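(* Let $k\ge0$ be an integer and let $$\Phi(\tau_1,z,\tau_2)=\sum_{\substack{n,m\in\mathbb Z_{\ge0},\, l\in\mathbb Z\\ 4nm\ge l^2}}c(n,l,m)\,q_1^n q_2^m\zeta^l$$ be a (holomorphic) Siegel modular form of genus $2$ and weight $2k$ for $\mathrm{Sp}_4(\mathbb Z)$, where $q_1=e^{2\pi i\tau_1}$, $q_2=e^{2\pi i\tau_2}$, $\zeta=e^{2\pi i z}$ and $\begin{pmatrix}\tau_1&z\\ z&\tau_2\end{pmatrix}$ lies in the Siegel upper half-space of degree $2$. If $c(n,l,m)\in\mathbb Z$ for all $m\le[\frac{k+1}{5}]$, $n\le[\frac{k+m}{6}]$ and $l^2\le 4nm$, then $c(n,l,m)\in\mathbb Z$ for all $n,l,m$, i.e. $\Phi$ has integral Fourier coefficients. Here $[x]$ is the integral part of $x$. *)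

theory Defs
  imports "HOL-Analysis.Analysis"
begin

text \<open>
  Matrices of size $4 \times 4$ are indexed by the sum type \<open>2 + 2\<close>, so that their four
  $2 \times 2$ blocks are selected by \<open>Inl\<close> and \<open>Inr\<close>.
\<close>

definition block_matrix ::
    "'a^2^2 \<Rightarrow> 'a^2^2 \<Rightarrow> 'a^2^2 \<Rightarrow> 'a^2^2 \<Rightarrow> 'a^(2 + 2)^(2 + 2)" where
  "block_matrix A B C D =
     (\<chi> a b. case (a, b) of
        (Inl i, Inl j) \<Rightarrow> A $ i $ j
      | (Inl i, Inr j) \<Rightarrow> B $ i $ j
      | (Inr i, Inl j) \<Rightarrow> C $ i $ j
      | (Inr i, Inr j) \<Rightarrow> D $ i $ j)"

definition symplectic_unit :: "int^(2 + 2)^(2 + 2)" where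
  "symplectic_unit = block_matrix 0 (mat 1) (- mat 1) 0"

definition Sp4Z :: "(int^(2 + 2)^(2 + 2)) set" where
  "Sp4Z = {M. transpose M ** symplectic_unit ** M = symplectic_unit}"

definition siegel_half_space :: "(complex^2^2) set" where
  "siegel_half_space =
     {Z. transpose Z = Z \<and>
         (\<forall>x::real^2. x \<noteq> 0 \<longrightarrow> x \<bullet> ((\<chi> i j. Im (Z $ i $ j)) *v x) > 0)}"

definition complex_block ::
    "(2 \<Rightarrow> 2 + 2) \<Rightarrow> (2 \<Rightarrow> 2 + 2) \<Rightarrow> int^(2 + 2)^(2 + 2) \<Rightarrow> complex^2^2" where
  "complex_block r s M = (\<chi> i j. of_int (M $ r i $ s j))"

definition automorphy_matrix :: "int^(2 + 2)^(2 + 2) \<Rightarrow> complex^2^2 \<Rightarrow> complex^2^2" where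
  "automorphy_matrix M Z = complex_block Inr Inl M ** Z + complex_block Inr Inr M"

definition symplectic_action :: "int^(2 + 2)^(2 + 2) \<Rightarrow> complex^2^2 \<Rightarrow> complex^2^2" where
  "symplectic_action M Z =
     (complex_block Inl Inl M ** Z + complex_block Inl Inr M) ** matrix_inv (automorphy_matrix M Z)"

definition period_matrix :: "complex \<Rightarrow> complex \<Rightarrow> complex \<Rightarrow> complex^2^2" where
  "period_matrix \<tau>\<^sub>1 z \<tau>\<^sub>2 = vector [vector [\<tau>\<^sub>1, z], vector [z, \<tau>\<^sub>2]]"

text \<open>
  Holomorphy on the half-space, in the coordinates $(\tau_1, z, \tau_2)$: the Frechet derivative
  exists at every point and is complex linear.
\<close>

definition holomorphic_on_siegel :: "(complex^2^2 \<Rightarrow> complex) \<Rightarrow> bool" where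
  "holomorphic_on_siegel \<Phi> \<longleftrightarrow>
     (\<forall>\<tau>\<^sub>1 z \<tau>\<^sub>2. period_matrix \<tau>\<^sub>1 z \<tau>\<^sub>2 \<in> siegel_half_space \<longrightarrow>
        (\<exists>a b c. ((\<lambda>(t, u, v). \<Phi> (period_matrix t u v))
                    has_derivative (\<lambda>(t, u, v). a * t + b * u + c * v)) (at (\<tau>\<^sub>1, z, \<tau>\<^sub>2))))"

text \<open>
  No growth condition at the cusps is imposed: in genus $2$ it follows from the Koecher principle.
\<close>

definition siegel_modular_form :: "nat \<Rightarrow> (complex^2^2 \<Rightarrow> complex) \<Rightarrow> bool" where
  "siegel_modular_form w \<Phi> \<longleftrightarrow>
     holomorphic_on_siegel \<Phi> \<and>
     (\<forall>M\<in>Sp4Z. \<forall>Z\<in>siegel_half_space.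
        \<Phi> (symplectic_action M Z) = det (automorphy_matrix M Z) ^ w * \<Phi> Z)"

definition fourier_index :: "(nat \<times> int \<times> nat) set" where
  "fourier_index = {(n, l, m). l\<^sup>2 \<le> 4 * int n * int m}"

definition has_fourier_expansion ::
    "(complex^2^2 \<Rightarrow> complex) \<Rightarrow> (nat \<Rightarrow> int \<Rightarrow> nat \<Rightarrow> complex) \<Rightarrow> bool" where
  "has_fourier_expansion \<Phi> c \<longleftrightarrow>
     (\<forall>\<tau>\<^sub>1 z \<tau>\<^sub>2. period_matrix \<tau>\<^sub>1 z \<tau>\<^sub>2 \<in> siegel_half_space \<longrightarrow>
        ((\<lambda>(n, l, m). c n l m * exp (2 * pi * \<i> * \<tau>\<^sub>1) ^ n * exp (2 * pi * \<i> * \<tau>\<^sub>2) ^ m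
                        * exp (2 * pi * \<i> * z) powi l)
           has_sum \<Phi> (period_matrix \<tau>\<^sub>1 z \<tau>\<^sub>2)) fourier_index)"

end

theory Submission
  imports Defs "HOL-Complex_Analysis.Complex_Analysis"
begin

text \<open>
  Write \<open>\<Phi> = \<Sum>\<^sub>m \<phi>\<^sub>m q\<^sub>2\<^sup>m\<close>. The heart of the matter is a statement about the Jacobi forms \<open>\<phi>\<^sub>m\<close> of weight
  \<open>2 k\<close> and index \<open>m\<close>: if the coefficients of \<open>q\<^sub>1\<^sup>n\<close> are integral for \<open>n \<le> (k + m) / 6\<close>, then all are.
  For \<open>m > (k + 1) / 5\<close> we have \<open>(k + m) / 6 < m\<close>, and the symmetry \<open>c(n, l, m) = c(m, l, n)\<close> finds the
  coefficients with \<open>n < m\<close> of \<open>\<phi>\<^sub>m\<close> among those of \<open>\<phi>\<^sub>n\<close>; so an induction on \<open>m\<close> applies.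

  For the statement on Jacobi forms, multiply by the \<open>k\<close>-th power of the form \<open>\<phi>(-2, 1)\<close>, which has
  weight \<open>-2\<close>, index \<open>1\<close> and leading coefficient \<open>X = \<zeta> - 2 + 1 / \<zeta>\<close>. This leads to weight \<open>0\<close> and index
  \<open>K = k + m\<close>. If such a form has order \<open>N\<close> in \<open>q\<close>, division by \<open>\<Delta>\<^sup>N\<close> and the absence of modular forms of
  negative weight and of weight \<open>2\<close> show that its leading coefficient is \<open>X\<^sup>6\<^sup>N R\<close> with a polynomial \<open>R\<close> in
  \<open>X\<close> of degree at most \<open>K - 6 N\<close> such that \<open>12 R'(0) = (K - 6 N) R(0)\<close>. An integral \<open>R\<close> with these properties is
  the constant term of an integral polynomial in Gritsenko's forms of weight \<open>0\<close> and index \<open>1, 2, 3, 4\<close>,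
  whose constant terms are \<open>X + 12\<close>, \<open>X + 6\<close>, \<open>X + 4\<close>, \<open>X + 3\<close>. Subtracting the product of that polynomial
  with the \<open>N\<close>-th power of \<open>\<Delta> \<phi>(-2, 1)\<^sup>6 = q X\<^sup>6 + \<dots>\<close> raises the order. Once \<open>N > K / 6\<close>, nothing is left.
\<close>

section \<open>Power series with polynomial coefficients\<close>

text \<open>Integrality must survive the passage to weight 0 in both directions. It does: the k-th
  power of \<phi>(-2, 1) is X^k times an integral series in q with constant term 1, and \<zeta>^l +
  \<zeta>^(-l) with l > 0 is a monic integral polynomial in X, so that coefficients in \<zeta> and
  in X are integral together. The bound K / 6 is a clash of two estimates for a leading coefficient
  of order N: it is divisible by X^(6 N), and its degree is at most K. The 12 is that of the
  quasimodular form E2. An integral solution (a, b) of 12 b = K a is a multiple of (12, K) / gcd(12,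
  K), and Gritsenko's forms reach exactly this vector; otherwise a denominator would remain. All
  analysis of theta functions is reduced to one inversion law, that of \<phi>(-2, 1), which a
  Liouville argument extracts from its product. The other forms, \<Delta> included, are built from
  the translates of this function by points of order two and its values there, and inherit the
  law.\<close>

definition pnorm :: "real \<Rightarrow> complex poly \<Rightarrow> real" where
  "pnorm s p = poly (map_poly norm p) s"

lemma pnorm_0 [simp]: "pnorm s 0 = 0"
  by (simp add: pnorm_def)

lemma pnorm_pCons [simp]: "pnorm s (pCons a p) = norm a + s * pnorm s p"
  by (cases "a = 0 \<and> p = 0") (auto simp: pnorm_def map_poly_pCons)

lemma pnorm_1 [simp]: "pnorm s 1 = 1"
  by (simp add: one_pCons)

lemma pnorm_nonneg: "0 \<le> s \<Longrightarrow> 0 \<le> pnorm s p"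
  by (induction p) auto

lemma pnorm_add: "0 \<le> s \<Longrightarrow> pnorm s (p + q) \<le> pnorm s p + pnorm s q"
proof (induction p q rule: poly_induct2)
  case (pCons a p b q)
  have "norm (a + b) \<le> norm a + norm b" by (rule norm_triangle_ineq)
  moreover have "s * pnorm s (p + q) \<le> s * (pnorm s p + pnorm s q)"
    using pCons by (intro mult_left_mono) auto
  ultimately show ?case by (simp add: algebra_simps)
qed auto

lemma pnorm_smult: "pnorm s (smult c p) = norm c * pnorm s p"
  by (induction p) (auto simp: algebra_simps norm_mult)

lemma pnorm_minus [simp]: "pnorm s (- p) = pnorm s p"
  by (induction p) auto

lemma pnorm_diff: "0 \<le> s \<Longrightarrow> pnorm s (p - q) \<le> pnorm s p + pnorm s q"
  using pnorm_add[of s p "- q"] by simp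

lemma pnorm_mult: "0 \<le> s \<Longrightarrow> pnorm s (p * q) \<le> pnorm s p * pnorm s q"
proof (induction p)
  case (pCons a p)
  have "pnorm s (pCons a p * q) \<le> norm a * pnorm s q + s * pnorm s (p * q)"
    using pnorm_add[OF pCons.prems, of "smult a q" "pCons 0 (p * q)"] by (simp add: pnorm_smult)
  also have "\<dots> \<le> norm a * pnorm s q + s * (pnorm s p * pnorm s q)"
    using pCons by (intro add_left_mono mult_left_mono) auto
  finally show ?case by (simp add: algebra_simps)
qed simp

lemma pnorm_sum: "0 \<le> s \<Longrightarrow> pnorm s (sum f I) \<le> (\<Sum>i\<in>I. pnorm s (f i))"
proof (induction I rule: infinite_finite_induct)
  case (insert x F)
  then show ?case using pnorm_add[of s "f x" "sum f F"] by auto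
qed auto

lemma norm_poly_le: "norm x \<le> s \<Longrightarrow> norm (poly p x) \<le> pnorm s p"
proof (induction p)
  case (pCons a p)
  have "norm (poly (pCons a p) x) \<le> norm a + norm x * norm (poly p x)"
    using norm_triangle_ineq[of a "x * poly p x"] by (simp add: norm_mult)
  also have "\<dots> \<le> norm a + s * pnorm s p"
    using pCons order_trans[OF norm_ge_zero[of x] pCons.prems] by (intro add_left_mono mult_mono) auto
  finally show ?case by simp
qed simp

text \<open>
  A power series in \<open>q\<close> whose coefficients are polynomials in \<open>X\<close> is \<open>conv\<close> if it converges
  absolutely, as a double series, for \<open>\<bar>q\<bar> < 1\<close> and all \<open>X\<close>.
\<close>

definition conv :: "complex poly fps \<Rightarrow> bool" where
  "conv A \<longleftrightarrow> (\<forall>r s. 0 \<le> r \<longrightarrow> r < 1 \<longrightarrow> 0 \<le> s \<longrightarrow> summable (\<lambda>n. pnorm s (fps_nth A n) * r ^ n))"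

text \<open>For fixed radii r of q and s of X this is a submultiplicative norm; it makes the
  infinite products converge uniformly.\<close>

definition fnorm :: "real \<Rightarrow> real \<Rightarrow> complex poly fps \<Rightarrow> real" where
  "fnorm r s A = (\<Sum>n. pnorm s (fps_nth A n) * r ^ n)"

definition ev :: "complex poly fps \<Rightarrow> complex \<Rightarrow> complex \<Rightarrow> complex" where
  "ev A q X = (\<Sum>n. poly (fps_nth A n) X * q ^ n)"

lemma convD: "conv A \<Longrightarrow> 0 \<le> r \<Longrightarrow> r < 1 \<Longrightarrow> 0 \<le> s \<Longrightarrow> summable (\<lambda>n. pnorm s (fps_nth A n) * r ^ n)"
  by (auto simp: conv_def)

lemma convI: "(\<And>r s. 0 \<le> r \<Longrightarrow> r < 1 \<Longrightarrow> 0 \<le> s \<Longrightarrow> summable (\<lambda>n. pnorm s (fps_nth A n) * r ^ n)) \<Longrightarrow> conv A"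
  by (auto simp: conv_def)

lemma ev_abs_summable:
  assumes "conv A" "norm q < 1"
  shows "summable (\<lambda>n. norm (poly (fps_nth A n) X * q ^ n))"
proof (rule summable_comparison_test'[where N = 0])
  show "summable (\<lambda>n. pnorm (norm X) (fps_nth A n) * norm q ^ n)"
    using assms by (intro convD) auto
  show "norm (norm (poly (fps_nth A n) X * q ^ n)) \<le> pnorm (norm X) (fps_nth A n) * norm q ^ n" for n
    by (auto simp: norm_mult norm_power intro!: mult_right_mono norm_poly_le)
qed

lemma ev_sums: "conv A \<Longrightarrow> norm q < 1 \<Longrightarrow> (\<lambda>n. poly (fps_nth A n) X * q ^ n) sums ev A q X"
  unfolding ev_def by (rule summable_sums, rule summable_norm_cancel, rule ev_abs_summable)

lemma norm_ev_le:
  assumes "conv A" "norm q \<le> r" "r < 1" "norm X \<le> s"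
  shows "norm (ev A q X) \<le> fnorm r s A"
proof -
  have s: "0 \<le> s" and r: "0 \<le> r" using assms(2,4) norm_ge_zero order_trans by blast+
  show ?thesis unfolding ev_def fnorm_def
  proof (rule norm_suminf_le)
    show "norm (poly (fps_nth A n) X * q ^ n) \<le> pnorm s (fps_nth A n) * r ^ n" for n
      using assms s by (auto simp: norm_mult norm_power intro!: mult_mono norm_poly_le power_mono pnorm_nonneg)
    show "summable (\<lambda>n. pnorm s (fps_nth A n) * r ^ n)"
      using assms r s by (intro convD) auto
  qed
qed

lemma conv_const [simp]: "conv (fps_const p)"
proof (rule convI)
  fix r s :: real
  show "summable (\<lambda>n. pnorm s (fps_nth (fps_const p) n) * r ^ n)"
    by (rule summable_finite[of "{0}"]) (auto simp: fps_const_def)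
qed

lemma conv_0 [simp]: "conv 0" and conv_1 [simp]: "conv 1"
  using conv_const[of 0] conv_const[of 1] by simp_all

lemma conv_X [simp]: "conv fps_X"
proof (rule convI)
  fix r s :: real
  show "summable (\<lambda>n. pnorm s (fps_nth fps_X n) * r ^ n)"
    by (rule summable_finite[of "{1}"]) (auto simp: fps_X_def)
qed

lemma conv_add [intro]: assumes "conv A" "conv B" shows "conv (A + B)"
proof (rule convI)
  fix r s :: real assume *: "0 \<le> r" "r < 1" "0 \<le> s"
  show "summable (\<lambda>n. pnorm s (fps_nth (A + B) n) * r ^ n)"
    using summable_add[OF convD[OF assms(1) *] convD[OF assms(2) *]]
  proof (rule summable_comparison_test'[where N = 0])
    show "norm (pnorm s (fps_nth (A + B) n) * r ^ n) \<le> pnorm s (fps_nth A n) * r ^ n + pnorm s (fps_nth B n) * r ^ n" for n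
      using * pnorm_add[of s "fps_nth A n" "fps_nth B n"]
      by (auto simp: abs_mult pnorm_nonneg simp flip: distrib_right intro!: mult_right_mono)
  qed
qed

lemma conv_minus [intro]: "conv A \<Longrightarrow> conv (- A)"
  by (simp add: conv_def)

lemma conv_diff [intro]: "conv A \<Longrightarrow> conv B \<Longrightarrow> conv (A - B)"
  using conv_add[of A "- B"] conv_minus[of B] by simp

lemma pnorm_nth_mult:
  assumes "0 \<le> s" "0 \<le> r"
  shows "pnorm s (fps_nth (A * B) n) * r ^ n
    \<le> (\<Sum>i\<le>n. (pnorm s (fps_nth A i) * r ^ i) * (pnorm s (fps_nth B (n - i)) * r ^ (n - i)))"
proof -
  have "pnorm s (fps_nth (A * B) n) \<le> (\<Sum>i\<le>n. pnorm s (fps_nth A i) * pnorm s (fps_nth B (n - i)))"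
    unfolding fps_mult_nth atLeast0AtMost
    by (rule order.trans[OF pnorm_sum sum_mono]) (use assms pnorm_mult in auto)
  then have "pnorm s (fps_nth (A * B) n) * r ^ n \<le> (\<Sum>i\<le>n. pnorm s (fps_nth A i) * pnorm s (fps_nth B (n - i))) * r ^ n"
    using assms by (intro mult_right_mono) auto
  also have "\<dots> = (\<Sum>i\<le>n. (pnorm s (fps_nth A i) * r ^ i) * (pnorm s (fps_nth B (n - i)) * r ^ (n - i)))"
    unfolding sum_distrib_right
  proof (rule sum.cong)
    fix i assume "i \<in> {..n}"
    then have "r ^ n = r ^ i * r ^ (n - i)" by (simp flip: power_add)
    then show "pnorm s (fps_nth A i) * pnorm s (fps_nth B (n - i)) * r ^ n =
         pnorm s (fps_nth A i) * r ^ i * (pnorm s (fps_nth B (n - i)) * r ^ (n - i))" by simp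
  qed simp
  finally show ?thesis .
qed

lemma
  assumes "conv A" "conv B"
  shows conv_mult [intro]: "conv (A * B)"
    and fnorm_mult: "0 \<le> r \<Longrightarrow> r < 1 \<Longrightarrow> 0 \<le> s \<Longrightarrow> fnorm r s (A * B) \<le> fnorm r s A * fnorm r s B"
proof -
  have *: "summable (\<lambda>n. pnorm s (fps_nth (A * B) n) * r ^ n) \<and> fnorm r s (A * B) \<le> fnorm r s A * fnorm r s B"
    if "0 \<le> r" "r < 1" "0 \<le> s" for r s :: real
  proof -
    let ?a = "\<lambda>i. pnorm s (fps_nth A i) * r ^ i" and ?b = "\<lambda>i. pnorm s (fps_nth B i) * r ^ i"
    have nn: "norm (?a i) = ?a i" "norm (?b i) = ?b i" for i using that by (auto simp: abs_mult pnorm_nonneg)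
    have sa: "summable (\<lambda>i. norm (?a i))" "summable (\<lambda>i. norm (?b i))"
      unfolding nn using convD assms that by blast+
    have "(\<lambda>n. \<Sum>i\<le>n. ?a i * ?b (n - i)) sums (fnorm r s A * fnorm r s B)"
      unfolding fnorm_def using Cauchy_product_sums[OF sa] .
    moreover have "summable (\<lambda>n. pnorm s (fps_nth (A * B) n) * r ^ n)"
      using sums_summable[OF calculation]
      by (rule summable_comparison_test'[where N = 0])
         (use pnorm_nth_mult[of s r A B] that in \<open>auto simp: abs_mult pnorm_nonneg\<close>)
    ultimately show ?thesis using pnorm_nth_mult[of s r A B] that
      unfolding fnorm_def[of r s "A * B"] by (metis (no_types, lifting) sums_iff suminf_le)
  qed
  then show "conv (A * B)" by (auto intro!: convI)
  from * show "0 \<le> r \<Longrightarrow> r < 1 \<Longrightarrow> 0 \<le> s \<Longrightarrow> fnorm r s (A * B) \<le> fnorm r s A * fnorm r s B" by blast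
qed

lemma conv_power [intro]: "conv A \<Longrightarrow> conv (A ^ n)"
  by (induction n) auto

lemma conv_prod: "(\<And>i. i \<in> I \<Longrightarrow> conv (f i)) \<Longrightarrow> conv (prod f I)"
  by (induction I rule: infinite_finite_induct) auto

lemma fnorm_nonneg: "conv A \<Longrightarrow> 0 \<le> r \<Longrightarrow> r < 1 \<Longrightarrow> 0 \<le> s \<Longrightarrow> 0 \<le> fnorm r s A"
  unfolding fnorm_def by (intro suminf_nonneg convD) (auto simp: pnorm_nonneg)

lemma fnorm_add:
  assumes "conv A" "conv B" "0 \<le> r" "r < 1" "0 \<le> s"
  shows "fnorm r s (A + B) \<le> fnorm r s A + fnorm r s B"
proof -
  have "fnorm r s (A + B) \<le> (\<Sum>n. pnorm s (fps_nth A n) * r ^ n + pnorm s (fps_nth B n) * r ^ n)"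
    unfolding fnorm_def
    using assms by (intro suminf_le convD summable_add) 
      (auto simp: pnorm_add simp flip: distrib_right intro!: mult_right_mono)
  then show ?thesis unfolding fnorm_def using assms by (simp add: suminf_add convD)
qed

lemma fnorm_minus [simp]: "fnorm r s (- A) = fnorm r s A"
  by (simp add: fnorm_def)

lemma fnorm_const: "fnorm r s (fps_const p) = pnorm s p"
proof -
  have "(\<lambda>n. pnorm s (fps_nth (fps_const p) n) * r ^ n) sums (\<Sum>n\<in>{0}. pnorm s (fps_nth (fps_const p) n) * r ^ n)"
    by (rule sums_finite) (auto simp: fps_const_def)
  then show ?thesis by (simp add: fnorm_def sums_iff)
qed

lemma fnorm_1 [simp]: "fnorm r s 1 = 1"
  using fnorm_const[of r s 1] by simp

lemma fnorm_X: "fnorm r s fps_X = r"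
proof -
  have "(\<lambda>n. pnorm s (fps_nth fps_X n) * r ^ n) sums (\<Sum>n\<in>{1}. pnorm s (fps_nth fps_X n) * r ^ n)"
    by (rule sums_finite) (auto simp: fps_X_def)
  then show ?thesis by (simp add: fnorm_def sums_iff)
qed

lemma fnorm_power:
  assumes "conv A" "0 \<le> r" "r < 1" "0 \<le> s"
  shows "fnorm r s (A ^ n) \<le> fnorm r s A ^ n"
proof (induction n)
  case (Suc n)
  have "fnorm r s (A ^ Suc n) \<le> fnorm r s A * fnorm r s (A ^ n)"
    using assms by (auto intro!: fnorm_mult)
  also have "\<dots> \<le> fnorm r s A * fnorm r s A ^ n"
    using Suc assms by (intro mult_left_mono fnorm_nonneg) auto
  finally show ?case by simp
qed simp

lemma ev_const [simp]: "ev (fps_const p) q X = poly p X"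
proof -
  have "(\<lambda>n. poly (fps_nth (fps_const p) n) X * q ^ n) sums (\<Sum>n\<in>{0}. poly (fps_nth (fps_const p) n) X * q ^ n)"
    by (rule sums_finite) (auto simp: fps_const_def)
  then show ?thesis by (simp add: ev_def sums_iff)
qed

lemma ev_0 [simp]: "ev 0 q X = 0" and ev_1 [simp]: "ev 1 q X = 1"
  using ev_const[of 0] ev_const[of 1] by simp_all

lemma ev_X [simp]: "ev fps_X q X = q"
proof -
  have "(\<lambda>n. poly (fps_nth fps_X n) X * q ^ n) sums (\<Sum>n\<in>{1}. poly (fps_nth fps_X n) X * q ^ n)"
    by (rule sums_finite) (auto simp: fps_X_def)
  then show ?thesis by (simp add: ev_def sums_iff)
qed

lemma ev_add: "conv A \<Longrightarrow> conv B \<Longrightarrow> norm q < 1 \<Longrightarrow> ev (A + B) q X = ev A q X + ev B q X"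
  using sums_add[OF ev_sums[of A q X] ev_sums[of B q X]] by (simp add: ev_def sums_iff algebra_simps)

lemma ev_minus: "conv A \<Longrightarrow> norm q < 1 \<Longrightarrow> ev (- A) q X = - ev A q X"
  using sums_minus[OF ev_sums[of A q X]] by (simp add: ev_def sums_iff algebra_simps)

lemma ev_diff: "conv A \<Longrightarrow> conv B \<Longrightarrow> norm q < 1 \<Longrightarrow> ev (A - B) q X = ev A q X - ev B q X"
  using ev_add[of A "- B" q X] by (simp add: conv_minus ev_minus)

lemma ev_mult:
  assumes "conv A" "conv B" "norm q < 1"
  shows "ev (A * B) q X = ev A q X * ev B q X"
proof -
  have "(\<lambda>n. \<Sum>i\<le>n. (poly (fps_nth A i) X * q ^ i) * (poly (fps_nth B (n - i)) X * q ^ (n - i))) sums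
      (ev A q X * ev B q X)"
    unfolding ev_def using assms by (intro Cauchy_product_sums ev_abs_summable)
  also have "(\<lambda>n. \<Sum>i\<le>n. (poly (fps_nth A i) X * q ^ i) * (poly (fps_nth B (n - i)) X * q ^ (n - i))) =
      (\<lambda>n. poly (fps_nth (A * B) n) X * q ^ n)"
  proof
    fix n
    have "(\<Sum>i\<le>n. (poly (fps_nth A i) X * q ^ i) * (poly (fps_nth B (n - i)) X * q ^ (n - i))) =
       (\<Sum>i\<le>n. poly (fps_nth A i) X * poly (fps_nth B (n - i)) X * q ^ n)"
    proof (rule sum.cong)
      fix i assume "i \<in> {..n}"
      then have "q ^ n = q ^ i * q ^ (n - i)" by (simp flip: power_add)
      then show "poly (fps_nth A i) X * q ^ i * (poly (fps_nth B (n - i)) X * q ^ (n - i)) =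
         poly (fps_nth A i) X * poly (fps_nth B (n - i)) X * q ^ n" by simp
    qed simp
    then show "(\<Sum>i\<le>n. (poly (fps_nth A i) X * q ^ i) * (poly (fps_nth B (n - i)) X * q ^ (n - i))) =
      poly (fps_nth (A * B) n) X * q ^ n"
      by (simp add: fps_mult_nth atLeast0AtMost poly_sum sum_distrib_right)
  qed
  finally show ?thesis unfolding ev_def[of "A * B"] by (rule sums_unique[symmetric])
qed

lemma ev_power: "conv A \<Longrightarrow> norm q < 1 \<Longrightarrow> ev (A ^ n) q X = ev A q X ^ n"
  by (induction n) (auto simp: ev_mult conv_power)

lemma ev_prod: "(\<And>i. i \<in> I \<Longrightarrow> conv (f i)) \<Longrightarrow> norm q < 1 \<Longrightarrow> ev (prod f I) q X = (\<Prod>i\<in>I. ev (f i) q X)"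
  by (induction I rule: infinite_finite_induct) (auto simp: ev_mult conv_prod)

section \<open>Integrality of coefficients\<close>

definition ipoly :: "complex poly \<Rightarrow> bool" where "ipoly p \<longleftrightarrow> (\<forall>i. coeff p i \<in> \<int>)"

definition ifps :: "complex poly fps \<Rightarrow> bool" where "ifps A \<longleftrightarrow> (\<forall>n. ipoly (fps_nth A n))"

lemma ipoly_pCons [simp]: "ipoly (pCons a p) \<longleftrightarrow> a \<in> \<int> \<and> ipoly p"
proof
  assume *: "ipoly (pCons a p)"
  have "coeff p i \<in> \<int>" for i using *[unfolded ipoly_def, rule_format, of "Suc i"] by simp
  then show "a \<in> \<int> \<and> ipoly p" using *[unfolded ipoly_def, rule_format, of 0] by (simp add: ipoly_def)
qed (auto simp: ipoly_def coeff_pCons split: nat.splits)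

lemma ipoly_0 [simp]: "ipoly 0" by (simp add: ipoly_def)
lemma ipoly_1 [simp]: "ipoly 1" by (simp add: one_pCons)
lemma ipoly_add: "ipoly p \<Longrightarrow> ipoly q \<Longrightarrow> ipoly (p + q)" by (simp add: ipoly_def)
lemma ipoly_minus: "ipoly p \<Longrightarrow> ipoly (- p)" by (simp add: ipoly_def)
lemma ipoly_diff: "ipoly p \<Longrightarrow> ipoly q \<Longrightarrow> ipoly (p - q)" by (simp add: ipoly_def)
lemma ipoly_sum: "(\<And>i. i \<in> I \<Longrightarrow> ipoly (f i)) \<Longrightarrow> ipoly (sum f I)"
  by (auto simp: ipoly_def coeff_sum intro!: Ints_sum)
lemma ipoly_mult: "ipoly p \<Longrightarrow> ipoly q \<Longrightarrow> ipoly (p * q)"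
  unfolding ipoly_def coeff_mult by (auto intro!: Ints_sum)
lemma ipoly_smult: "c \<in> \<int> \<Longrightarrow> ipoly p \<Longrightarrow> ipoly (smult c p)" by (simp add: ipoly_def)

lemma ifps_const [simp]: "ifps (fps_const p) \<longleftrightarrow> ipoly p"
  by (auto simp: ifps_def fps_const_def)
lemma ifps_0 [simp]: "ifps 0" and ifps_1 [simp]: "ifps 1"
  using ifps_const[of 0] ifps_const[of 1] by simp_all
lemma ifps_X [simp]: "ifps fps_X" by (auto simp: ifps_def fps_X_def)
lemma ifps_add: "ifps A \<Longrightarrow> ifps B \<Longrightarrow> ifps (A + B)" by (simp add: ifps_def ipoly_add)
lemma ifps_minus: "ifps A \<Longrightarrow> ifps (- A)" by (simp add: ifps_def ipoly_minus)
lemma ifps_diff: "ifps A \<Longrightarrow> ifps B \<Longrightarrow> ifps (A - B)" by (simp add: ifps_def ipoly_diff)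
lemma ifps_mult: "ifps A \<Longrightarrow> ifps B \<Longrightarrow> ifps (A * B)"
  unfolding ifps_def fps_mult_nth by (auto intro!: ipoly_sum ipoly_mult)
lemma ifps_power: "ifps A \<Longrightarrow> ifps (A ^ n)" by (induction n) (auto intro: ifps_mult)
lemma ifps_prod: "(\<And>i. i \<in> I \<Longrightarrow> ifps (f i)) \<Longrightarrow> ifps (prod f I)"
  by (induction I rule: infinite_finite_induct) (auto intro: ifps_mult)

lemmas conv_intros = conv_const conv_0 conv_1 conv_X conv_add conv_minus conv_diff conv_mult conv_power
lemmas ifps_intros = ifps_0 ifps_1 ifps_X ifps_add ifps_minus ifps_diff ifps_mult ifps_power
lemmas ev_simps = ev_add ev_minus ev_diff ev_mult ev_power conv_intros

section \<open>Infinite products\<close>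

text \<open>Under \<open>lowU\<close> the factor number n changes only coefficients of order above
  n, so the coefficient of order i is final after the first i factors.\<close>

definition infprod :: "(nat \<Rightarrow> complex poly fps) \<Rightarrow> complex poly fps" where
  "infprod U = Abs_fps (\<lambda>i. fps_nth (\<Prod>n<i. 1 + U n) i)"

locale fps_product =
  fixes U :: "nat \<Rightarrow> complex poly fps"
  assumes convU: "\<And>n. conv (U n)"
    and lowU: "\<And>n i. i \<le> n \<Longrightarrow> fps_nth (U n) i = 0"
    and summU: "\<And>r s. 0 \<le> r \<Longrightarrow> r < 1 \<Longrightarrow> 0 \<le> s \<Longrightarrow> summable (\<lambda>n. fnorm r s (U n))"
begin

abbreviation partial :: "nat \<Rightarrow> complex poly fps" where
  "partial N \<equiv> (\<Prod>n<N. 1 + U n)"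

lemma nth_infprod: "i \<le> N \<Longrightarrow> fps_nth (infprod U) i = fps_nth (partial N) i"
proof (induction N)
  case (Suc N)
  show ?case
  proof (cases "i = Suc N")
    case False
    then have "i \<le> N" using Suc by simp
    moreover from this have "fps_nth (partial N * U N) i = 0"
      by (auto simp: fps_mult_nth lowU)
    ultimately show ?thesis using Suc by (simp add: distrib_left)
  qed (simp add: infprod_def)
qed (simp add: infprod_def)

lemma conv_partial: "conv (partial N)"
  by (intro conv_prod conv_add convU) simp

lemma fnorm_partial:
  assumes "0 \<le> r" "r < 1" "0 \<le> s"
  shows "fnorm r s (partial N) \<le> exp (\<Sum>n. fnorm r s (U n))"
proof -
  have nn: "0 \<le> fnorm r s (U n)" for n using assms by (intro fnorm_nonneg convU)
  have "fnorm r s (partial N) \<le> exp (\<Sum>n<N. fnorm r s (U n))"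
  proof (induction N)
    case (Suc N)
    have "fnorm r s (partial (Suc N)) \<le> fnorm r s (partial N) * fnorm r s (1 + U N)"
      using fnorm_mult[OF conv_partial[of N] conv_add[OF conv_1 convU[of N]]] assms by simp
    also have "\<dots> \<le> exp (\<Sum>n<N. fnorm r s (U n)) * exp (fnorm r s (U N))"
    proof (intro mult_mono Suc)
      show "fnorm r s (1 + U N) \<le> exp (fnorm r s (U N))"
        using fnorm_add[OF conv_1 convU[of N] assms] exp_ge_add_one_self[of "fnorm r s (U N)"]
        unfolding fnorm_1 by linarith
      show "0 \<le> fnorm r s (1 + U N)" using assms by (intro fnorm_nonneg conv_add convU) auto
    qed auto
    finally show ?case by (simp add: exp_add)
  qed simp
  also have "\<dots> \<le> exp (\<Sum>n. fnorm r s (U n))"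
    using summU[OF assms] nn by (simp add: sum_le_suminf)
  finally show ?thesis .
qed

lemma conv_infprod: "conv (infprod U)"
proof (rule convI)
  fix r s :: real assume *: "0 \<le> r" "r < 1" "0 \<le> s"
  show "summable (\<lambda>n. pnorm s (fps_nth (infprod U) n) * r ^ n)"
  proof (rule summableI_nonneg_bounded[where x = "exp (\<Sum>n. fnorm r s (U n))"])
    fix N
    have "(\<Sum>n<N. pnorm s (fps_nth (infprod U) n) * r ^ n) = (\<Sum>n<N. pnorm s (fps_nth (partial N) n) * r ^ n)"
      by (intro sum.cong refl) (simp add: nth_infprod[where N = N])
    also have "\<dots> \<le> fnorm r s (partial N)"
      unfolding fnorm_def using * by (intro sum_le_suminf convD conv_partial) (auto simp: pnorm_nonneg)
    finally show "(\<Sum>n<N. pnorm s (fps_nth (infprod U) n) * r ^ n) \<le> exp (\<Sum>n. fnorm r s (U n))"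
      using fnorm_partial[OF *] by (rule order.trans)
  qed (use * in \<open>auto simp: pnorm_nonneg\<close>)
qed

lemma ifps_infprod: "(\<And>n. ifps (U n)) \<Longrightarrow> ifps (infprod U)"
proof -
  assume "\<And>n. ifps (U n)"
  then have "ifps (partial N)" for N by (intro ifps_prod ifps_add) auto
  then show ?thesis by (auto simp: ifps_def infprod_def)
qed

text \<open>The difference to the N-th partial product starts beyond order N. Measured at a radius r
  strictly between the modulus of q and 1, its norm is bounded uniformly in N, and going back to q
  gains the factor x^N.\<close>

lemma ev_infprod:
  assumes q: "norm q < 1"
  shows "(\<lambda>N. \<Prod>n<N. 1 + ev (U n) q X) \<longlonglongrightarrow> ev (infprod U) q X"
proof -
  define r where "r = (1 + norm q) / 2"
  define s where "s = norm X"
  define M where "M = exp (\<Sum>n. fnorm r s (U n)) + fnorm r s (infprod U)"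
  have r: "0 < r" "r < 1" "norm q < r" using q norm_ge_zero[of q] by (auto simp: r_def simp del: norm_ge_zero)
  have s: "0 \<le> s" "norm X \<le> s" by (auto simp: s_def)
  have evp: "ev (partial N) q X = (\<Prod>n<N. 1 + ev (U n) q X)" for N
    using q by (simp add: ev_prod conv_add convU ev_add)
  define x where "x = norm q / r"
  have x: "0 \<le> x" "x < 1" using r by (auto simp: x_def)
  have qx: "norm q = r * x" using r by (simp add: x_def)
  have bound: "norm (ev (partial N - infprod U) q X) \<le> M * x ^ N" for N
  proof -
    let ?D = "partial N - infprod U"
    have cD: "conv ?D" by (intro conv_diff conv_partial conv_infprod)
    have "norm (ev ?D q X) \<le> (\<Sum>n. pnorm s (fps_nth ?D n) * r ^ n * x ^ N)"
      unfolding ev_def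
    proof (rule norm_suminf_le)
      show "summable (\<lambda>n. pnorm s (fps_nth ?D n) * r ^ n * x ^ N)"
        using r s by (intro summable_mult2 convD cD) auto
      show "norm (poly (fps_nth ?D n) X * q ^ n) \<le> pnorm s (fps_nth ?D n) * r ^ n * x ^ N" for n
      proof (cases "n \<le> N")
        case False
        have "norm (poly (fps_nth ?D n) X * q ^ n) = norm (poly (fps_nth ?D n) X) * r ^ n * x ^ n"
          by (simp add: norm_mult norm_power qx power_mult_distrib)
        also have "\<dots> \<le> pnorm s (fps_nth ?D n) * r ^ n * x ^ N"
          using s r x False by (intro mult_mono norm_poly_le power_decreasing mult_nonneg_nonneg pnorm_nonneg) auto
        finally show ?thesis .
      qed (simp add: nth_infprod)
    qed
    also have "\<dots> = fnorm r s ?D * x ^ N"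
      unfolding fnorm_def using r s by (intro suminf_mult2[symmetric] convD cD) auto
    also have "\<dots> \<le> M * x ^ N"
    proof (rule mult_right_mono)
      have "fnorm r s ?D \<le> fnorm r s (partial N) + fnorm r s (infprod U)"
        using fnorm_add[OF conv_partial[of N] conv_minus[OF conv_infprod], of r s] r s by simp
      also have "\<dots> \<le> M" unfolding M_def using fnorm_partial[of r s N] r s by simp
      finally show "fnorm r s ?D \<le> M" .
    qed (use x in simp)
    finally show ?thesis .
  qed
  have "(\<lambda>N. M * x ^ N) \<longlonglongrightarrow> M * 0"
    using x by (intro tendsto_mult LIMSEQ_power_zero tendsto_const) auto
  then have "(\<lambda>N. ev (partial N - infprod U) q X) \<longlonglongrightarrow> 0"
    unfolding mult_zero_right by (rule Lim_null_comparison[OF always_eventually[OF allI[OF bound]]])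
  then have "(\<lambda>N. ev (partial N) q X - ev (infprod U) q X) \<longlonglongrightarrow> 0"
    unfolding ev_diff[OF conv_partial conv_infprod q] .
  then show ?thesis unfolding evp by (rule LIM_zero_cancel)
qed

text \<open>An absolutely convergent product vanishes only if a factor does; this will locate the
  zeros of \<open>kap\<close>.\<close>

lemma ev_infprod_nonzero:
  assumes q: "norm q < 1" and nz: "\<And>n. 1 + ev (U n) q X \<noteq> 0"
  shows "ev (infprod U) q X \<noteq> 0"
proof -
  let ?f = "\<lambda>n. 1 + ev (U n) q X"
  have "summable (\<lambda>n. norm (ev (U n) q X))"
  proof (rule summable_comparison_test'[where N = 0])
    show "summable (\<lambda>n. fnorm (norm q) (norm X) (U n))" using q by (intro summU) auto
    show "norm (norm (ev (U n) q X)) \<le> fnorm (norm q) (norm X) (U n)" for n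
      using norm_ev_le[OF convU[of n], of q "norm q" X "norm X"] q by simp
  qed
  then have "abs_convergent_prod ?f" by (intro summable_imp_abs_convergent_prod) simp
  then have c: "convergent_prod ?f" by (rule abs_convergent_prod_imp_convergent_prod)
  have "(\<lambda>N. \<Prod>n\<le>N. ?f n) \<longlonglongrightarrow> ev (infprod U) q X"
    using LIMSEQ_Suc[OF ev_infprod[OF q, of X]] by (simp add: lessThan_Suc_atMost)
  with convergent_prod_LIMSEQ[OF c] have "ev (infprod U) q X = prodinf ?f" by (rule LIMSEQ_unique[symmetric])
  with prodinf_nonzero[OF c nz] show ?thesis by simp
qed

end

text \<open>The exponents e n > n serve twice: they give the order condition \<open>lowU\<close>
  and, as the G n are bounded uniformly in n, a geometric majorant.\<close>

lemma fps_productI: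
  assumes "\<And>n. conv (G n)" "\<And>n r s. 0 \<le> r \<Longrightarrow> r < 1 \<Longrightarrow> 0 \<le> s \<Longrightarrow> fnorm r s (G n) \<le> M r s"
    and e: "\<And>n. n < e n"
  shows "fps_product (\<lambda>n. fps_X ^ e n * (fps_const p * G n))"
proof
  show "conv (fps_X ^ e n * (fps_const p * G n))" for n using assms by (intro conv_intros)
  show "i \<le> n \<Longrightarrow> fps_nth (fps_X ^ e n * (fps_const p * G n)) i = 0" for n i
    using e[of n] by (simp add: fps_X_power_mult_nth)
  fix r s :: real assume *: "0 \<le> r" "r < 1" "0 \<le> s"
  have M: "0 \<le> M r s" using order.trans[OF fnorm_nonneg[OF assms(1) *] assms(2)[OF *]] .
  show "summable (\<lambda>n. fnorm r s (fps_X ^ e n * (fps_const p * G n)))"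
  proof (rule summable_comparison_test'[where N = 0])
    show "summable (\<lambda>n. r ^ n * (pnorm s p * M r s))"
      using * by (intro summable_mult2 summable_geometric) auto
    fix n
    have "fnorm r s (fps_X ^ e n * (fps_const p * G n)) \<le> fnorm r s (fps_X ^ e n) * fnorm r s (fps_const p * G n)"
      by (rule fnorm_mult) (use * assms in \<open>auto intro!: conv_intros\<close>)
    also have "\<dots> \<le> r ^ n * (pnorm s p * M r s)"
    proof (rule mult_mono)
      have "fnorm r s (fps_X ^ e n) \<le> r ^ e n" using fnorm_power[OF conv_X *, of "e n"] by (simp add: fnorm_X)
      also have "\<dots> \<le> r ^ n" using * e[of n] by (intro power_decreasing) auto
      finally show "fnorm r s (fps_X ^ e n) \<le> r ^ n" .
      have "fnorm r s (fps_const p * G n) \<le> pnorm s p * fnorm r s (G n)"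
        using fnorm_mult[OF conv_const assms(1) *] by (simp add: fnorm_const)
      also have "\<dots> \<le> pnorm s p * M r s" using assms(2)[OF *] * by (intro mult_left_mono pnorm_nonneg) auto
      finally show "fnorm r s (fps_const p * G n) \<le> pnorm s p * M r s" .
    qed (use * assms in \<open>auto intro!: fnorm_nonneg conv_intros\<close>)
    finally show "norm (fnorm r s (fps_X ^ e n * (fps_const p * G n))) \<le> r ^ n * (pnorm s p * M r s)"
      using fnorm_nonneg[OF conv_mult[OF conv_power[OF conv_X] conv_mult[OF conv_const assms(1)]] *] by simp
  qed
qed

section \<open>The expansion of 1 / (1 - \<epsilon> q^e) and the factors of the theta
  products\<close>

definition geom :: "complex \<Rightarrow> nat \<Rightarrow> complex poly fps" where
  "geom \<epsilon> e = Abs_fps (\<lambda>N. if e dvd N then [:\<epsilon> ^ (N div e):] else 0)"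

context
  fixes \<epsilon> :: complex and e :: nat
  assumes \<epsilon>: "norm \<epsilon> = 1" and e: "0 < e"
begin

lemma pnorm_geom_le: "pnorm s (fps_nth (geom \<epsilon> e) n) \<le> 1"
  using \<epsilon> by (simp add: geom_def norm_power)

lemma conv_geom: "conv (geom \<epsilon> e)"
proof (rule convI)
  fix r s :: real assume *: "0 \<le> r" "r < 1" "0 \<le> s"
  show "summable (\<lambda>n. pnorm s (fps_nth (geom \<epsilon> e) n) * r ^ n)"
  proof (rule summable_comparison_test'[where N = 0])
    show "summable (\<lambda>n. r ^ n)" using * by (intro summable_geometric) auto
    show "norm (pnorm s (fps_nth (geom \<epsilon> e) n) * r ^ n) \<le> r ^ n" for n
      using * pnorm_geom_le[of s n] by (simp add: abs_mult pnorm_nonneg mult_left_le_one_le)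
  qed
qed

lemma fnorm_geom:
  assumes *: "0 \<le> r" "r < 1" "0 \<le> s"
  shows "fnorm r s (geom \<epsilon> e) \<le> 1 / (1 - r)"
proof -
  have "fnorm r s (geom \<epsilon> e) \<le> (\<Sum>n. r ^ n)" unfolding fnorm_def
    using * pnorm_geom_le by (intro suminf_le convD conv_geom summable_geometric)
      (auto simp: mult_left_le_one_le pnorm_nonneg)
  then show ?thesis using * by (simp add: suminf_geometric)
qed

lemma geom_mult: "geom \<epsilon> e * (1 - fps_const [:\<epsilon>:] * fps_X ^ e) = 1"
proof (rule fps_ext)
  fix n
  have "fps_nth (geom \<epsilon> e * (1 - fps_const [:\<epsilon>:] * fps_X ^ e)) n =
     fps_nth (geom \<epsilon> e) n - fps_nth (fps_X ^ e * (fps_const [:\<epsilon>:] * geom \<epsilon> e)) n"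
    by (simp add: algebra_simps)
  also have "\<dots> = fps_nth 1 n"
  proof (cases "n < e")
    case True
    then show ?thesis using e by (auto simp: fps_X_power_mult_nth geom_def dest: dvd_imp_le)
  next
    case False
    then obtain m where n: "n = e + m" using le_Suc_ex by (metis not_less)
    show ?thesis unfolding n using e by (auto simp: fps_X_power_mult_nth geom_def)
  qed
  finally show "fps_nth (geom \<epsilon> e * (1 - fps_const [:\<epsilon>:] * fps_X ^ e)) n = fps_nth 1 n" .
qed

lemma one_minus_power_nonzero: "norm (q::complex) < 1 \<Longrightarrow> 1 - \<epsilon> * q ^ e \<noteq> 0"
proof
  assume "norm q < 1" "1 - \<epsilon> * q ^ e = 0"
  then have "norm (\<epsilon> * q ^ e) = 1" by (metis eq_iff_diff_eq_0 norm_one)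
  then have "norm q ^ e = 1" using \<epsilon> by (simp add: norm_mult norm_power)
  moreover have "norm q ^ e < 1" using \<open>norm q < 1\<close> e by (simp add: power_less_one_iff)
  ultimately show False by simp
qed

lemma ev_geom:
  assumes "norm q < 1"
  shows "ev (geom \<epsilon> e) q X = 1 / (1 - \<epsilon> * q ^ e)"
proof -
  have "ev (geom \<epsilon> e) q X * (1 - \<epsilon> * q ^ e) = 1"
    using arg_cong[OF geom_mult, of "\<lambda>A. ev A q X"] assms by (simp add: ev_simps conv_geom)
  then show ?thesis using one_minus_power_nonzero[OF assms] by (simp add: field_simps)
qed

end

lemma ifps_geom: "\<epsilon> \<in> \<int> \<Longrightarrow> ifps (geom \<epsilon> e)"
  by (auto simp: ifps_def geom_def)

text \<open>
  \<open>1 + theta_factor \<epsilon> e\<close> is \<open>1 - \<epsilon> q\<^sup>e X / (1 - \<epsilon> q\<^sup>e)\<^sup>2\<close>, which in terms of \<open>\<zeta>\<close> reads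
  \<open>(1 - \<epsilon> q\<^sup>e \<zeta>) (1 - \<epsilon> q\<^sup>e / \<zeta>) / (1 - \<epsilon> q\<^sup>e)\<^sup>2\<close>.
\<close>

definition theta_factor :: "complex \<Rightarrow> nat \<Rightarrow> complex poly fps" where
  "theta_factor \<epsilon> e = fps_X ^ e * (fps_const [:0, -\<epsilon>:] * geom \<epsilon> e ^ 2)"

lemma fps_product_theta:
  assumes "norm \<epsilon> = 1" "\<And>n. n < e n"
  shows "fps_product (\<lambda>n. theta_factor \<epsilon> (e n))"
  unfolding theta_factor_def
proof (rule fps_productI[where M = "\<lambda>r s. (1 / (1 - r))\<^sup>2"])
  have e: "0 < e n" for n using assms(2)[of n] by simp
  fix n
  show "conv (geom \<epsilon> (e n) ^ 2)" using assms e by (intro conv_power conv_geom)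
  fix r s :: real assume *: "0 \<le> r" "r < 1" "0 \<le> s"
  have "fnorm r s (geom \<epsilon> (e n) ^ 2) \<le> fnorm r s (geom \<epsilon> (e n)) ^ 2"
    using * assms e by (intro fnorm_power conv_geom)
  also have "\<dots> \<le> (1 / (1 - r))\<^sup>2"
    using * assms e by (intro power_mono fnorm_geom fnorm_nonneg conv_geom)
  finally show "fnorm r s (geom \<epsilon> (e n) ^ 2) \<le> (1 / (1 - r))\<^sup>2" .
qed (use assms in auto)

lemma ev_theta_factor:
  assumes "norm \<epsilon> = 1" "0 < e" "norm q < 1"
  shows "1 + ev (theta_factor \<epsilon> e) q X = 1 - \<epsilon> * q ^ e * X / (1 - \<epsilon> * q ^ e)\<^sup>2"
  using assms by (simp add: theta_factor_def ev_simps conv_geom ev_geom power_divide field_simps)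

lemma ifps_theta_factor: "\<epsilon> \<in> \<int> \<Longrightarrow> ifps (theta_factor \<epsilon> e)"
  unfolding theta_factor_def by (intro ifps_intros ifps_geom) auto

section \<open>Even and odd parts of a series, and specialisation of X\<close>

definition evens :: "complex poly fps \<Rightarrow> complex poly fps" where
  "evens B = Abs_fps (\<lambda>n. fps_nth B (2 * n))"

definition odds :: "complex poly fps \<Rightarrow> complex poly fps" where
  "odds B = Abs_fps (\<lambda>n. fps_nth B (2 * n + 1))"

lemma ifps_evens: "ifps B \<Longrightarrow> ifps (evens B)" and ifps_odds: "ifps B \<Longrightarrow> ifps (odds B)"
  by (auto simp: ifps_def evens_def odds_def)

lemma conv_evens: assumes "conv B" shows "conv (evens B)"
proof (rule convI)
  fix r s :: real assume *: "0 \<le> r" "r < 1" "0 \<le> s"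
  have "summable (\<lambda>n. pnorm s (fps_nth B n) * sqrt r ^ n)"
    using * by (intro convD[OF assms]) auto
  then have "summable ((\<lambda>n. pnorm s (fps_nth B n) * sqrt r ^ n) \<circ> (\<lambda>n. 2 * n))"
    by (rule summable_reindex) (use * in \<open>auto simp: inj_on_def pnorm_nonneg\<close>)
  then show "summable (\<lambda>n. pnorm s (fps_nth (evens B) n) * r ^ n)"
    using * by (simp add: o_def evens_def power_mult)
qed

lemma conv_odds: assumes "conv B" shows "conv (odds B)"
proof (rule convI)
  fix r s :: real assume *: "0 \<le> r" "r < 1" "0 \<le> s"
  \<comment> \<open>One factor t has to be divided out of the odd powers. The square root of r,
    which suffices for \<open>evens\<close>, can be 0; hence a larger radius with r < t^2 <
    1.\<close>
  define t where "t = sqrt ((1 + r) / 2)"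
  have t: "0 < t" "t < 1" "r < t\<^sup>2" using * by (auto simp: t_def)
  have "summable (\<lambda>n. pnorm s (fps_nth B n) * t ^ n)"
    using * t by (intro convD[OF assms]) auto
  then have "summable ((\<lambda>n. pnorm s (fps_nth B n) * t ^ n) \<circ> (\<lambda>n. 2 * n + 1))"
    by (rule summable_reindex) (use * t in \<open>auto simp: inj_on_def pnorm_nonneg\<close>)
  then have "summable (\<lambda>n. (1/t) * (pnorm s (fps_nth B (2 * n + 1)) * t ^ (2 * n + 1)))"
    by (intro summable_mult) (simp add: o_def)
  then have "summable (\<lambda>n. pnorm s (fps_nth (odds B) n) * (t\<^sup>2) ^ n)"
    using t by (simp add: odds_def power_mult[symmetric])
  then show "summable (\<lambda>n. pnorm s (fps_nth (odds B) n) * r ^ n)"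
    by (rule summable_comparison_test'[where N = 0])
       (use * t in \<open>auto simp: abs_mult pnorm_nonneg intro!: mult_left_mono power_mono\<close>)
qed

text \<open>Used at r = e(\<tau> / 2) and at -r: expressions symmetric under r \<mapsto> -r become
  series in q = r^2.\<close>

lemma ev_split:
  assumes "conv B" "norm r < 1"
  shows "ev B r X = ev (evens B) (r\<^sup>2) X + r * ev (odds B) (r\<^sup>2) X"
proof -
  have r2: "norm (r\<^sup>2) < 1" using assms(2) by (simp add: norm_power power_less_one_iff)
  have "(\<lambda>n. \<Sum>i = n * 2..<n * 2 + 2. poly (fps_nth B i) X * r ^ i) sums ev B r X"
    using ev_sums[OF assms] by (rule sums_group) simp
  moreover have "(\<Sum>i = n * 2..<n * 2 + 2. poly (fps_nth B i) X * r ^ i) =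
      poly (fps_nth (evens B) n) X * (r\<^sup>2) ^ n + r * (poly (fps_nth (odds B) n) X * (r\<^sup>2) ^ n)" for n
    by (simp add: evens_def odds_def mult.commute[of n] power_add power_mult_distrib mult_2 numeral_2_eq_2)
  ultimately have "(\<lambda>n. poly (fps_nth (evens B) n) X * (r\<^sup>2) ^ n + r * (poly (fps_nth (odds B) n) X * (r\<^sup>2) ^ n))
     sums ev B r X" by simp
  moreover have "(\<lambda>n. poly (fps_nth (evens B) n) X * (r\<^sup>2) ^ n + r * (poly (fps_nth (odds B) n) X * (r\<^sup>2) ^ n))
     sums (ev (evens B) (r\<^sup>2) X + r * ev (odds B) (r\<^sup>2) X)"
    using r2 assms by (intro sums_add sums_mult ev_sums conv_evens conv_odds)
  ultimately show ?thesis by (rule sums_unique2)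
qed

text \<open>Needed at x = -4, the value of \<open>xx\<close> at 1/2, to turn a value of
  \<open>kap\<close> at a point of order two into a series in q alone.\<close>

definition atX :: "complex \<Rightarrow> complex poly fps \<Rightarrow> complex poly fps" where
  "atX x B = Abs_fps (\<lambda>n. [:poly (fps_nth B n) x:])"

lemma conv_atX: assumes "conv B" shows "conv (atX x B)"
proof (rule convI)
  fix r s :: real assume *: "0 \<le> r" "r < 1" "0 \<le> s"
  have "summable (\<lambda>n. pnorm (norm x) (fps_nth B n) * r ^ n)"
    using * by (intro convD[OF assms]) auto
  then show "summable (\<lambda>n. pnorm s (fps_nth (atX x B) n) * r ^ n)"
    by (rule summable_comparison_test'[where N = 0])
       (use * in \<open>auto simp: atX_def abs_mult norm_poly_le intro!: mult_right_mono\<close>)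
qed

lemma ev_atX [simp]: "ev (atX x B) q X = ev B q x"
  by (simp add: ev_def atX_def)

section \<open>The basic theta quotient\<close>

definition ex :: "complex \<Rightarrow> complex" where "ex z = exp (2 * of_real pi * \<i> * z)"

definition xx :: "complex \<Rightarrow> complex" where "xx z = ex z + ex (- z) - 2"

lemma ex_add: "ex (a + b) = ex a * ex b" by (simp add: ex_def exp_add algebra_simps)
lemma ex_0 [simp]: "ex 0 = 1" by (simp add: ex_def)
lemma ex_nonzero [simp]: "ex a \<noteq> 0" by (simp add: ex_def)
lemma ex_minus: "ex (- a) = 1 / ex a" by (simp add: ex_def exp_minus field_simps)
lemma ex_diff: "ex (a - b) = ex a / ex b" using ex_add[of a "- b"] by (simp add: ex_minus)
lemma ex_of_nat_mult: "ex (of_nat n * a) = ex a ^ n"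
  unfolding ex_def by (subst exp_of_nat_mult[symmetric]) (simp add: mult_ac)
lemma ex_1 [simp]: "ex 1 = 1" by (simp add: ex_def)
lemma ex_half [simp]: "ex (1 / 2) = -1" by (simp add: ex_def exp_pi_i' exp_pi_i)
lemma ex_eq_1: "ex a = 1 \<longleftrightarrow> (\<exists>n::int. a = of_int n)"
proof
  assume "ex a = 1"
  then obtain n :: int where "Re (2 * of_real pi * \<i> * a) = 0" "Im (2 * of_real pi * \<i> * a) = of_int (2 * n) * pi"
    unfolding ex_def exp_eq_1 by blast
  then have "a = of_int n" by (simp add: complex_eq_iff)
  then show "\<exists>n::int. a = of_int n" ..
next
  assume "\<exists>n::int. a = of_int n"
  then show "ex a = 1" unfolding ex_def exp_eq_1 by auto
qed
lemma norm_ex: "norm (ex a) = exp (- (2 * pi * Im a))"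
  by (simp add: ex_def)
lemma norm_ex_less_1 [simp]: "Im a > 0 \<Longrightarrow> norm (ex a) < 1"
  by (simp add: norm_ex)
lemma ex_half_square: "ex (a / 2) ^ 2 = ex a"
  using ex_of_nat_mult[of 2 "a / 2"] by simp
lemma Im_S [simp]: "Im \<tau> > 0 \<Longrightarrow> Im (- 1 / \<tau>) > 0"
  by (simp add: Im_divide sum_power2_gt_zero_iff)

lemma xx_minus [simp]: "xx (- z) = xx z" by (simp add: xx_def)
lemma xx_add_1 [simp]: "xx (z + 1) = xx z" by (simp add: xx_def ex_add ex_diff ex_minus)
lemma xx_0 [simp]: "xx 0 = 0" by (simp add: xx_def)
lemma xx_eq: "xx z = (1 - ex z)\<^sup>2 / ex z"
  by (simp add: xx_def ex_minus power2_eq_square field_simps)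
lemma xx_half: "xx (z + 1 / 2) = - xx z - 4"
  by (simp add: xx_def ex_add ex_diff ex_minus)
lemma xx_sin: "xx z = - 4 * sin (of_real pi * z) ^ 2"
proof -
  define w where "w = ex (z / 2)"
  have w: "w \<noteq> 0" "ex z = w ^ 2" by (simp_all add: w_def ex_half_square)
  have S: "sin (of_real pi * z) = (w - 1 / w) / (2 * \<i>)"
    unfolding sin_exp_eq w_def ex_minus[symmetric] by (simp add: ex_def mult_ac)
  show ?thesis unfolding S using w
    by (simp add: xx_def ex_minus power_divide power2_eq_square field_simps)
qed

lemma holomorphic_ex [holomorphic_intros]: "f holomorphic_on S \<Longrightarrow> (\<lambda>z. ex (f z)) holomorphic_on S"
  unfolding ex_def by (intro holomorphic_intros)
lemma holomorphic_xx [holomorphic_intros]: "f holomorphic_on S \<Longrightarrow> (\<lambda>z. xx (f z)) holomorphic_on S"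
  unfolding xx_def by (intro holomorphic_intros)

lemma holomorphic_ev_X:
  assumes "conv A" "norm q < 1"
  shows "ev A q holomorphic_on UNIV"
proof (rule holomorphic_uniform_sequence[OF open_UNIV])
  show "(\<lambda>X. \<Sum>n<N. poly (fps_nth A n) X * q ^ n) holomorphic_on UNIV" for N
    by (intro holomorphic_intros)
  fix x :: complex
  have "uniform_limit (cball x 1) (\<lambda>N X. \<Sum>n<N. poly (fps_nth A n) X * q ^ n) (ev A q) sequentially"
    unfolding ev_def
  proof (rule Weierstrass_m_test)
    show "summable (\<lambda>n. pnorm (norm x + 1) (fps_nth A n) * norm q ^ n)"
      using assms by (intro convD) auto
    fix n X assume "X \<in> cball x 1"
    then have "norm X \<le> norm x + 1"
      using norm_triangle_ineq[of x "X - x"] by (simp add: dist_norm norm_minus_commute)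
    then show "norm (poly (fps_nth A n) X * q ^ n) \<le> pnorm (norm x + 1) (fps_nth A n) * norm q ^ n"
      by (auto simp: norm_mult norm_power intro!: mult_right_mono norm_poly_le)
  qed
  then show "\<exists>d>0. cball x d \<subseteq> UNIV \<and>
      uniform_limit (cball x d) (\<lambda>N X. \<Sum>n<N. poly (fps_nth A n) X * q ^ n) (ev A q) sequentially"
    by (intro exI[of _ 1]) auto
qed

lemma holomorphic_ev_q:
  assumes "conv A"
  shows "(\<lambda>q. ev A q X) holomorphic_on ball 0 1"
proof (rule power_series_holomorphic)
  fix q :: complex assume "q \<in> ball 0 1"
  then show "(\<lambda>n. poly (fps_nth A n) X * (q - 0) ^ n) sums ev A q X"
    using ev_sums[OF assms, of q X] by simp
qed

text \<open>
  \<open>KAP\<close> is the weak Jacobi form usually denoted \<open>\<phi>(-2, 1)\<close>, the square of the odd theta function normalised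
  by its derivative at \<open>z = 0\<close>. The series \<open>TT\<close> is to be evaluated at \<open>r = e(\<tau> / 2)\<close>; up to a
  factor it is the translate of \<open>KAP\<close> by \<open>\<tau> / 2\<close>.
\<close>

definition KK :: "complex poly fps" where "KK = infprod (\<lambda>n. theta_factor 1 (n + 1))"
definition TT0 :: "complex poly fps" where "TT0 = infprod (\<lambda>n. theta_factor 1 (2 * n + 1))"
definition KAP :: "complex poly fps" where "KAP = fps_const [:0, 1:] * KK ^ 2"
definition TT :: "complex poly fps" where "TT = TT0 ^ 2"

interpretation KK: fps_product "\<lambda>n. theta_factor 1 (n + 1)"
  by (rule fps_product_theta) auto
interpretation TT0: fps_product "\<lambda>n. theta_factor 1 (2 * n + 1)"
  by (rule fps_product_theta) auto

lemma conv_KK: "conv KK" and conv_TT0: "conv TT0"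
  unfolding KK_def TT0_def by (rule KK.conv_infprod TT0.conv_infprod)+

lemma conv_KAP [intro]: "conv KAP"
  unfolding KAP_def by (intro conv_intros conv_KK)

lemma KK_lim:
  assumes "norm q < 1"
  shows "(\<lambda>N. \<Prod>n<N. 1 - q ^ (n + 1) * X / (1 - q ^ (n + 1))\<^sup>2) \<longlonglongrightarrow> ev KK q X"
  using KK.ev_infprod[OF assms, of X] assms
  by (simp only: ev_theta_factor zero_less_Suc Suc_eq_plus1[symmetric] norm_one mult_1 KK_def)

lemma TT0_lim:
  assumes "norm q < 1"
  shows "(\<lambda>N. \<Prod>n<N. 1 - q ^ (2 * n + 1) * X / (1 - q ^ (2 * n + 1))\<^sup>2) \<longlonglongrightarrow> ev TT0 q X"
  using TT0.ev_infprod[OF assms, of X] assms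
  by (simp only: ev_theta_factor zero_less_Suc Suc_eq_plus1[symmetric] norm_one mult_1 TT0_def)

lemma KK_X0: assumes "norm q < 1" shows "ev KK q 0 = 1"
  using LIMSEQ_unique[OF KK_lim[OF assms, of 0]] by simp

section \<open>The theta quotient as a function of \<tau> and z: translations and zeros\<close>

definition kap :: "complex \<Rightarrow> complex \<Rightarrow> complex" where "kap \<tau> z = ev KAP (ex \<tau>) (xx z)"

lemma kap_eq: "Im \<tau> > 0 \<Longrightarrow> kap \<tau> z = xx z * ev KK (ex \<tau>) (xx z) ^ 2"
  by (simp add: kap_def KAP_def ev_simps conv_KK)

lemma factor_eq:
  assumes "y \<noteq> 1"
  shows "1 - y * xx z / (1 - y)\<^sup>2 = (1 - y * ex z) * (1 - y / ex z) / (1 - y)\<^sup>2"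
proof -
  have "(1 - y)\<^sup>2 - y * xx z = (1 - y * ex z) * (1 - y / ex z)"
    by (simp add: xx_def ex_minus power2_eq_square field_simps)
  moreover have "1 - y * xx z / (1 - y)\<^sup>2 = ((1 - y)\<^sup>2 - y * xx z) / (1 - y)\<^sup>2"
    using assms by (simp add: diff_divide_distrib)
  ultimately show ?thesis by simp
qed

lemma power_neq_1: "norm (q::complex) < 1 \<Longrightarrow> 0 < n \<Longrightarrow> q ^ n \<noteq> 1"
  by (metis norm_one norm_power norm_ge_zero order_less_irrefl power_less_one_iff)

text \<open>With q = r^2 the shifted factors are (1 - r^(2n+3) \<zeta>) (1 - r^(2n+1) / \<zeta>).
  The extra factor 1 - r \<zeta> on the left moves the first kind down by one index, which leaves
  the surplus factor at N, with limit 1.\<close>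

lemma half_finite:
  fixes z \<tau> :: complex
  defines "r \<equiv> ex (\<tau> / 2)" and "\<zeta> \<equiv> ex z"
  assumes \<tau>: "Im \<tau> > 0"
  shows "(1 - r * \<zeta>) * (\<Prod>n<N. 1 - ex \<tau> ^ (n + 1) * xx (z + \<tau> / 2) / (1 - ex \<tau> ^ (n + 1))\<^sup>2) =
    (\<Prod>n<N. 1 - r ^ (2 * n + 1) * xx z / (1 - r ^ (2 * n + 1))\<^sup>2) * (1 - r ^ (2 * N + 1) * \<zeta>) *
    (\<Prod>n<N. ((1 - r ^ (2 * n + 1)) / (1 - r ^ (2 * n + 2)))\<^sup>2)"
proof (induction N)
  case (Suc N)
  have r: "norm r < 1" "r \<noteq> 0" and \<zeta>: "\<zeta> \<noteq> 0" using \<tau> by (auto simp: r_def \<zeta>_def)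
  have q: "ex \<tau> = r ^ 2" by (simp add: r_def ex_half_square)
  have qr: "ex \<tau> ^ (N + 1) = r ^ (2 * N + 2)" unfolding q power_mult[symmetric] by (simp add: distrib_left)
  have n1: "r ^ (2 * N + 1) \<noteq> 1" "r ^ (2 * N + 2) \<noteq> 1" using power_neq_1[OF r(1), of "2 * N + 1"] power_neq_1[OF r(1), of "2 * N + 2"] by simp_all
  have e: "ex (z + \<tau> / 2) = r * \<zeta>" by (simp add: ex_add r_def \<zeta>_def)
  have A: "1 - ex \<tau> ^ (N + 1) * xx (z + \<tau> / 2) / (1 - ex \<tau> ^ (N + 1))\<^sup>2 =
    (1 - r ^ (2 * N + 3) * \<zeta>) * (1 - r ^ (2 * N + 1) / \<zeta>) / (1 - r ^ (2 * N + 2))\<^sup>2"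
    unfolding qr factor_eq[OF n1(2)] e using r \<zeta> by (simp add: field_simps eval_nat_numeral power2_eq_square[of r])
  have B: "1 - r ^ (2 * N + 1) * xx z / (1 - r ^ (2 * N + 1))\<^sup>2 =
    (1 - r ^ (2 * N + 1) * \<zeta>) * (1 - r ^ (2 * N + 1) / \<zeta>) / (1 - r ^ (2 * N + 1))\<^sup>2"
    unfolding factor_eq[OF n1(1)] by (simp add: \<zeta>_def)
  have e3: "2 * Suc N + 1 = 2 * N + 3" by simp
  show ?case unfolding prod.lessThan_Suc mult.assoc[symmetric] Suc.IH A B e3
    using n1 by (simp add: power_divide field_simps)
qed simp

text \<open>The constant product need not be evaluated: the case z = 0 of \<open>half_finite\<close>
  identifies its limit, and the general case then passes to the limit.\<close>

lemma
  assumes \<tau>: "Im \<tau> > 0"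
  shows half_const_lim: "(\<lambda>N. \<Prod>n<N. ((1 - ex (\<tau> / 2) ^ (2 * n + 1)) / (1 - ex (\<tau> / 2) ^ (2 * n + 2)))\<^sup>2)
      \<longlonglongrightarrow> (1 - ex (\<tau> / 2)) * ev KK (ex \<tau>) (xx (\<tau> / 2))" (is "?V \<longlonglongrightarrow> ?w")
    and half_KK: "(1 - ex (\<tau> / 2) * ex z) * ev KK (ex \<tau>) (xx (z + \<tau> / 2)) =
      ev TT0 (ex (\<tau> / 2)) (xx z) * ((1 - ex (\<tau> / 2)) * ev KK (ex \<tau>) (xx (\<tau> / 2)))"
proof -
  define r where "r = ex (\<tau> / 2)"
  have r: "norm r < 1" and q: "norm (ex \<tau>) < 1" using \<tau> by (auto simp: r_def)
  have p0: "(\<lambda>N. r ^ (2 * N + 1)) \<longlonglongrightarrow> 0"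
    using LIMSEQ_subseq_LIMSEQ[OF LIMSEQ_power_zero[OF r], of "\<lambda>N. 2 * N + 1"]
    by (simp add: o_def strict_mono_def)
  have p1: "(\<lambda>N. 1 - r ^ (2 * N + 1) * c) \<longlonglongrightarrow> 1" for c
    using tendsto_diff[OF tendsto_const tendsto_mult[OF p0 tendsto_const[of c]], of 1] by simp
  have "(\<lambda>N. (1 - r) * (\<Prod>n<N. 1 - ex \<tau> ^ (n + 1) * xx (\<tau> / 2) / (1 - ex \<tau> ^ (n + 1))\<^sup>2)) \<longlonglongrightarrow> ?w"
    unfolding r_def by (intro tendsto_mult tendsto_const KK_lim q)
  also have "(\<lambda>N. (1 - r) * (\<Prod>n<N. 1 - ex \<tau> ^ (n + 1) * xx (\<tau> / 2) / (1 - ex \<tau> ^ (n + 1))\<^sup>2)) =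
     (\<lambda>N. (1 - r ^ (2 * N + 1) * 1) * ?V N)"
    using half_finite[OF \<tau>, of 0] by (simp add: r_def fun_eq_iff)
  finally have "(\<lambda>N. (1 - r ^ (2 * N + 1) * 1) * ?V N / (1 - r ^ (2 * N + 1) * 1)) \<longlonglongrightarrow> ?w / 1"
    by (rule tendsto_divide) (use p1[of 1] in auto)
  moreover have "(1 - r ^ (2 * N + 1) * 1) * ?V N / (1 - r ^ (2 * N + 1) * 1) = ?V N" for N
    using power_neq_1[OF r, of "2 * N + 1"] by simp
  ultimately show V: "?V \<longlonglongrightarrow> ?w" by simp
  have "(\<lambda>N. (1 - r * ex z) * (\<Prod>n<N. 1 - ex \<tau> ^ (n + 1) * xx (z + \<tau> / 2) / (1 - ex \<tau> ^ (n + 1))\<^sup>2))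
     \<longlonglongrightarrow> (1 - r * ex z) * ev KK (ex \<tau>) (xx (z + \<tau> / 2))"
    by (intro tendsto_mult tendsto_const KK_lim q)
  moreover have "(\<lambda>N. (\<Prod>n<N. 1 - r ^ (2 * n + 1) * xx z / (1 - r ^ (2 * n + 1))\<^sup>2) * (1 - r ^ (2 * N + 1) * ex z) * ?V N)
     \<longlonglongrightarrow> ev TT0 r (xx z) * 1 * ?w"
    by (intro tendsto_mult TT0_lim r p1 V)
  ultimately show "(1 - ex (\<tau> / 2) * ex z) * ev KK (ex \<tau>) (xx (z + \<tau> / 2)) =
      ev TT0 (ex (\<tau> / 2)) (xx z) * ?w"
    unfolding r_def half_finite[OF \<tau>] by (simp add: LIMSEQ_unique)
qed

lemma kap_half:
  assumes \<tau>: "Im \<tau> > 0"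
  shows "kap \<tau> (z + \<tau> / 2) = ex (- z) * ev TT (ex (\<tau> / 2)) (xx z) * kap \<tau> (\<tau> / 2)"
proof -
  have "kap \<tau> (z + \<tau> / 2) = ((1 - ex (\<tau> / 2) * ex z) * ev KK (ex \<tau>) (xx (z + \<tau> / 2)))\<^sup>2 / (ex (\<tau> / 2) * ex z)"
    using \<tau> by (simp add: kap_eq xx_eq[of "z + \<tau> / 2"] ex_add mult_ac power_mult_distrib)
  also have "\<dots> = ev TT0 (ex (\<tau> / 2)) (xx z) ^ 2 * (xx (\<tau> / 2) * ev KK (ex \<tau>) (xx (\<tau> / 2)) ^ 2) / ex z"
    unfolding half_KK[OF \<tau>] using \<tau> by (simp add: xx_eq[of "\<tau> / 2"] power_mult_distrib mult_ac)
  finally show ?thesis using \<tau> by (simp add: kap_eq[of \<tau> "\<tau> / 2"] TT_def ev_simps conv_TT0 ex_minus)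
qed

lemma kap_minus [simp]: "kap \<tau> (- z) = kap \<tau> z" by (simp add: kap_def)
lemma kap_add_1 [simp]: "kap \<tau> (z + 1) = kap \<tau> z" by (simp add: kap_def)

text \<open>Two half shifts. As \<open>xx\<close> is even, the second one is \<open>kap_half\<close>
  at - z - \<tau> / 2, read backwards.\<close>

lemma kap_add_tau:
  assumes \<tau>: "Im \<tau> > 0"
  shows "kap \<tau> (z + \<tau>) = ex (- \<tau> - 2 * z) * kap \<tau> z"
proof -
  have "kap \<tau> (z + \<tau>) = ex (- z - \<tau> / 2) * (ev TT (ex (\<tau> / 2)) (xx (z + \<tau> / 2)) * kap \<tau> (\<tau> / 2))"
    using kap_half[OF \<tau>, of "z + \<tau> / 2"] by (simp add: mult_ac add.assoc)
  also have "xx (z + \<tau> / 2) = xx (- z - \<tau> / 2)" using xx_minus[of "z + \<tau> / 2"] by simp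
  also have "ev TT (ex (\<tau> / 2)) (xx (- z - \<tau> / 2)) * kap \<tau> (\<tau> / 2) = ex (- z - \<tau> / 2) * kap \<tau> z"
    using kap_half[OF \<tau>, of "- z - \<tau> / 2"] by (simp add: ex_add ex_diff ex_minus)
  also have "ex (- z - \<tau> / 2) * (ex (- z - \<tau> / 2) * kap \<tau> z) = ex (- \<tau> - 2 * z) * kap \<tau> z"
  proof -
    have "- z - \<tau> / 2 + (- z - \<tau> / 2) = - \<tau> - 2 * z" by simp
    then have "ex (- z - \<tau> / 2) * ex (- z - \<tau> / 2) = ex (- \<tau> - 2 * z)"
      unfolding ex_add[symmetric] by (rule arg_cong)
    then show ?thesis by (simp flip: mult.assoc)
  qed
  finally show ?thesis .
qed

lemma kap_0 [simp]: "Im \<tau> > 0 \<Longrightarrow> kap \<tau> 0 = 0"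
  by (simp add: kap_eq)

lemma kap_zeroD:
  assumes \<tau>: "Im \<tau> > 0" and "kap \<tau> z = 0"
  shows "\<exists>a b :: int. z = of_int a + of_int b * \<tau>"
proof -
  consider "xx z = 0" | "ev KK (ex \<tau>) (xx z) = 0" using assms by (auto simp: kap_eq)
  then show ?thesis
  proof cases
    case 1
    then have "ex z = 1" by (simp add: xx_eq)
    then obtain a :: int where "z = of_int a" by (auto simp: ex_eq_1)
    then have "z = of_int a + of_int 0 * \<tau>" by simp
    then show ?thesis by blast
  next
    case 2
    have q: "norm (ex \<tau>) < 1" using \<tau> by simp
    obtain n where n: "1 + ev (theta_factor 1 (n + 1)) (ex \<tau>) (xx z) = 0"
      using 2 KK.ev_infprod_nonzero[OF q, of "xx z"] unfolding KK_def by blast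
    have y: "ex \<tau> ^ (n + 1) = ex (of_nat (n + 1) * \<tau>)" by (rule ex_of_nat_mult[symmetric])
    have "1 - ex \<tau> ^ (n + 1) * xx z / (1 - ex \<tau> ^ (n + 1))\<^sup>2 = 0"
      using n ev_theta_factor[of 1 "n + 1" "ex \<tau>" "xx z"] q by simp
    then have "(1 - ex \<tau> ^ (n + 1) * ex z) * (1 - ex \<tau> ^ (n + 1) / ex z) = 0"
      using power_neq_1[OF q, of "n + 1"] by (subst (asm) factor_eq) auto
    then have "ex (of_nat (n + 1) * \<tau> + z) = 1 \<or> ex (of_nat (n + 1) * \<tau> - z) = 1"
      unfolding y by (auto simp: ex_add ex_diff)
    then show ?thesis
    proof
      assume "ex (of_nat (n + 1) * \<tau> + z) = 1"
      then obtain a :: int where "of_nat (n + 1) * \<tau> + z = of_int a" by (auto simp: ex_eq_1)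
      then have "z = of_int a + of_int (- int (n + 1)) * \<tau>" by (simp add: algebra_simps)
      then show ?thesis by blast
    next
      assume "ex (of_nat (n + 1) * \<tau> - z) = 1"
      then obtain a :: int where "of_nat (n + 1) * \<tau> - z = of_int a" by (auto simp: ex_eq_1)
      then have "z = of_int (- a) + of_int (int (n + 1)) * \<tau>" by (simp add: algebra_simps)
      then show ?thesis by blast
    qed
  qed
qed

section \<open>Doubly periodic functions and the inversion law of \<open>kap\<close>\<close>

lemma periodic_int:
  fixes h :: "complex \<Rightarrow> 'a"
  assumes "\<And>z. h (z + p) = h z"
  shows "h (z + of_int a * p) = h z"
proof (induction a rule: int_induct[of _ 0])
  case base
  show ?case by simp
next
  case (step1 i)
  have "h (z + of_int (i + 1) * p) = h ((z + of_int i * p) + p)" by (simp add: algebra_simps)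
  then show ?case using assms step1 by simp
next
  case (step2 i)
  have "h (z + of_int i * p) = h ((z + of_int (i - 1) * p) + p)" by (simp add: algebra_simps)
  then show ?case using assms step2 by simp
qed

text \<open>The codomain is arbitrary so that the lemma also applies to a predicate such as the
  vanishing of a function with multipliers.\<close>

lemma doubly_periodic_int:
  fixes h :: "complex \<Rightarrow> 'a"
  assumes "\<And>z. h (z + 1) = h z" "\<And>z. h (z + \<tau>) = h z"
  shows "h (z + (of_int a + of_int b * \<tau>)) = h z"
  using periodic_int[of h 1 "z + of_int b * \<tau>" a] periodic_int[of h \<tau> z b] assms
  by (simp add: add_ac)

lemma Liouville_doubly_periodic:
  fixes h :: "complex \<Rightarrow> complex"
  assumes \<tau>: "Im \<tau> > 0" and holo: "h holomorphic_on UNIV"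
    and per: "\<And>z. h (z + 1) = h z" "\<And>z. h (z + \<tau>) = h z"
  shows "h z = h 0"
proof -
  let ?P = "(\<lambda>(s, t). of_real s + of_real t * \<tau>) ` ({0..1} \<times> {0..1::real})"
  have "compact ?P"
    by (intro compact_continuous_image compact_Times compact_Icc)
       (auto intro!: continuous_intros simp: case_prod_unfold)
  then have "compact (h ` ?P)"
    by (rule compact_continuous_image[OF continuous_on_subset[OF holomorphic_on_imp_continuous_on[OF holo] subset_UNIV]])
  then have "bounded (h ` ?P)" by (rule compact_imp_bounded)
  moreover have "range h \<subseteq> h ` ?P"
  proof
    fix y assume "y \<in> range h"
    then obtain z where y: "y = h z" by blast
    define t where "t = Im z / Im \<tau>"
    define s where "s = Re z - t * Re \<tau>"
    have z: "z = of_real s + of_real t * \<tau>"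
      using \<tau> by (simp add: complex_eq_iff s_def t_def)
    define w where "w = of_real (frac s) + of_real (frac t) * \<tau>"
    have "z = w + (of_int \<lfloor>s\<rfloor> + of_int \<lfloor>t\<rfloor> * \<tau>)"
      unfolding z w_def frac_def by (simp add: algebra_simps)
    then have "y = h w" using doubly_periodic_int[OF per] y by metis
    moreover have "w \<in> ?P"
      unfolding w_def by (rule image_eqI[of _ _ "(frac s, frac t)"]) (auto simp: frac_ge_0 frac_lt_1 less_imp_le)
    ultimately show "y \<in> h ` ?P" by blast
  qed
  ultimately have "bounded (range h)" by (rule bounded_subset)
  then obtain c where "\<And>z. h z = c" using Liouville_theorem[OF holo] unfolding constant_on_def by blast
  then show ?thesis by simp
qed

lemma holomorphic_kap:
  assumes "Im \<tau> > 0" "f holomorphic_on S"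
  shows "(\<lambda>z. kap \<tau> (f z)) holomorphic_on S"
proof -
  have "(ev KAP (ex \<tau>) \<circ> (\<lambda>z. xx (f z))) holomorphic_on S"
    by (rule holomorphic_on_compose_gen[OF _ holomorphic_ev_X[OF conv_KAP]]) (use assms in \<open>auto intro: holomorphic_intros\<close>)
  then show ?thesis by (simp add: o_def kap_def)
qed

lemma tendsto_sin_over: "((\<lambda>z. sin (c * z) / z) \<longlongrightarrow> (c::complex)) (at 0)"
proof -
  have "((\<lambda>z. sin (c * z)) has_field_derivative c) (at 0)"
    by (rule derivative_eq_intros refl | simp)+
  then show ?thesis by (simp add: DERIV_def)
qed

text \<open>Used with \<tau> for the inverted side of a transformation law and with 1 for the other,
  hence the terms z / 1 in later proofs.\<close>

lemma tendsto_xx_over: "((\<lambda>z. xx (z / \<tau>) / z\<^sup>2) \<longlongrightarrow> - 4 * (of_real pi / \<tau>)\<^sup>2) (at 0)"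
proof -
  have "((\<lambda>z. - 4 * (sin (of_real pi / \<tau> * z) / z)\<^sup>2) \<longlongrightarrow> - 4 * (of_real pi / \<tau>)\<^sup>2) (at 0)"
    by (intro tendsto_intros tendsto_sin_over)
  moreover have "(\<lambda>z. - 4 * (sin (of_real pi / \<tau> * z) / z)\<^sup>2) = (\<lambda>z. xx (z / \<tau>) / z\<^sup>2)"
    by (simp add: xx_sin power_divide)
  ultimately show ?thesis by simp
qed

lemma tendsto_ev_xx:
  assumes "conv A" "norm q < 1"
  shows "((\<lambda>z. ev A q (xx (z / \<tau>))) \<longlongrightarrow> ev A q 0) (at 0)"
proof -
  have "(ev A q \<circ> (\<lambda>z. xx (z / \<tau>))) holomorphic_on UNIV"
    by (rule holomorphic_on_compose_gen[OF _ holomorphic_ev_X[OF assms]])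
       (auto intro!: holomorphic_intros simp: divide_inverse)
  then have "continuous (at 0) (\<lambda>z. ev A q (xx (z / \<tau>)))"
    using holomorphic_on_imp_continuous_on continuous_on_eq_continuous_at[OF open_UNIV] by (auto simp: o_def)
  then show ?thesis by (simp add: isCont_def)
qed

text \<open>
  Both sides have double zeros exactly at the lattice points and the same multipliers under the
  lattice, so their quotient is a holomorphic doubly periodic function.
\<close>

lemma kap_S:
  assumes \<tau>: "Im \<tau> > 0"
  shows "\<tau>\<^sup>2 * kap (- 1 / \<tau>) (z / \<tau>) = ex (z\<^sup>2 / \<tau>) * kap \<tau> z"
proof -
  define \<sigma> where "\<sigma> = - 1 / \<tau>"
  have \<sigma>: "Im \<sigma> > 0" using \<tau> Im_S unfolding \<sigma>_def by blast
  have \<tau>0: "\<tau> \<noteq> 0" using \<tau> by auto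
  define f where "f z = kap \<sigma> (z / \<tau>) * ex (- z\<^sup>2 / \<tau>)" for z
  define g where "g z = kap \<tau> z" for z
  \<comment> \<open>The value at the zeros of g is the limit of the quotient at 0, hence at every
    lattice point.\<close>
  define \<rho> where "\<rho> z = (if g z = 0 then 1 / \<tau>\<^sup>2 else f z / g z)" for z
  have g1: "g (z + 1) = g z" and gt: "g (z + \<tau>) = ex (- \<tau> - 2 * z) * g z" for z
    using kap_add_tau[OF \<tau>] by (simp_all add: g_def)
  have f1: "f (z + 1) = f z" for z
  proof -
    have "kap \<sigma> (z / \<tau>) = ex (- \<sigma> - 2 * (z / \<tau> - \<sigma>)) * kap \<sigma> (z / \<tau> - \<sigma>)"
      using kap_add_tau[OF \<sigma>, of "z / \<tau> - \<sigma>"] by simp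
    moreover have "(z + 1) / \<tau> = z / \<tau> - \<sigma>" by (simp add: \<sigma>_def add_divide_distrib)
    moreover have "- \<sigma> - 2 * (z / \<tau> - \<sigma>) + - z\<^sup>2 / \<tau> = - (z + 1)\<^sup>2 / \<tau>"
      using \<tau>0 by (simp add: \<sigma>_def power2_eq_square field_simps)
    then have "ex (- \<sigma> - 2 * (z / \<tau> - \<sigma>)) * ex (- z\<^sup>2 / \<tau>) = ex (- (z + 1)\<^sup>2 / \<tau>)"
      unfolding ex_add[symmetric] by (rule arg_cong)
    ultimately show ?thesis unfolding f_def by (simp add: mult_ac)
  qed
  have ft: "f (z + \<tau>) = ex (- \<tau> - 2 * z) * f z" for z
  proof -
    have "(z + \<tau>) / \<tau> = z / \<tau> + 1" using \<tau>0 by (simp add: add_divide_distrib)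
    moreover have "- (z + \<tau>)\<^sup>2 / \<tau> = - \<tau> - 2 * z + - z\<^sup>2 / \<tau>"
      using \<tau>0 by (simp add: power2_eq_square field_simps)
    ultimately show ?thesis unfolding f_def by (simp only: kap_add_1 ex_add mult_ac)
  qed
  have \<rho>1: "\<rho> (z + 1) = \<rho> z" and \<rho>t: "\<rho> (z + \<tau>) = \<rho> z" for z
    by (simp_all add: \<rho>_def g1 gt f1 ft)
  have f0: "f 0 = 0" and g0: "g 0 = 0" using \<sigma> \<tau> by (simp_all add: f_def g_def)
  have holo_f: "f holomorphic_on S" and holo_g: "g holomorphic_on S" for S
    unfolding f_def g_def using \<tau>0 by (auto intro!: holomorphic_intros holomorphic_kap \<sigma> \<tau>)
  have lim: "((\<lambda>z. f z / g z) \<longlongrightarrow> 1 / \<tau>\<^sup>2) (at 0)"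
  proof -
    have q: "norm (ex \<sigma>) < 1" "norm (ex \<tau>) < 1" using \<sigma> \<tau> by auto
    have "((\<lambda>z. (xx (z / \<tau>) / z\<^sup>2) / (xx (z / 1) / z\<^sup>2) *
        (ev KK (ex \<sigma>) (xx (z / \<tau>)) ^ 2 / ev KK (ex \<tau>) (xx (z / 1)) ^ 2) * ex (- z\<^sup>2 / \<tau>)) \<longlongrightarrow>
       (- 4 * (of_real pi / \<tau>)\<^sup>2) / (- 4 * (of_real pi / 1)\<^sup>2) * (ev KK (ex \<sigma>) 0 ^ 2 / ev KK (ex \<tau>) 0 ^ 2) * ex (- 0\<^sup>2 / \<tau>)) (at 0)"
      unfolding ex_def
      by (intro tendsto_intros tendsto_xx_over tendsto_ev_xx[unfolded ex_def] conv_KK) (use q KK_X0[OF q(2)] \<tau>0 in \<open>auto simp: ex_def\<close>)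
    also have "(- 4 * (of_real pi / \<tau>)\<^sup>2) / (- 4 * (of_real pi / 1)\<^sup>2) * (ev KK (ex \<sigma>) 0 ^ 2 / ev KK (ex \<tau>) 0 ^ 2) * ex (- 0\<^sup>2 / \<tau>) = 1 / \<tau>\<^sup>2"
      using KK_X0[OF q(1)] KK_X0[OF q(2)] by (simp add: power_divide)
    finally show ?thesis
    proof (rule Lim_transform_eventually)
      show "\<forall>\<^sub>F z in at 0. (xx (z / \<tau>) / z\<^sup>2) / (xx (z / 1) / z\<^sup>2) *
        (ev KK (ex \<sigma>) (xx (z / \<tau>)) ^ 2 / ev KK (ex \<tau>) (xx (z / 1)) ^ 2) * ex (- z\<^sup>2 / \<tau>) = f z / g z"
        by (auto simp: eventually_at_filter f_def g_def kap_eq \<sigma> \<tau>)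
    qed
  qed
  have ev_g: "\<forall>\<^sub>F z in at 0. g z \<noteq> 0"
  proof -
    have "((\<lambda>z. xx (z / 1) / z\<^sup>2 * ev KK (ex \<tau>) (xx (z / 1)) ^ 2) \<longlongrightarrow> - 4 * (of_real pi / 1)\<^sup>2 * ev KK (ex \<tau>) 0 ^ 2) (at 0)"
      using \<tau> by (intro tendsto_intros tendsto_xx_over tendsto_ev_xx conv_KK) auto
    moreover have "- 4 * (of_real pi / 1)\<^sup>2 * ev KK (ex \<tau>) 0 ^ 2 \<noteq> (0::complex)" using KK_X0[of "ex \<tau>"] \<tau> by simp
    ultimately have "\<forall>\<^sub>F z in at 0. xx (z / 1) / z\<^sup>2 * ev KK (ex \<tau>) (xx (z / 1)) ^ 2 \<noteq> 0"
      by (rule tendsto_imp_eventually_ne)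
    then show ?thesis by eventually_elim (auto simp: g_def kap_eq \<tau>)
  qed
  have \<rho>_away: "\<rho> field_differentiable (at z)" if "g z \<noteq> 0" for z
  proof -
    have "open (g -` (- {0}))"
      by (rule open_vimage[OF _ holomorphic_on_imp_continuous_on[OF holo_g]]) auto
    then have o: "open {w. g w \<noteq> 0}" by (simp add: vimage_def)
    have "(\<lambda>w. f w / g w) holomorphic_on {w. g w \<noteq> 0}"
      by (intro holomorphic_on_divide holo_f holo_g) auto
    then have "\<rho> holomorphic_on {w. g w \<noteq> 0}"
      by (rule holomorphic_transform) (auto simp: \<rho>_def)
    then show ?thesis using o that by (auto simp: holomorphic_on_open field_differentiable_def)
  qed
  have \<rho>_0: "\<rho> field_differentiable (at 0)"
  proof -
    from ev_g obtain d where d: "d > 0" "\<And>z. z \<noteq> 0 \<Longrightarrow> dist z 0 < d \<Longrightarrow> g z \<noteq> 0"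
      by (auto simp: eventually_at)
    have nz: "g z \<noteq> 0" if "z \<in> ball 0 d - {0}" for z using d(2)[of z] that by (auto simp: dist_commute)
    have "(\<rho> \<longlongrightarrow> \<rho> 0) (at 0)"
    proof (rule Lim_transform_eventually)
      show "((\<lambda>z. f z / g z) \<longlongrightarrow> \<rho> 0) (at 0)" using lim g0 by (simp add: \<rho>_def)
      show "\<forall>\<^sub>F z in at 0. f z / g z = \<rho> z" using ev_g by eventually_elim (simp add: \<rho>_def)
    qed
    then have c0: "isCont \<rho> 0" by (simp add: isCont_def)
    have "isCont \<rho> z" if "z \<in> ball 0 d" for z
      using c0 \<rho>_away[OF nz[of z]] that by (cases "z = 0") (auto intro: field_differentiable_imp_continuous_at)
    then have "continuous_on (ball 0 d) \<rho>" by (simp add: continuous_at_imp_continuous_on)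
    moreover have "\<rho> holomorphic_on (ball 0 d - {0})"
      using \<rho>_away nz by (simp add: holomorphic_on_def field_differentiable_at_within)
    ultimately have "\<rho> holomorphic_on ball 0 d" by (rule no_isolated_singularity) auto
    then show ?thesis using d(1) by (auto simp: holomorphic_on_open field_differentiable_def)
  qed
  have "\<rho> field_differentiable (at z)" for z
  proof (cases "g z = 0")
    case True
    \<comment> \<open>A zero of g is a lattice point, and periodicity of \<rho> carries the
      removable singularity at 0 there.\<close>
    then obtain a b :: int where z: "z = of_int a + of_int b * \<tau>" using kap_zeroD[OF \<tau>] unfolding g_def by blast
    obtain D where "(\<rho> has_field_derivative D) (at (0 + 0))" using \<rho>_0 by (auto simp: field_differentiable_def)
    then have "((\<lambda>w. \<rho> (w - z)) has_field_derivative D) (at z)"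
      using DERIV_shift[of "\<lambda>w. \<rho> (w - z)" D 0 z] by (simp add: add.commute)
    moreover have "\<rho> (w - z) = \<rho> w" for w
      using doubly_periodic_int[OF \<rho>1 \<rho>t, of "w - z" a b] by (simp flip: z)
    ultimately show ?thesis by (auto simp: field_differentiable_def)
  qed (rule \<rho>_away)
  then have "\<rho> holomorphic_on UNIV" by (simp add: holomorphic_on_def)
  then have const: "\<rho> z = 1 / \<tau>\<^sup>2" using Liouville_doubly_periodic[OF \<tau> _ \<rho>1 \<rho>t, of z] g0 by (simp add: \<rho>_def[of 0])
  have "\<tau>\<^sup>2 * f z = g z"
  proof (cases "g z = 0")
    case True
    then obtain a b :: int where z: "z = 0 + (of_int a + of_int b * \<tau>)" using kap_zeroD[OF \<tau>] unfolding g_def add_0 by blast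
    \<comment> \<open>At a zero of g the value of \<rho> says nothing about f. The multipliers of f
      do not vanish, so the property f z = 0 is doubly periodic.\<close>
    have "(f z = 0) = (f 0 = 0)" unfolding z
      by (rule doubly_periodic_int[of "\<lambda>z. f z = 0"]) (simp_all add: f1 ft)
    then show ?thesis using True f0 by simp
  next
    case False
    then show ?thesis using const \<tau>0 by (simp add: \<rho>_def field_simps)
  qed
  then show ?thesis unfolding f_def g_def \<sigma>_def by (simp add: ex_minus field_simps)
qed

section \<open>Jacobi forms of weight zero\<close>

text \<open>
  \<open>jac s K A\<close>: the series \<open>A\<close> in \<open>q = e(\<tau>)\<close> and \<open>X = \<zeta> - 2 + 1 / \<zeta>\<close>, \<open>\<zeta> = e(z)\<close>, is an even weak Jacobi form
  of weight \<open>- 2 s\<close> and index \<open>K\<close>. Invariance under \<open>\<tau> \<mapsto> \<tau> + 1\<close> and \<open>z \<mapsto> z + 1\<close> is built into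
  the expansion.
\<close>

definition jac :: "nat \<Rightarrow> nat \<Rightarrow> complex poly fps \<Rightarrow> bool" where
  "jac s K A \<longleftrightarrow> conv A \<and>
     (\<forall>\<tau> z. Im \<tau> > 0 \<longrightarrow>
        \<tau> ^ (2 * s) * ev A (ex (- 1 / \<tau>)) (xx (z / \<tau>)) = ex (z\<^sup>2 / \<tau>) ^ K * ev A (ex \<tau>) (xx z)) \<and>
     (\<forall>\<tau> z. Im \<tau> > 0 \<longrightarrow> ex (\<tau> + 2 * z) ^ K * ev A (ex \<tau>) (xx (z + \<tau>)) = ev A (ex \<tau>) (xx z))"

lemma jac_conv: "jac s K A \<Longrightarrow> conv A"
  and jac_S: "jac s K A \<Longrightarrow> Im \<tau> > 0 \<Longrightarrow>
     \<tau> ^ (2 * s) * ev A (ex (- 1 / \<tau>)) (xx (z / \<tau>)) = ex (z\<^sup>2 / \<tau>) ^ K * ev A (ex \<tau>) (xx z)"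
  and jac_elliptic: "jac s K A \<Longrightarrow> Im \<tau> > 0 \<Longrightarrow>
     ex (\<tau> + 2 * z) ^ K * ev A (ex \<tau>) (xx (z + \<tau>)) = ev A (ex \<tau>) (xx z)"
  by (simp_all add: jac_def)

lemma jac_add: "jac s K A \<Longrightarrow> jac s K B \<Longrightarrow> jac s K (A + B)"
  by (simp add: jac_def ev_add conv_add distrib_left del: divide_minus_left)

lemma jac_mult:
  assumes "jac s K A" "jac t L B"
  shows "jac (s + t) (K + L) (A * B)"
proof -
  note c = jac_conv[OF assms(1)] jac_conv[OF assms(2)]
  have "\<tau> ^ (2 * (s + t)) * ev (A * B) (ex (- 1 / \<tau>)) (xx (z / \<tau>)) =
      ex (z\<^sup>2 / \<tau>) ^ (K + L) * ev (A * B) (ex \<tau>) (xx z)" if "Im \<tau> > 0" for \<tau> z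
  proof -
    have "\<tau> ^ (2 * (s + t)) * ev (A * B) (ex (- 1 / \<tau>)) (xx (z / \<tau>)) =
      (\<tau> ^ (2 * s) * ev A (ex (- 1 / \<tau>)) (xx (z / \<tau>))) * (\<tau> ^ (2 * t) * ev B (ex (- 1 / \<tau>)) (xx (z / \<tau>)))"
      using that c Im_S[OF that] by (simp add: ev_mult distrib_left power_add mult_ac del: divide_minus_left)
    also have "\<dots> = ex (z\<^sup>2 / \<tau>) ^ (K + L) * ev (A * B) (ex \<tau>) (xx z)"
      unfolding jac_S[OF assms(1) that] jac_S[OF assms(2) that] using that c by (simp add: ev_mult power_add)
    finally show ?thesis .
  qed
  moreover have "ex (\<tau> + 2 * z) ^ (K + L) * ev (A * B) (ex \<tau>) (xx (z + \<tau>)) = ev (A * B) (ex \<tau>) (xx z)"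
    if "Im \<tau> > 0" for \<tau> z
    using that c jac_elliptic[OF assms(1) that, of z] jac_elliptic[OF assms(2) that, of z, symmetric]
    by (simp add: ev_mult power_add mult_ac)
  ultimately show ?thesis using c by (auto simp: jac_def)
qed

lemma jac_const: "jac 0 0 (fps_const [:c:])"
  by (simp add: jac_def)

lemma jac_1: "jac 0 0 1"
  using jac_const[of 1] by (simp add: one_pCons[symmetric])

lemma jac_scale: "jac s K A \<Longrightarrow> jac s K (fps_const [:c:] * A)"
  using jac_mult[OF jac_const[of c]] by fastforce

lemma jac_diff: "jac s K A \<Longrightarrow> jac s K B \<Longrightarrow> jac s K (A - B)"
  by (simp add: jac_def ev_diff conv_diff right_diff_distrib del: divide_minus_left)

lemma jac_power: "jac s K A \<Longrightarrow> jac (n * s) (n * K) (A ^ n)"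
  by (induction n) (auto simp: jac_1 intro: jac_mult)

lemma jac_KAP: "jac 1 1 KAP"
  unfolding jac_def
proof (intro conjI allI impI conv_KAP)
  fix \<tau> z :: complex assume \<tau>: "Im \<tau> > 0"
  show "\<tau> ^ (2 * 1) * ev KAP (ex (- 1 / \<tau>)) (xx (z / \<tau>)) = ex (z\<^sup>2 / \<tau>) ^ 1 * ev KAP (ex \<tau>) (xx z)"
    using kap_S[OF \<tau>, of z] unfolding kap_def by simp
  have "ex (\<tau> + 2 * z) * ex (- \<tau> - 2 * z) = 1" by (simp flip: ex_add)
  then show "ex (\<tau> + 2 * z) ^ 1 * ev KAP (ex \<tau>) (xx (z + \<tau>)) = ev KAP (ex \<tau>) (xx z)"
    using kap_add_tau[OF \<tau>, of z] unfolding kap_def by simp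
qed

text \<open>
  The translates of \<open>kap\<close> by the three points of order two, normalised to be \<open>1\<close> at \<open>z = 0\<close>;
  the inversion exchanges the first two. Symmetric polynomials in them are Jacobi forms of weight \<open>0\<close>.
\<close>

definition xi1 :: "complex \<Rightarrow> complex \<Rightarrow> complex" where
  "xi1 \<tau> z = kap \<tau> (z + 1 / 2) / kap \<tau> (1 / 2)"
definition xi2 :: "complex \<Rightarrow> complex \<Rightarrow> complex" where
  "xi2 \<tau> z = ev TT (ex (\<tau> / 2)) (xx z)"
definition xi3 :: "complex \<Rightarrow> complex \<Rightarrow> complex" where
  "xi3 \<tau> z = ev TT (- ex (\<tau> / 2)) (xx z)"

lemma half_not_int: "of_int a \<noteq> (1 / 2 :: real)"
proof
  assume "of_int a = (1 / 2 :: real)"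
  then have "of_int (2 * a) = (of_int 1 :: real)" by simp
  then have "2 * a = 1" by (simp only: of_int_eq_iff)
  then show False by presburger
qed

lemma kap_half_nonzero:
  assumes "Im \<tau> > 0"
  shows "kap \<tau> (1 / 2) \<noteq> 0" "kap \<tau> (\<tau> / 2) \<noteq> 0" "kap \<tau> (\<tau> / 2 + 1 / 2) \<noteq> 0"
proof -
  show "kap \<tau> (1 / 2) \<noteq> 0"
  proof
    assume "kap \<tau> (1 / 2) = 0"
    then obtain a b :: int where e: "1 / 2 = of_int a + of_int b * \<tau>" using kap_zeroD[OF assms] by blast
    from arg_cong[OF e, of Im] assms have "b = 0" by simp
    with arg_cong[OF e, of Re] half_not_int[of a] show False by simp
  qed
  have n: "x + \<tau> / 2 \<noteq> of_int a + of_int b * \<tau>" if "Im x = 0" for x and a b :: int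
  proof
    assume "x + \<tau> / 2 = of_int a + of_int b * \<tau>"
    from arg_cong[OF this, of Im] assms that have "of_int b = (1 / 2 :: real)" by simp
    with half_not_int[of b] show False by simp
  qed
  have "kap \<tau> (x + \<tau> / 2) \<noteq> 0" if "Im x = 0" for x
    using kap_zeroD[OF assms, of "x + \<tau> / 2"] n[OF that] by blast
  from this[of 0] this[of "1/2"] show "kap \<tau> (\<tau> / 2) \<noteq> 0" "kap \<tau> (\<tau> / 2 + 1 / 2) \<noteq> 0"
    by (simp_all add: add.commute)
qed

lemma kap_tau_plus_1: "kap (\<tau> + 1) z = kap \<tau> z"
  by (simp add: kap_def ex_add)

lemma kap_half_xi2: "Im \<tau> > 0 \<Longrightarrow> kap \<tau> (z + \<tau> / 2) = ex (- z) * xi2 \<tau> z * kap \<tau> (\<tau> / 2)"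
  by (simp add: kap_half xi2_def)

text \<open>The case of \<open>kap_half\<close> for \<tau> + 1, where e(\<tau> / 2) changes
  sign.\<close>

lemma kap_half_xi3:
  assumes "Im \<tau> > 0"
  shows "kap \<tau> (z + \<tau> / 2 + 1 / 2) = ex (- z) * xi3 \<tau> z * kap \<tau> (\<tau> / 2 + 1 / 2)"
proof -
  have "ex ((\<tau> + 1) / 2) = - ex (\<tau> / 2)" by (simp add: add_divide_distrib ex_add)
  then show ?thesis using kap_half[of "\<tau> + 1" z] assms
    by (simp add: kap_tau_plus_1 xi3_def add_divide_distrib add.assoc)
qed

text \<open>The factor \<tau>^2 of \<open>kap_S\<close> cancels in the quotient; this is why the
  normalised translates have weight 0.\<close>

lemma kap_S_half:
  assumes \<tau>: "Im \<tau> > 0" and c: "kap \<tau> c \<noteq> 0"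
  shows "kap (- 1 / \<tau>) ((z + c) / \<tau>) / kap (- 1 / \<tau>) (c / \<tau>) = ex (z\<^sup>2 / \<tau> + 2 * z * c / \<tau>) * kap \<tau> (z + c) / kap \<tau> c"
proof -
  have \<tau>0: "\<tau> \<noteq> 0" using \<tau> by auto
  have "(z + c)\<^sup>2 / \<tau> - c\<^sup>2 / \<tau> = z\<^sup>2 / \<tau> + 2 * z * c / \<tau>"
    by (simp add: power2_sum add_divide_distrib)
  then have e: "ex ((z + c)\<^sup>2 / \<tau>) / ex (c\<^sup>2 / \<tau>) = ex (z\<^sup>2 / \<tau> + 2 * z * c / \<tau>)"
    unfolding ex_diff[symmetric] by (rule arg_cong)
  have "kap (- 1 / \<tau>) ((z + c) / \<tau>) / kap (- 1 / \<tau>) (c / \<tau>) =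
     (\<tau>\<^sup>2 * kap (- 1 / \<tau>) ((z + c) / \<tau>)) / (\<tau>\<^sup>2 * kap (- 1 / \<tau>) (c / \<tau>))"
    using \<tau>0 by simp
  also have "\<dots> = ex ((z + c)\<^sup>2 / \<tau>) / ex (c\<^sup>2 / \<tau>) * kap \<tau> (z + c) / kap \<tau> c"
    unfolding kap_S[OF \<tau>] by simp
  finally show ?thesis unfolding e .
qed

context
  fixes \<tau> z :: complex
  assumes \<tau>: "Im \<tau> > 0"
begin

lemma tau_nonzero: "\<tau> \<noteq> 0" using \<tau> by auto

lemma xi1_S: "xi1 (- 1 / \<tau>) (z / \<tau>) = ex (z\<^sup>2 / \<tau>) * xi2 \<tau> z"
  using kap_S_half[OF \<tau> kap_half_nonzero(2)[OF \<tau>], of z] tau_nonzero kap_half_nonzero(2)[OF \<tau>]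
  by (simp add: xi1_def add_divide_distrib kap_half_xi2[OF \<tau>] ex_add ex_minus del: divide_minus_left)

lemma xi3_S: "xi3 (- 1 / \<tau>) (z / \<tau>) = ex (z\<^sup>2 / \<tau>) * xi3 \<tau> z"
proof -
  define \<sigma> where "\<sigma> = - 1 / \<tau>"
  have \<sigma>: "Im \<sigma> > 0" using Im_S[OF \<tau>] by (simp add: \<sigma>_def)
  \<comment> \<open>Inversion takes the third point of order two to \<tau> / 2 - 1 / 2, which
    differs from \<tau> / 2 + 1 / 2 by the period 1.\<close>
  have m: "kap \<tau> (w + (\<tau> / 2 - 1 / 2)) = kap \<tau> (w + \<tau> / 2 + 1 / 2)" for w
    using kap_add_1[of \<tau> "w + (\<tau> / 2 - 1 / 2)"] by (simp add: algebra_simps)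
  have n: "kap \<tau> (\<tau> / 2 - 1 / 2) \<noteq> 0" using m[of 0] kap_half_nonzero(3)[OF \<tau>] by simp
  have "z / \<tau> + \<sigma> / 2 + 1 / 2 = (z + (\<tau> / 2 - 1 / 2)) / \<tau>" "\<sigma> / 2 + 1 / 2 = (\<tau> / 2 - 1 / 2) / \<tau>"
    using tau_nonzero by (simp_all add: \<sigma>_def field_simps)
  then have "ex (- (z / \<tau>)) * xi3 \<sigma> (z / \<tau>) = ex (z\<^sup>2 / \<tau> + 2 * z * (\<tau> / 2 - 1 / 2) / \<tau>) * kap \<tau> (z + (\<tau> / 2 - 1 / 2)) / kap \<tau> (\<tau> / 2 - 1 / 2)"
    using kap_half_xi3[OF \<sigma>, of "z / \<tau>"] kap_half_nonzero(3)[OF \<sigma>] kap_S_half[OF \<tau> n, of z] unfolding \<sigma>_def by (simp del: divide_minus_left)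
  also have "z\<^sup>2 / \<tau> + 2 * z * (\<tau> / 2 - 1 / 2) / \<tau> = z\<^sup>2 / \<tau> + z - z / \<tau>"
    using tau_nonzero by (simp add: field_simps)
  finally show ?thesis unfolding m m[of 0, simplified] kap_half_xi3[OF \<tau>]
    using kap_half_nonzero(3)[OF \<tau>] by (simp add: ex_add ex_diff ex_minus \<sigma>_def)
qed

lemma xi1_minus: "xi1 \<tau> (- z) = xi1 \<tau> z"
proof -
  have "kap \<tau> (- z + 1 / 2) = kap \<tau> (z - 1 / 2)" using kap_minus[of \<tau> "z - 1 / 2"] by (simp add: algebra_simps)
  also have "\<dots> = kap \<tau> (z + 1 / 2)" using kap_add_1[of \<tau> "z - 1 / 2"] by (simp add: algebra_simps)
  finally show ?thesis by (simp add: xi1_def)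
qed

lemma xi1_elliptic: "ex (\<tau> + 2 * z) * xi1 \<tau> (z + \<tau>) = xi1 \<tau> z"
  using kap_add_tau[OF \<tau>, of "z + 1 / 2"]
  by (simp add: xi1_def add_ac ex_add ex_diff ex_minus)

lemma xi2_elliptic: "ex (\<tau> + 2 * z) * xi2 \<tau> (z + \<tau>) = xi2 \<tau> z"
proof -
  have "ex (- (z + \<tau>)) * xi2 \<tau> (z + \<tau>) = ex (- \<tau> - 2 * (z + \<tau> / 2)) * (ex (- z) * xi2 \<tau> z)"
    using kap_half_xi2[OF \<tau>, of "z + \<tau>"] kap_half_xi2[OF \<tau>, of z] kap_add_tau[OF \<tau>, of "z + \<tau> / 2"]
      kap_half_nonzero(2)[OF \<tau>] by (simp add: add_ac)
  also have "- \<tau> - 2 * (z + \<tau> / 2) = - (\<tau> + 2 * z) - \<tau>" by simp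
  finally show ?thesis unfolding ex_diff ex_minus ex_add by (simp add: field_simps)
qed

lemma xi3_elliptic: "ex (\<tau> + 2 * z) * xi3 \<tau> (z + \<tau>) = xi3 \<tau> z"
proof -
  have "ex (- (z + \<tau>)) * xi3 \<tau> (z + \<tau>) = ex (- \<tau> - 2 * (z + \<tau> / 2 + 1 / 2)) * (ex (- z) * xi3 \<tau> z)"
    using kap_half_xi3[OF \<tau>, of "z + \<tau>"] kap_half_xi3[OF \<tau>, of z] kap_add_tau[OF \<tau>, of "z + \<tau> / 2 + 1 / 2"]
      kap_half_nonzero(3)[OF \<tau>] by (simp add: add_ac)
  also have "- \<tau> - 2 * (z + \<tau> / 2 + 1 / 2) = - (\<tau> + 2 * z) - \<tau> - 1" by simp
  finally show ?thesis unfolding ex_diff ex_minus ex_add by (simp add: field_simps)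
qed

end

text \<open>Inversion is an involution up to the sign of z, so this is \<open>xi1_S\<close> at - 1 /
  \<tau>.\<close>

lemma xi2_S:
  assumes \<tau>: "Im \<tau> > 0"
  shows "xi2 (- 1 / \<tau>) (z / \<tau>) = ex (z\<^sup>2 / \<tau>) * xi1 \<tau> z"
proof -
  have \<tau>0: "\<tau> \<noteq> 0" using \<tau> by auto
  have "xi1 (- 1 / (- 1 / \<tau>)) (z / \<tau> / (- 1 / \<tau>)) = ex ((z / \<tau>)\<^sup>2 / (- 1 / \<tau>)) * xi2 (- 1 / \<tau>) (z / \<tau>)"
    by (rule xi1_S[OF Im_S[OF \<tau>]])
  moreover have "- 1 / (- 1 / \<tau>) = \<tau>" "z / \<tau> / (- 1 / \<tau>) = - z" "(z / \<tau>)\<^sup>2 / (- 1 / \<tau>) = - (z\<^sup>2 / \<tau>)"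
    using \<tau>0 by (simp_all add: power2_eq_square)
  ultimately show ?thesis using xi1_minus[OF \<tau>, of z] by (simp add: ex_minus)
qed

text \<open>The condition on F is homogeneity of degree K together with symmetry in the first two
  arguments, which inversion exchanges. Translation of \<tau>, which exchanges the last two, is
  accounted for by A being a series in q.\<close>

lemma jac_symmetric:
  assumes "conv A"
    and ev: "\<And>\<tau> z. Im \<tau> > 0 \<Longrightarrow> ev A (ex \<tau>) (xx z) = F (xi1 \<tau> z) (xi2 \<tau> z) (xi3 \<tau> z)"
    and F: "\<And>a b c t. F (t * b) (t * a) (t * c) = t ^ K * F a b c"
  shows "jac 0 K A"
  unfolding jac_def
proof (intro conjI allI impI assms(1))
  fix \<tau> z :: complex assume \<tau>: "Im \<tau> > 0"
  show "\<tau> ^ (2 * 0) * ev A (ex (- 1 / \<tau>)) (xx (z / \<tau>)) = ex (z\<^sup>2 / \<tau>) ^ K * ev A (ex \<tau>) (xx z)"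
    unfolding ev[OF \<tau>] ev[OF Im_S[OF \<tau>]] xi1_S[OF \<tau>] xi2_S[OF \<tau>] xi3_S[OF \<tau>] F by simp
  have F': "t ^ K * F a b c = F (t * a) (t * b) (t * c)" for a b c t
    using F[where t = t and a = b and b = a and c = c] F[where t = 1 and a = b and b = a and c = c] by simp
  show "ex (\<tau> + 2 * z) ^ K * ev A (ex \<tau>) (xx (z + \<tau>)) = ev A (ex \<tau>) (xx z)"
    unfolding ev[OF \<tau>] F' xi1_elliptic[OF \<tau>] xi2_elliptic[OF \<tau>] xi3_elliptic[OF \<tau>] ..
qed

text \<open>The translate of \<open>KK\<close> by 1/2 up to a constant, under which X becomes - X -
  4. The normalised translate has constant term 1 + X / 4, so \<open>AA\<close> carries a factor 4
  to be integral.\<close>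

definition AF :: "complex poly fps" where "AF = infprod (\<lambda>n. theta_factor (-1) (n + 1))"
definition AA :: "complex poly fps" where "AA = fps_const [:4, 1:] * AF ^ 2"

interpretation AF: fps_product "\<lambda>n. theta_factor (-1) (n + 1)"
  by (rule fps_product_theta) auto

lemma conv_AF: "conv AF" unfolding AF_def by (rule AF.conv_infprod)

lemma conv_AA [intro]: "conv AA"
  unfolding AA_def by (intro conv_intros conv_AF)

lemma AF_lim:
  assumes "norm q < 1"
  shows "(\<lambda>N. \<Prod>n<N. 1 - (- 1) * q ^ (n + 1) * X / (1 - (- 1) * q ^ (n + 1))\<^sup>2) \<longlonglongrightarrow> ev AF q X"
  using AF.ev_infprod[OF assms, of X] assms
  by (simp only: ev_theta_factor zero_less_Suc Suc_eq_plus1[symmetric] norm_one norm_minus_cancel AF_def)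

text \<open>Holds factor by factor, by (1 - y)^2 + y (X + 4) = (1 + y)^2 + y X with y =
  q^(n+1).\<close>

lemma KK_half:
  assumes q: "norm q < 1"
  shows "ev KK q (- X - 4) = ev AF q X * ev KK q (- 4)"
proof -
  have "1 - y * (- X - 4) / (1 - y)\<^sup>2 = (1 - (- 1) * y * X / (1 - (- 1) * y)\<^sup>2) * (1 - y * (- 4) / (1 - y)\<^sup>2)"
    if "y \<noteq> 1" "y \<noteq> -1" for y :: complex
  proof -
    have "1 + y \<noteq> 0" using that by (metis add_eq_0_iff)
    have 1: "1 - y * (- 4) / (1 - y)\<^sup>2 = (1 + y)\<^sup>2 / (1 - y)\<^sup>2" "1 - y * (- X - 4) / (1 - y)\<^sup>2 = ((1 + y)\<^sup>2 + y * X) / (1 - y)\<^sup>2"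
      using that by (simp_all add: field_simps) (simp_all add: power2_eq_square algebra_simps)
    have 2: "1 - (- 1) * y * X / (1 - (- 1) * y)\<^sup>2 = ((1 + y)\<^sup>2 + y * X) / (1 + y)\<^sup>2"
      using \<open>1 + y \<noteq> 0\<close> by (simp add: add_divide_distrib)
    show ?thesis unfolding 1 2 using \<open>1 + y \<noteq> 0\<close> by simp
  qed
  moreover have "q ^ (n + 1) \<noteq> 1" "q ^ (n + 1) \<noteq> -1" for n
    using power_neq_1[OF q, of "n + 1"] power_neq_1[OF q, of "(n + 1) * 2"] unfolding power_mult by force+
  ultimately have "(\<Prod>n<N. 1 - q ^ (n + 1) * (- X - 4) / (1 - q ^ (n + 1))\<^sup>2) =
     (\<Prod>n<N. 1 - (- 1) * q ^ (n + 1) * X / (1 - (- 1) * q ^ (n + 1))\<^sup>2) * (\<Prod>n<N. 1 - q ^ (n + 1) * (- 4) / (1 - q ^ (n + 1))\<^sup>2)" for N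
    unfolding prod.distrib[symmetric] by (intro prod.cong) auto
  then have "(\<lambda>N. \<Prod>n<N. 1 - q ^ (n + 1) * (- X - 4) / (1 - q ^ (n + 1))\<^sup>2) \<longlonglongrightarrow> ev AF q X * ev KK q (- 4)"
    using tendsto_mult[OF AF_lim[OF q, of X] KK_lim[OF q, of "-4"]] by simp
  then show ?thesis using KK_lim[OF q, of "- X - 4"] LIMSEQ_unique by blast
qed

lemma ev_AA: assumes \<tau>: "Im \<tau> > 0" shows "ev AA (ex \<tau>) (xx z) = 4 * xi1 \<tau> z"
proof -
  have h: "xx (1 / 2) = - 4" using xx_half[of 0] by simp
  have "ev KK (ex \<tau>) (- 4) \<noteq> 0" using kap_half_nonzero(1)[OF \<tau>] by (auto simp: kap_eq \<tau> h)
  moreover have e1: "kap \<tau> (z + 1 / 2) = (- xx z - 4) * (ev AF (ex \<tau>) (xx z) * ev KK (ex \<tau>) (- 4))\<^sup>2"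
    using \<tau> by (simp add: kap_eq xx_half KK_half)
  moreover have e2: "kap \<tau> (1 / 2) = - 4 * (ev KK (ex \<tau>) (- 4))\<^sup>2"
    using \<tau> by (simp add: kap_eq h)
  ultimately show ?thesis unfolding xi1_def e1 e2
    using \<tau> by (simp add: AA_def ev_simps conv_AF power_mult_distrib field_simps)
qed

text \<open>
  \<open>te\<close> and \<open>th\<close> are the even and odd parts in \<open>r = e(\<tau> / 2)\<close> of the square roots
  \<open>te +/- r th\<close> of \<open>xi2\<close> and \<open>xi3\<close>.
\<close>

definition te :: "complex poly fps" where "te = evens TT0"
definition th :: "complex poly fps" where "th = odds TT0"

lemma conv_te [intro]: "conv te" and conv_th [intro]: "conv th"
  by (simp_all add: te_def th_def conv_evens conv_odds conv_TT0)

lemma ev_TT0: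
  assumes \<tau>: "Im \<tau> > 0"
  shows "ev TT0 (ex (\<tau> / 2)) X = ev te (ex \<tau>) X + ex (\<tau> / 2) * ev th (ex \<tau>) X"
    and "ev TT0 (- ex (\<tau> / 2)) X = ev te (ex \<tau>) X - ex (\<tau> / 2) * ev th (ex \<tau>) X"
  using ev_split[OF conv_TT0, of "ex (\<tau> / 2)" X] ev_split[OF conv_TT0, of "- ex (\<tau> / 2)" X] \<tau>
  by (simp_all add: te_def th_def ex_half_square)

lemma xi23_eq:
  assumes \<tau>: "Im \<tau> > 0"
  shows "xi2 \<tau> z = (ev te (ex \<tau>) (xx z) + ex (\<tau> / 2) * ev th (ex \<tau>) (xx z))\<^sup>2"
    and "xi3 \<tau> z = (ev te (ex \<tau>) (xx z) - ex (\<tau> / 2) * ev th (ex \<tau>) (xx z))\<^sup>2"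
  using \<tau> by (simp_all add: xi2_def xi3_def TT_def ev_power conv_TT0 ev_TT0)

text \<open>
  \<open>AA = 4 \<xi>\<^sub>1\<close>, \<open>EE = (\<xi>\<^sub>2 + \<xi>\<^sub>3) / 2\<close>, \<open>CC = \<xi>\<^sub>2 \<xi>\<^sub>3\<close>. With the elementary symmetric functions \<open>e\<^sub>i\<close>
  of the \<open>\<xi>\<^sub>i\<close>, the next series are \<open>4 e\<^sub>1\<close>, \<open>2 e\<^sub>2\<close>, \<open>4 e\<^sub>3\<close>, \<open>4 e\<^sub>1 e\<^sub>3 - e\<^sub>2\<^sup>2\<close> and \<open>16\<close> times the discriminant,
  written so that integrality is visible. They are Gritsenko's generators of index \<open>1, 2, 3, 4\<close>
  and the product of \<open>\<Delta>\<close> with the sixth power of \<open>KAP\<close>.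
\<close>

definition EE :: "complex poly fps" where "EE = te ^ 2 + fps_X * th ^ 2"
definition CC :: "complex poly fps" where "CC = (te ^ 2 - fps_X * th ^ 2) ^ 2"

definition PH1 :: "complex poly fps" where "PH1 = AA + fps_const [:8:] * EE"
definition PH2 :: "complex poly fps" where "PH2 = AA * EE + fps_const [:2:] * CC"
definition PH3 :: "complex poly fps" where "PH3 = AA * CC"
definition PH4 :: "complex poly fps" where "PH4 = AA * EE * CC - CC ^ 2 - fps_X * (AA * (te * th)) ^ 2"
definition DD :: "complex poly fps" where
  "DD = fps_X * ((te * th) * (AA ^ 2 - fps_const [:8:] * (AA * EE) + fps_const [:16:] * CC)) ^ 2"

lemma conv_EE [intro]: "conv EE" and conv_CC [intro]: "conv CC"
  unfolding EE_def CC_def by (intro conv_intros conv_te conv_th)+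

context
  fixes \<tau> z :: complex
  assumes \<tau>: "Im \<tau> > 0"
begin

lemma ev_EE: "ev EE (ex \<tau>) (xx z) = (xi2 \<tau> z + xi3 \<tau> z) / 2"
  using \<tau> by (simp add: EE_def ev_simps conv_te conv_th xi23_eq)
    (simp add: ex_half_square[of \<tau>, symmetric] power2_eq_square algebra_simps)

lemma ev_CC: "ev CC (ex \<tau>) (xx z) = xi2 \<tau> z * xi3 \<tau> z"
  using \<tau> by (simp add: CC_def ev_simps conv_te conv_th xi23_eq)
    (simp add: ex_half_square[of \<tau>, symmetric] power2_eq_square algebra_simps)

text \<open>The difference of the two squares in \<open>xi23_eq\<close> is odd in e(\<tau> / 2), so
  only its square is a series in q.\<close>

lemma ev_odd: "ex \<tau> * (ev te (ex \<tau>) (xx z) * ev th (ex \<tau>) (xx z))\<^sup>2 = ((xi2 \<tau> z - xi3 \<tau> z) / 4)\<^sup>2"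
proof -
  have "(xi2 \<tau> z - xi3 \<tau> z) / 4 = ex (\<tau> / 2) * (ev te (ex \<tau>) (xx z) * ev th (ex \<tau>) (xx z))"
    using \<tau> by (simp add: xi23_eq power2_eq_square algebra_simps)
  then show ?thesis by (simp add: power_mult_distrib ex_half_square)
qed

lemmas ev_gens = ev_EE ev_CC ev_AA[OF \<tau>]

lemma ev_PH1: "ev PH1 (ex \<tau>) (xx z) = 4 * (xi1 \<tau> z + xi2 \<tau> z + xi3 \<tau> z)"
  using \<tau> by (simp add: PH1_def ev_simps conv_AA conv_EE ev_gens)

lemma ev_PH2: "ev PH2 (ex \<tau>) (xx z) = 2 * (xi1 \<tau> z * xi2 \<tau> z + xi1 \<tau> z * xi3 \<tau> z + xi2 \<tau> z * xi3 \<tau> z)"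
  using \<tau> by (simp add: PH2_def ev_simps conv_AA conv_EE conv_CC ev_gens algebra_simps)

lemma ev_PH3: "ev PH3 (ex \<tau>) (xx z) = 4 * (xi1 \<tau> z * xi2 \<tau> z * xi3 \<tau> z)"
  using \<tau> by (simp add: PH3_def ev_simps conv_AA conv_CC ev_gens)

lemma ev_PH4: "ev PH4 (ex \<tau>) (xx z) = 4 * (xi1 \<tau> z + xi2 \<tau> z + xi3 \<tau> z) * (xi1 \<tau> z * xi2 \<tau> z * xi3 \<tau> z) -
    (xi1 \<tau> z * xi2 \<tau> z + xi1 \<tau> z * xi3 \<tau> z + xi2 \<tau> z * xi3 \<tau> z)\<^sup>2"
proof -
  have "ev PH4 (ex \<tau>) (xx z) = 4 * xi1 \<tau> z * ((xi2 \<tau> z + xi3 \<tau> z) / 2) * (xi2 \<tau> z * xi3 \<tau> z) - (xi2 \<tau> z * xi3 \<tau> z)\<^sup>2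
     - (4 * xi1 \<tau> z)\<^sup>2 * (ex \<tau> * (ev te (ex \<tau>) (xx z) * ev th (ex \<tau>) (xx z))\<^sup>2)"
    using \<tau> by (simp add: PH4_def ev_simps conv_AA conv_EE conv_CC conv_te conv_th ev_gens power_mult_distrib)
  also have "\<dots> = 4 * (xi1 \<tau> z + xi2 \<tau> z + xi3 \<tau> z) * (xi1 \<tau> z * xi2 \<tau> z * xi3 \<tau> z) -
    (xi1 \<tau> z * xi2 \<tau> z + xi1 \<tau> z * xi3 \<tau> z + xi2 \<tau> z * xi3 \<tau> z)\<^sup>2"
    unfolding ev_odd by (simp add: power2_eq_square field_simps)
  finally show ?thesis .
qed

lemma ev_DD: "ev DD (ex \<tau>) (xx z) =
    16 * ((xi1 \<tau> z - xi2 \<tau> z) * (xi1 \<tau> z - xi3 \<tau> z) * (xi2 \<tau> z - xi3 \<tau> z))\<^sup>2"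
proof -
  have "ev DD (ex \<tau>) (xx z) = (ex \<tau> * (ev te (ex \<tau>) (xx z) * ev th (ex \<tau>) (xx z))\<^sup>2) *
     ((4 * xi1 \<tau> z)\<^sup>2 - 8 * (4 * xi1 \<tau> z * ((xi2 \<tau> z + xi3 \<tau> z) / 2)) + 16 * (xi2 \<tau> z * xi3 \<tau> z))\<^sup>2"
    using \<tau> by (simp add: DD_def ev_simps conv_AA conv_EE conv_CC conv_te conv_th ev_gens power_mult_distrib)
  also have "(4 * xi1 \<tau> z)\<^sup>2 - 8 * (4 * xi1 \<tau> z * ((xi2 \<tau> z + xi3 \<tau> z) / 2)) + 16 * (xi2 \<tau> z * xi3 \<tau> z) =
     16 * ((xi1 \<tau> z - xi2 \<tau> z) * (xi1 \<tau> z - xi3 \<tau> z))"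
    by (simp add: power2_eq_square algebra_simps)
  finally show ?thesis unfolding ev_odd by (simp add: power_mult_distrib power_divide)
qed

end

lemma jac_PH1: "jac 0 1 PH1"
proof (rule jac_symmetric[where F = "\<lambda>a b c. 4 * (a + b + c)"])
  show "conv PH1" unfolding PH1_def by (intro conv_intros conv_AA conv_EE)
qed (simp_all only: ev_PH1, simp add: algebra_simps)

lemma jac_PH2: "jac 0 2 PH2"
proof (rule jac_symmetric[where F = "\<lambda>a b c. 2 * (a * b + a * c + b * c)"])
  show "conv PH2" unfolding PH2_def by (intro conv_intros conv_AA conv_EE conv_CC)
qed (simp_all only: ev_PH2, simp add: algebra_simps power2_eq_square)

lemma jac_PH3: "jac 0 3 PH3"
proof (rule jac_symmetric[where F = "\<lambda>a b c. 4 * (a * b * c)"])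
  show "conv PH3" unfolding PH3_def by (intro conv_intros conv_AA conv_CC)
qed (simp_all only: ev_PH3, simp add: algebra_simps power3_eq_cube)

lemma jac_PH4: "jac 0 4 PH4"
proof (rule jac_symmetric[where F = "\<lambda>a b c. 4 * (a + b + c) * (a * b * c) - (a * b + a * c + b * c)\<^sup>2"])
  show "conv PH4" unfolding PH4_def by (intro conv_intros conv_AA conv_CC conv_EE conv_te conv_th)
qed (simp_all only: ev_PH4, simp add: algebra_simps power2_eq_square power4_eq_xxxx)

lemma jac_DD: "jac 0 6 DD"
proof (rule jac_symmetric[where F = "\<lambda>a b c. 16 * ((a - b) * (a - c) * (b - c))\<^sup>2"])
  show "conv DD" unfolding DD_def by (intro conv_intros conv_AA conv_CC conv_EE conv_te conv_th)
  show "16 * ((t * b - t * a) * (t * b - t * c) * (t * a - t * c))\<^sup>2 = t ^ 6 * (16 * ((a - b) * (a - c) * (b - c))\<^sup>2)" for a b c t :: complex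
  proof -
    have "(t * b - t * a) * (t * b - t * c) * (t * a - t * c) = - (t ^ 3) * ((a - b) * (a - c) * (b - c))"
      by (simp add: power3_eq_cube algebra_simps)
    then show ?thesis by (simp add: power_mult_distrib flip: power_mult)
  qed
qed (rule ev_DD)

section \<open>Integrality and lowest coefficients of the generators\<close>

lemma ifps_TT0: "ifps TT0" and ifps_KK: "ifps KK" and ifps_AF: "ifps AF"
  unfolding TT0_def KK_def AF_def
  by (rule TT0.ifps_infprod KK.ifps_infprod AF.ifps_infprod, rule ifps_theta_factor, simp)+

lemma ifps_te: "ifps te" and ifps_th: "ifps th"
  unfolding te_def th_def by (intro ifps_evens ifps_odds ifps_TT0)+

lemma ifps_AA: "ifps AA"
  unfolding AA_def by (intro ifps_intros ifps_AF) auto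

lemma ifps_EE: "ifps EE" and ifps_CC: "ifps CC"
  unfolding EE_def CC_def by (intro ifps_intros ifps_te ifps_th)+

lemma ifps_PH: "ifps PH1" "ifps PH2" "ifps PH3" "ifps PH4" "ifps DD"
  unfolding PH1_def PH2_def PH3_def PH4_def DD_def
  by (intro ifps_intros ifps_te ifps_th ifps_AA ifps_EE ifps_CC; simp)+

lemma nth_0_KK: "fps_nth KK 0 = 1" and nth_0_AF: "fps_nth AF 0 = 1" and nth_0_TT0: "fps_nth TT0 0 = 1"
  by (simp_all add: KK_def AF_def TT0_def infprod_def)

lemma nth_1_TT0: "fps_nth TT0 1 = [:0, -1:]"
  unfolding TT0_def using TT0.nth_infprod[of 1 1] by (simp add: theta_factor_def geom_def power2_eq_square fps_mult_nth)

lemma nth_0_te: "fps_nth te 0 = 1" and nth_0_th: "fps_nth th 0 = [:0, -1:]"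
  using nth_0_TT0 nth_1_TT0 by (simp_all add: te_def th_def evens_def odds_def)

lemma fps_nth_power_0: "fps_nth (A ^ n) 0 = (fps_nth A 0 :: 'a :: comm_ring_1) ^ n"
  by (induction n) auto

lemma nth_0_gens: "fps_nth AA 0 = [:4, 1:]" "fps_nth EE 0 = 1" "fps_nth CC 0 = 1"
  unfolding AA_def EE_def CC_def by (simp_all add: fps_nth_power_0 nth_0_te nth_0_AF)

lemma nth_0_PH: "fps_nth PH1 0 = [:12, 1:]" "fps_nth PH2 0 = [:6, 1:]" "fps_nth PH3 0 = [:4, 1:]"
    "fps_nth PH4 0 = [:3, 1:]"
  unfolding PH1_def PH2_def PH3_def PH4_def
  by (simp_all add: fps_nth_power_0 nth_0_gens) (simp_all add: one_pCons)

lemma nth_DD: "fps_nth DD 0 = 0" "fps_nth DD 1 = monom 1 6"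
proof -
  show "fps_nth DD 0 = 0" by (simp add: DD_def)
  have "fps_nth DD 1 = fps_nth (((te * th) * (AA ^ 2 - fps_const [:8:] * (AA * EE) + fps_const [:16:] * CC)) ^ 2) 0"
    by (simp add: DD_def)
  also have "\<dots> = ([:0, -1:] * ([:4, 1:]\<^sup>2 - [:8:] * [:4, 1:] + [:16:])) ^ 2"
    by (simp add: fps_nth_power_0 nth_0_te nth_0_th nth_0_gens one_pCons)
  \<comment> \<open>The quadratic expression in X + 4 is (X + 4 - 4)^2 = X^2.\<close>
  also have "\<dots> = monom 1 6"
    by (simp add: power2_eq_square monom_altdef eval_nat_numeral one_pCons)
  finally show "fps_nth DD 1 = monom 1 6" .
qed

lemma nth_0_KAP: "fps_nth KAP 0 = [:0, 1:]"
  by (simp add: KAP_def fps_nth_power_0 nth_0_KK)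

section \<open>Modular forms of level one\<close>

text \<open>The point 0 is left out because q = e(\<tau>) never takes this value.\<close>

lemma powser_coeffs_zero:
  fixes a :: "nat \<Rightarrow> complex"
  assumes r: "0 < r" and sums: "\<And>q. norm q < r \<Longrightarrow> q \<noteq> 0 \<Longrightarrow> (\<lambda>n. a n * q ^ n) sums 0"
  shows "a n = 0"
proof (induction n rule: less_induct)
  case (less n)
  have "(\<lambda>k. a (k + n) * q ^ k) sums 0" if "q \<noteq> 0" "norm q < r" for q
  proof -
    have "(\<lambda>k. a (k + n) * q ^ (k + n)) sums (0 - (\<Sum>i<n. a i * q ^ i))"
      by (rule sums_split_initial_segment[OF sums]) (use that in auto)
    then have "(\<lambda>k. q ^ n * (a (k + n) * q ^ k)) sums (q ^ n * 0)"
      using less by (simp add: power_add mult_ac)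
    then show ?thesis using that by (subst (asm) sums_mult_iff) auto
  qed
  then have "((\<lambda>_. 0) \<longlongrightarrow> a (0 + n)) (at (0::complex))"
    by (intro powser_limit_0_strong[OF r, of "\<lambda>k. a (k + n)"]) auto
  then show "a n = 0" by (simp add: tendsto_const_iff)
qed

lemma powser_coeffs_eq:
  fixes a b :: "nat \<Rightarrow> complex"
  assumes r: "0 < r"
    and "\<And>q. norm q < r \<Longrightarrow> q \<noteq> 0 \<Longrightarrow> (\<lambda>n. a n * q ^ n) sums f q"
    and "\<And>q. norm q < r \<Longrightarrow> q \<noteq> 0 \<Longrightarrow> (\<lambda>n. b n * q ^ n) sums f q"
  shows "a n = b n"
proof -
  have "(\<lambda>n. (a n - b n) * q ^ n) sums 0" if "norm q < r" "q \<noteq> 0" for q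
    using sums_diff[OF assms(2,3)[OF that]] by (simp add: left_diff_distrib)
  from powser_coeffs_zero[OF r this] show ?thesis by simp
qed

section \<open>Division of a series by powers of q and of X\<close>

lemma ev_q0: "ev A 0 X = poly (fps_nth A 0) X"
  by (simp add: ev_def)

lemma pnorm_mono: "0 \<le> s \<Longrightarrow> s \<le> t \<Longrightarrow> pnorm s p \<le> pnorm t p"
proof (induction p)
  case (pCons a p)
  then have "s * pnorm s p \<le> t * pnorm t p" by (intro mult_mono pnorm_nonneg) auto
  then show ?case by simp
qed simp

lemma conv_shift_q: assumes "conv A" shows "conv (fps_shift N A)"
proof (rule convI)
  fix r s :: real assume *: "0 \<le> r" "r < 1" "0 \<le> s"
  define t where "t = (1 + r) / 2"
  have t: "0 < t" "t < 1" "r \<le> t" using * by (auto simp: t_def)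
  have "summable (\<lambda>n. pnorm s (fps_nth A (n + N)) * t ^ (n + N))"
    using convD[OF assms, of t s] t * by (subst summable_iff_shift[of "\<lambda>n. pnorm s (fps_nth A n) * t ^ n"]) auto
  then have "summable (\<lambda>n. (1 / t ^ N) * (pnorm s (fps_nth A (n + N)) * t ^ (n + N)))"
    by (rule summable_mult)
  then have "summable (\<lambda>n. pnorm s (fps_nth A (n + N)) * t ^ n)"
    using t by (simp add: power_add)
  then show "summable (\<lambda>n. pnorm s (fps_nth (fps_shift N A) n) * r ^ n)"
    by (rule summable_comparison_test'[where N = 0])
       (use * t in \<open>auto simp: abs_mult pnorm_nonneg intro!: mult_left_mono power_mono\<close>)
qed

lemma ev_shift_q:
  assumes "conv A" "\<And>i. i < N \<Longrightarrow> fps_nth A i = 0" "norm q < 1"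
  shows "ev A q X = q ^ N * ev (fps_shift N A) q X"
proof -
  have "A = fps_X ^ N * fps_shift N A"
    by (rule fps_ext) (use assms(2) in \<open>auto simp: fps_X_power_mult_nth\<close>)
  then have "ev A q X = ev (fps_X ^ N * fps_shift N A) q X" by simp
  then show ?thesis using assms by (simp add: ev_simps conv_shift_q)
qed

definition shiftX :: "nat \<Rightarrow> complex poly fps \<Rightarrow> complex poly fps" where
  "shiftX j A = Abs_fps (\<lambda>n. poly_shift j (fps_nth A n))"

text \<open>For s < 1 division by X may increase the norm; \<open>conv_shiftX\<close> therefore
  works with the radius max 1 s.\<close>

lemma pnorm_poly_shift: "1 \<le> s \<Longrightarrow> pnorm s (poly_shift j p) \<le> pnorm s p"
proof (induction j arbitrary: p)
  case (Suc j)
  obtain a r where p: "p = pCons a r" by (cases p)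
  have "poly_shift (Suc j) p = poly_shift j r" by (simp add: poly_eq_iff coeff_poly_shift p)
  also have "pnorm s \<dots> \<le> pnorm s r" using Suc by simp
  also have "\<dots> \<le> s * pnorm s r" using Suc.prems pnorm_nonneg[of s r] by (simp add: mult_le_cancel_right1)
  also have "\<dots> \<le> pnorm s p" by (simp add: p)
  finally show ?case .
qed simp

lemma conv_shiftX: assumes "conv A" shows "conv (shiftX j A)"
proof (rule convI)
  fix r s :: real assume *: "0 \<le> r" "r < 1" "0 \<le> s"
  have sm: "summable (\<lambda>n. pnorm (max 1 s) (fps_nth A n) * r ^ n)"
    using * by (intro convD[OF assms]) auto
  have le: "pnorm s (poly_shift j p) \<le> pnorm (max 1 s) p" for p
    using order.trans[OF pnorm_mono pnorm_poly_shift] * by (metis max.cobounded1 max.cobounded2)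
  show "summable (\<lambda>n. pnorm s (fps_nth (shiftX j A) n) * r ^ n)"
    using sm by (rule summable_comparison_test'[where N = 0])
      (use * le in \<open>auto intro!: mult_right_mono simp: shiftX_def abs_mult pnorm_nonneg\<close>)
qed

definition lowX :: "nat \<Rightarrow> complex poly fps \<Rightarrow> bool" where
  "lowX j A \<longleftrightarrow> (\<forall>n. \<forall>i<j. coeff (fps_nth A n) i = 0)"

lemma ev_shiftX:
  assumes "conv A" "lowX j A" "norm q < 1"
  shows "ev A q X = X ^ j * ev (shiftX j A) q X"
proof -
  have "A = fps_const (monom 1 j) * shiftX j A"
    by (rule fps_ext, rule poly_eqI) (use assms(2) in \<open>auto simp: shiftX_def lowX_def coeff_monom_mult coeff_poly_shift\<close>)
  then have "ev A q X = ev (fps_const (monom 1 j) * shiftX j A) q X" by simp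
  then show ?thesis using assms by (simp add: ev_simps conv_shiftX poly_monom)
qed

lemma nth_shiftX_0: "poly (fps_nth (shiftX j A) n) 0 = coeff (fps_nth A n) j"
  by (simp add: shiftX_def poly_0_coeff_0 coeff_poly_shift)

section \<open>Modular forms of weight 0 and of negative weight\<close>

lemma ex_surj:
  assumes "q \<noteq> 0"
  obtains \<tau> where "ex \<tau> = q"
proof
  show "ex (Ln q / (2 * of_real pi * \<i>)) = q" using assms by (simp add: ex_def)
qed

lemma ex_surj_H:
  assumes "q \<noteq> 0" "norm q < 1"
  obtains \<tau> where "ex \<tau> = q" "Im \<tau> > 0"
proof -
  obtain \<tau> where t: "ex \<tau> = q" using ex_surj[OF assms(1)] .
  with assms(2) have "Im \<tau> > 0" by (auto simp: norm_ex zero_less_mult_iff)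
  with t that show ?thesis by blast
qed

text \<open>
  As long as \<open>Im \<tau> < 1 / 2\<close>, a translation followed by the inversion at least doubles \<open>Im \<tau>\<close>.
\<close>

lemma SL2_reduction:
  fixes P :: "complex \<Rightarrow> 'a"
  assumes T: "\<And>\<tau>. P (\<tau> + 1) = P \<tau>" and S: "\<And>\<tau>. Im \<tau> > 0 \<Longrightarrow> P (- 1 / \<tau>) = P \<tau>" and \<tau>: "Im \<tau> > 0"
  shows "\<exists>\<sigma>. Im \<sigma> \<ge> 1 / 2 \<and> P \<sigma> = P \<tau>"
proof -
  \<comment> \<open>After n doublings the imaginary part is large enough; the induction keeps 1 / Im
    \<tau> < 2^n.\<close>
  obtain n :: nat where n: "1 / Im \<tau> < 2 ^ n" using real_arch_pow[of 2 "1 / Im \<tau>"] by auto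
  have "\<exists>\<sigma>. Im \<sigma> \<ge> 1 / 2 \<and> P \<sigma> = P \<tau>" if "Im \<tau> > 0" "1 / Im \<tau> < 2 ^ n" for \<tau> n
    using that
  proof (induction n arbitrary: \<tau>)
    case 0
    then show ?case by (intro exI[of _ \<tau>]) (auto simp: field_simps)
  next
    case (Suc n)
    show ?case
    proof (cases "Im \<tau> \<ge> 1 / 2")
      case False
      define \<rho> where "\<rho> = \<tau> + of_int (- round (Re \<tau>)) * 1"
      have P: "P \<rho> = P \<tau>" unfolding \<rho>_def by (rule periodic_int) (rule T)
      have im: "Im \<rho> = Im \<tau>" by (simp add: \<rho>_def)
      have "\<bar>Re \<rho>\<bar> \<le> 1 / 2" using of_int_round_abs_le[of "Re \<tau>"] by (simp add: \<rho>_def abs_minus_commute)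
      then have "(Re \<rho>)\<^sup>2 \<le> (1 / 2)\<^sup>2" by (subst abs_le_square_iff[symmetric]) simp
      moreover have "(Im \<rho>)\<^sup>2 \<le> (1 / 2)\<^sup>2" using False Suc.prems im by (intro power_mono) auto
      ultimately have b: "(Re \<rho>)\<^sup>2 + (Im \<rho>)\<^sup>2 \<le> 1 / 2" by (simp add: power2_eq_square)
      have pos: "(Re \<rho>)\<^sup>2 + (Im \<rho>)\<^sup>2 > 0" using Suc.prems im by (simp add: sum_power2_gt_zero_iff)
      have "2 * Im \<tau> \<le> Im (- 1 / \<rho>)"
      proof -
        have "2 * Im \<tau> * ((Re \<rho>)\<^sup>2 + (Im \<rho>)\<^sup>2) \<le> Im \<tau>" using b Suc.prems mult_left_mono[OF b, of "2 * Im \<tau>"] by simp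
        then show ?thesis using pos by (simp add: Im_divide im field_simps)
      qed
      moreover have "Im (- 1 / \<rho>) > 0" using Suc.prems im Im_S by metis
      moreover have "1 / (2 * Im \<tau>) < 2 ^ n" using Suc.prems by (simp add: field_simps)
      ultimately have "1 / Im (- 1 / \<rho>) < 2 ^ n" using Suc.prems
        by (smt (verit, best) frac_le)
      from Suc.IH[OF \<open>Im (- 1 / \<rho>) > 0\<close> this] obtain \<sigma> where "Im \<sigma> \<ge> 1 / 2" "P \<sigma> = P (- 1 / \<rho>)" by blast
      moreover have "P (- 1 / \<rho>) = P \<rho>" using S[of \<rho>] Suc.prems im by simp
      ultimately show ?thesis using P by auto
    qed auto
  qed
  from this[OF \<tau> n] show ?thesis .
qed

text \<open>In terms of q the reduced points lie in a closed disc inside the unit disc, on which a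
  holomorphic function attains its maximum.\<close>

lemma norm_ex_half_plane: "Im \<tau> \<ge> 1 / 2 \<Longrightarrow> norm (ex \<tau>) \<le> exp (- pi)"
  using mult_left_mono[of 1 "2 * Im \<tau>" pi] by (simp add: norm_ex)

lemma cball_exp_pi: "cball 0 (exp (- pi)) \<subseteq> ball (0::complex) 1"
proof
  fix q :: complex assume "q \<in> cball 0 (exp (- pi))"
  then have "norm q \<le> exp (- pi)" by simp
  also have "exp (- pi) < 1" by simp
  finally show "q \<in> ball 0 1" by simp
qed

context
  fixes G :: "complex \<Rightarrow> complex" and t :: nat
  assumes holo: "G holomorphic_on ball 0 1"
    and S: "\<And>\<tau>. Im \<tau> > 0 \<Longrightarrow> \<tau> ^ (2 * t) * G (ex (- 1 / \<tau>)) = G (ex \<tau>)"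
begin

lemma max_on_cball:
  obtains p where "norm p \<le> exp (- pi)" "\<And>q. norm q \<le> exp (- pi) \<Longrightarrow> norm (G q) \<le> norm (G p)"
proof -
  have "continuous_on (cball 0 (exp (- pi))) (\<lambda>q. norm (G q))"
    by (intro continuous_intros holomorphic_on_imp_continuous_on holomorphic_on_subset[OF holo] cball_exp_pi)
  then show ?thesis
    using continuous_attains_sup[of "cball 0 (exp (- pi))" "\<lambda>q. norm (G q)"] that by auto
qed

text \<open>By reduction the modulus of G on the whole unit disc is bounded by its value at an
  interior point p, and the maximum principle applies.\<close>

lemma modular_const:
  assumes t: "t = 0" and q: "norm q < 1"
  shows "G q = G 0"
proof -
  obtain p where p: "norm p \<le> exp (- pi)" "\<And>q. norm q \<le> exp (- pi) \<Longrightarrow> norm (G q) \<le> norm (G p)"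
    using max_on_cball by blast
  have e: "exp (- pi) < (1::real)" by simp
  have "norm (G q) \<le> norm (G p)" if q: "norm q < 1" for q
  proof (cases "q = 0")
    case False
    obtain \<tau> where \<tau>: "ex \<tau> = q" "Im \<tau> > 0" using ex_surj_H[OF False q] .
    have "\<exists>\<sigma>. Im \<sigma> \<ge> 1 / 2 \<and> G (ex \<sigma>) = G (ex \<tau>)"
      by (rule SL2_reduction[OF _ _ \<tau>(2)]) (use S t in \<open>auto simp: ex_add\<close>)
    then obtain \<sigma> where "Im \<sigma> \<ge> 1 / 2" "G (ex \<sigma>) = G q" using \<tau> by auto
    then show ?thesis using p(2)[OF norm_ex_half_plane] by metis
  qed (use p(2)[of 0] in auto)
  then have "G constant_on ball 0 1"
    by (intro maximum_modulus_principle[OF holo open_ball connected_ball open_ball subset_refl, of p])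
       (use le_less_trans[OF p(1) e] in auto)
  then show ?thesis using q by (auto simp: constant_on_def)
qed

text \<open>
  \<open>\<bar>G\<bar> / (Im \<tau>)\<^sup>t\<close> is invariant and bounded, so \<open>G\<close> tends to \<open>0\<close> at the unit circle.
\<close>

lemma modular_zero:
  assumes t: "t > 0" and q: "norm q < 1"
  shows "G q = 0"
proof -
  obtain p where p: "\<And>q. norm q \<le> exp (- pi) \<Longrightarrow> norm (G q) \<le> norm (G p)"
    using max_on_cball by blast
  \<comment> \<open>The factor 2^t bounds 1 / (Im \<sigma>)^t at a reduced point, where Im \<sigma>
    \<ge> 1 / 2.\<close>
  define C where "C = norm (G p) * 2 ^ t"
  define P where "P \<tau> = norm (G (ex \<tau>)) / Im \<tau> ^ t" for \<tau>
  have bound: "norm (G (ex \<tau>)) \<le> C * Im \<tau> ^ t" if \<tau>: "Im \<tau> > 0" for \<tau>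
  proof -
    have "\<exists>\<sigma>. Im \<sigma> \<ge> 1 / 2 \<and> P \<sigma> = P \<tau>"
    proof (rule SL2_reduction[OF _ _ \<tau>])
      show "P (\<tau> + 1) = P \<tau>" for \<tau> by (simp add: P_def ex_add)
      show "P (- 1 / \<tau>) = P \<tau>" if \<tau>: "Im \<tau> > 0" for \<tau>
      proof -
        have "\<tau> \<noteq> 0" using \<tau> by auto
        have "Im (- 1 / \<tau>) = Im \<tau> / norm \<tau> ^ 2"
          by (simp add: Im_divide cmod_power2)
        then have "Im (- 1 / \<tau>) ^ t = Im \<tau> ^ t / norm \<tau> ^ (2 * t)"
          by (simp only: power_divide power_mult)
        moreover have "norm (G (ex \<tau>)) = norm \<tau> ^ (2 * t) * norm (G (ex (- 1 / \<tau>)))"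
          unfolding S[OF \<tau>, symmetric] by (simp add: norm_mult norm_power)
        ultimately show ?thesis using \<open>\<tau> \<noteq> 0\<close> by (simp add: P_def del: divide_minus_left)
      qed
    qed
    then obtain \<sigma> where \<sigma>: "Im \<sigma> \<ge> 1 / 2" "P \<sigma> = P \<tau>" by blast
    have "P \<sigma> \<le> norm (G p) / (1 / 2) ^ t"
      unfolding P_def using \<sigma> p[OF norm_ex_half_plane[OF \<sigma>(1)]]
      by (intro frac_le power_mono) auto
    then have "P \<tau> \<le> C" by (simp add: \<sigma> C_def power_divide)
    then show ?thesis using \<tau> by (simp add: P_def field_simps)
  qed
  have "norm (G q) \<le> C * y ^ t" if y: "0 < y" "norm q < exp (- (2 * pi * y))" for y
  proof -
    \<comment> \<open>The circle of radius R is the line Im \<tau> = y; afterwards y tends to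
      0.\<close>
    define R where "R = exp (- (2 * pi * y))"
    have R: "0 < R" "R < 1" using y by (auto simp: R_def)
    show ?thesis
    proof (rule maximum_modulus_frontier[of G "ball 0 R"])
      show "G holomorphic_on interior (ball 0 R)"
        by (rule holomorphic_on_subset[OF holo]) (use R in auto)
      show "continuous_on (closure (ball 0 R)) G"
        by (intro holomorphic_on_imp_continuous_on holomorphic_on_subset[OF holo]) (use R in auto)
      fix w :: complex assume "w \<in> frontier (ball 0 R)"
      then have w: "norm w = R" using R by (simp add: frontier_ball)
      then obtain \<tau> where \<tau>: "ex \<tau> = w" "Im \<tau> > 0" using ex_surj_H[of w] R by (metis norm_zero order_less_irrefl)
      have "Im \<tau> = y" using w \<tau>(1)[symmetric] by (simp add: norm_ex R_def)
      then show "norm (G w) \<le> C * y ^ t" using bound[OF \<tau>(2)] \<tau> by simp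
    qed (use y in \<open>auto simp: R_def\<close>)
  qed
  moreover have "\<forall>\<^sub>F y in at_right 0. 0 < y \<and> norm q < exp (- (2 * pi * y))"
  proof (intro eventually_conj)
    have "((\<lambda>y. exp (- (2 * pi * y))) \<longlongrightarrow> exp (- (2 * pi * 0))) (at_right 0)" by (intro tendsto_intros)
    then show "\<forall>\<^sub>F y in at_right 0. norm q < exp (- (2 * pi * y))" using q by (intro order_tendstoD) auto
  qed (simp add: eventually_at_right_less)
  ultimately have "\<forall>\<^sub>F y in at_right 0. norm (G q) \<le> C * y ^ t"
    by (auto elim: eventually_mono)
  moreover have "((\<lambda>y. C * y ^ t) \<longlongrightarrow> C * 0 ^ t) (at_right 0)" by (intro tendsto_intros)
  ultimately have "norm (G q) \<le> C * 0 ^ t"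
    by (intro tendsto_lowerbound[of "\<lambda>y. C * y ^ t"]) auto
  moreover have "C * 0 ^ t = 0" using t by simp
  ultimately show ?thesis by simp
qed

end

text \<open>
  A primitive \<open>F\<close> of the function satisfies \<open>F(\<tau> + 1) = F(\<tau>) + a\<close>, where \<open>a\<close> is the constant term, and
  \<open>F(- 1 / \<tau>) - F(\<tau>)\<close> is a multiple of \<open>Ln \<tau>\<close> plus a constant. The values at \<open>\<i>\<close>, fixed by
  \<open>\<tau> \<mapsto> - 1 / \<tau>\<close>, and at \<open>\<omega> = exp(\<i> \<pi> / 3)\<close>, where \<open>- 1 / \<omega> = \<omega> - 1\<close>, determine \<open>a\<close>.
\<close>

lemma quasimodular_const_term:
  fixes k :: complex
  assumes A: "conv A"
    and S: "\<And>\<tau>. Im \<tau> > 0 \<Longrightarrow> ev A (ex (- 1 / \<tau>)) 0 = \<tau>\<^sup>2 * ev A (ex \<tau>) 0 - \<i> * k * \<tau> / (2 * of_real pi)"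
  shows "poly (fps_nth A 0) 0 = k / 12"
proof -
  define a where "a = poly (fps_nth A 0) 0"
  define B where "B = fps_shift 1 A"
  have AB: "ev A q 0 = a + q * ev B q 0" if "norm q < 1" for q
  proof -
    have "A = fps_const (fps_nth A 0) + fps_X * B"
      by (rule fps_ext) (auto simp: B_def)
    then have "ev A q 0 = ev (fps_const (fps_nth A 0) + fps_X * B) q 0" by simp
    then show ?thesis using that A by (simp add: ev_simps a_def B_def conv_shift_q)
  qed
  have "(\<lambda>q. ev B q 0) holomorphic_on ball 0 1"
    unfolding B_def by (intro holomorphic_ev_q conv_shift_q A)
  then obtain P where P0: "\<And>q. q \<in> ball 0 1 \<Longrightarrow> (P has_field_derivative ev B q 0) (at q within ball 0 1)"
    using holomorphic_convex_primitive'[OF convex_ball open_ball] by blast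
  then have P: "(P has_field_derivative ev B q 0) (at q)" if "norm q < 1" for q
  proof -
    have "at q within ball 0 1 = at q" using that by (intro at_within_open) auto
    with P0[of q] that show ?thesis by simp
  qed
  \<comment> \<open>Since dq = 2 pi \<i> q d\<tau>, the part q B(q) of the function has the
    primitive P(q) / (2 pi \<i>).\<close>
  define F where "F \<tau> = a * \<tau> + P (ex \<tau>) / (2 * of_real pi * \<i>)" for \<tau>
  have F: "(F has_field_derivative ev A (ex \<tau>) 0) (at \<tau>)" if \<tau>: "Im \<tau> > 0" for \<tau>
  proof -
    have "((\<lambda>\<tau>. P (ex \<tau>)) has_field_derivative ev B (ex \<tau>) 0 * (ex \<tau> * (2 * of_real pi * \<i>))) (at \<tau>)"
    proof (rule DERIV_chain2[OF P])
      show "(ex has_field_derivative ex \<tau> * (2 * of_real pi * \<i>)) (at \<tau>)"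
        unfolding ex_def by (rule derivative_eq_intros refl | simp)+
    qed (use \<tau> in simp)
    then have "(F has_field_derivative a * 1 + ev B (ex \<tau>) 0 * (ex \<tau> * (2 * of_real pi * \<i>)) / (2 * of_real pi * \<i>)) (at \<tau>)"
      unfolding F_def by (intro DERIV_add DERIV_cmult DERIV_cdivide DERIV_ident)
    then show ?thesis using AB[of "ex \<tau>"] \<tau> by (simp add: mult_ac)
  qed
  have FT: "F (\<tau> + 1) = F \<tau> + a" for \<tau> by (simp add: F_def ex_add algebra_simps)
  define D where "D \<tau> = F (- 1 / \<tau>) - F \<tau> + \<i> * k / (2 * of_real pi) * Ln \<tau>" for \<tau>
  have "(D has_field_derivative 0) (at \<tau> within {\<tau>. Im \<tau> > 0})" if \<tau>: "\<tau> \<in> {\<tau>. Im \<tau> > 0}" for \<tau>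
  proof -
    have im: "Im \<tau> > 0" and t0: "\<tau> \<noteq> 0" and nr: "\<tau> \<notin> \<real>\<^sub>\<le>\<^sub>0" using \<tau> by (auto simp: complex_nonpos_Reals_iff)
    have "((\<lambda>\<tau>. - 1 / \<tau>) has_field_derivative 1 / \<tau>\<^sup>2) (at \<tau>)"
      using t0 by (auto intro!: derivative_eq_intros simp: power2_eq_square)
    then have "((\<lambda>\<tau>. F (- 1 / \<tau>)) has_field_derivative ev A (ex (- 1 / \<tau>)) 0 * (1 / \<tau>\<^sup>2)) (at \<tau>)"
      by (rule DERIV_chain2[where f = F and g = "\<lambda>\<tau>. - 1 / \<tau>" and x = \<tau>, OF F[OF Im_S[OF im]]])
    then have "(D has_field_derivative ev A (ex (- 1 / \<tau>)) 0 * (1 / \<tau>\<^sup>2) - ev A (ex \<tau>) 0 + \<i> * k / (2 * of_real pi) * inverse \<tau>) (at \<tau>)"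
      unfolding D_def by (intro DERIV_add DERIV_diff DERIV_cmult F im has_field_derivative_Ln nr)
    also have "ev A (ex (- 1 / \<tau>)) 0 * (1 / \<tau>\<^sup>2) - ev A (ex \<tau>) 0 + \<i> * k / (2 * of_real pi) * inverse \<tau> = 0"
      unfolding S[OF im] using t0 by (simp add: field_simps power2_eq_square)
    finally show ?thesis by (rule has_field_derivative_at_within)
  qed
  then obtain c where c: "\<And>\<tau>. Im \<tau> > 0 \<Longrightarrow> D \<tau> = c"
    using has_field_derivative_zero_constant[OF convex_halfspace_Im_gt[of 0], of D] by auto
  \<comment> \<open>The values of F cancel at the fixed point, and Ln \<i> = \<i> pi / 2
    remains.\<close>
  have "D \<i> = - k / 4" by (simp add: D_def mult_ac)
  then have c1: "c = - k / 4" using c[of \<i>] by simp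
  define \<omega> where "\<omega> = exp (\<i> * (of_real pi / 3))"
  have \<omega>: "Re \<omega> = 1 / 2" "Im \<omega> = sqrt 3 / 2" by (simp_all add: \<omega>_def Re_exp Im_exp cos_60 sin_60)
  have e1: "- 1 / \<omega> = \<omega> - 1"
  proof -
    have "\<omega> * (\<omega> - 1) = - 1" by (simp add: complex_eq_iff \<omega>)
    moreover have "\<omega> \<noteq> 0" by (simp add: \<omega>_def)
    ultimately show ?thesis by (simp add: field_simps)
  qed
  have e2: "Ln \<omega> = \<i> * (of_real pi / 3)" unfolding \<omega>_def by (rule Ln_exp) auto
  have e3: "F \<omega> = F (\<omega> - 1) + a" using FT[of "\<omega> - 1"] by simp
  \<comment> \<open>Here F contributes -a and the logarithm -k / 6; comparison with -k / 4 gives a =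
    (1/4 - 1/6) k, the source of the 12.\<close>
  have "D \<omega> = - a + \<i> * k / (2 * of_real pi) * (\<i> * (of_real pi / 3))" unfolding D_def e1 e2 e3 by simp
  also have "\<dots> = - a - k / 6" by (simp add: mult_ac)
  finally have "- a - k / 6 = - k / 4" using c[of \<omega>] c1 \<omega> by simp
  then show ?thesis unfolding a_def[symmetric] by (simp add: field_simps)
qed

section \<open>Leading coefficients of Jacobi forms\<close>

text \<open>Factor y^2 - 1 as (y - 1) (y + 1) with y = sin w / w; the first factor is governed by
  the cubic Taylor term of the sine.\<close>

lemma tendsto_sin_quadratic:
  "((\<lambda>z. ((sin (c * z) / (c * z))\<^sup>2 - 1) / z\<^sup>2) \<longlongrightarrow> - (c\<^sup>2 / 3 :: complex)) (at 0)" if "c \<noteq> 0"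
proof -
  have lim1: "((\<lambda>w. (sin w - w) / w ^ 3) \<longlongrightarrow> - (1 / 6 :: complex)) (at 0)"
  proof -
    have b: "norm ((sin w - w) / w ^ 3 - - (1 / 6)) \<le> exp 1 * norm w" if "norm w < 1" and False: "w \<noteq> 0" for w :: complex
    proof -
      have T: "norm (sin w - (w - w ^ 3 / 6)) \<le> exp \<bar>Im w\<bar> * norm w ^ 4 / 6"
      proof -
        have "{..3::nat} = {0, 1, 2, 3}" by auto
        then have "(\<Sum>k\<le>3. complex_of_real (sin_coeff k) * w ^ k) = w - w ^ 3 / 6"
          by (simp add: sin_coeff_def fact_numeral)
        then show ?thesis using Taylor_sin[of w 3] by (simp add: fact_numeral)
      qed
      have "exp \<bar>Im w\<bar> \<le> exp 1" using abs_Im_le_cmod[of w] that by simp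
      then have "exp \<bar>Im w\<bar> * norm w ^ 4 \<le> exp 1 * norm w ^ 4" by (intro mult_right_mono) auto
      moreover have "exp \<bar>Im w\<bar> * norm w ^ 4 / 6 \<le> exp \<bar>Im w\<bar> * norm w ^ 4" by simp
      ultimately have "exp \<bar>Im w\<bar> * norm w ^ 4 / 6 \<le> exp 1 * norm w ^ 4" by linarith
      with T have "norm (sin w - (w - w ^ 3 / 6)) \<le> exp 1 * norm w ^ 4" by simp
      moreover have "(sin w - w) / w ^ 3 - - (1 / 6) = (sin w - (w - w ^ 3 / 6)) / w ^ 3"
        using False by (simp add: field_simps)
      ultimately have "norm ((sin w - w) / w ^ 3 - - (1 / 6)) \<le> exp 1 * norm w ^ 4 / norm w ^ 3"
        by (simp add: norm_divide norm_power divide_right_mono)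
      also have "\<dots> = exp 1 * norm w" using False by (simp add: eval_nat_numeral)
      finally show ?thesis .
    qed
    have "((\<lambda>w. (sin w - w) / w ^ 3 - - (1 / 6)) \<longlongrightarrow> 0) (at (0::complex))"
    proof (rule Lim_null_comparison)
      show "\<forall>\<^sub>F w in at 0. norm ((sin w - w) / w ^ 3 - - (1 / 6)) \<le> exp 1 * norm (w::complex)"
        unfolding eventually_at using b by (intro exI[of _ 1]) auto
      have "((\<lambda>w::complex. exp 1 * norm w) \<longlongrightarrow> exp 1 * norm (0::complex)) (at 0)" by (intro tendsto_intros)
      then show "((\<lambda>w::complex. exp 1 * norm w) \<longlongrightarrow> 0) (at 0)" by simp
    qed
    then show ?thesis by (rule LIM_zero_cancel)
  qed
  have f: "filterlim (\<lambda>z. c * z) (at 0) (at 0)"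
  proof (rule filterlim_atI)
    have "((\<lambda>z. c * z) \<longlongrightarrow> c * 0) (at 0)" by (intro tendsto_intros)
    then show "((\<lambda>z. c * z) \<longlongrightarrow> 0) (at 0)" by simp
    show "\<forall>\<^sub>F z in at 0. c * z \<noteq> 0" using that by (auto simp: eventually_at_filter)
  qed
  have "((\<lambda>z. c\<^sup>2 * ((sin (c * z) - c * z) / (c * z) ^ 3) * (sin (c * z) / z / c + 1)) \<longlongrightarrow> c\<^sup>2 * - (1 / 6) * (c / c + 1)) (at 0)"
    using that by (intro tendsto_intros tendsto_sin_over filterlim_compose[OF lim1 f])
  also have "c\<^sup>2 * - (1 / 6) * (c / c + 1) = - (c\<^sup>2 / 3)" using that by simp
  finally show ?thesis
  proof (rule Lim_transform_eventually)
    have "c\<^sup>2 * ((sin (c * z) - c * z) / (c * z) ^ 3) * (sin (c * z) / z / c + 1) = ((sin (c * z) / (c * z))\<^sup>2 - 1) / z\<^sup>2"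
      if "z \<noteq> 0" for z
      using that \<open>c \<noteq> 0\<close> by (simp add: field_simps power2_eq_square power3_eq_cube)
    then show "\<forall>\<^sub>F z in at 0. c\<^sup>2 * ((sin (c * z) - c * z) / (c * z) ^ 3) * (sin (c * z) / z / c + 1) =
        ((sin (c * z) / (c * z))\<^sup>2 - 1) / z\<^sup>2" by (auto simp: eventually_at_filter)
  qed
qed

text \<open>Take out the factor y - L of y^s - L^s: divided by z^2 it has a limit by the preceding
  lemma, and the cofactor tends to s L^(s-1).\<close>

lemma tendsto_xx_power:
  fixes \<tau> :: complex
  assumes \<tau>: "\<tau> \<noteq> 0"
  defines "L \<equiv> - 4 * (of_real pi / \<tau>)\<^sup>2"
  shows "((\<lambda>z. ((xx (z / \<tau>) / z\<^sup>2) ^ s - L ^ s) / z\<^sup>2) \<longlongrightarrow> of_nat s * L ^ s * - ((of_real pi / \<tau>)\<^sup>2 / 3)) (at 0)"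
proof -
  define c where "c = of_real pi / \<tau>"
  have c: "c \<noteq> 0" using \<tau> by (simp add: c_def)
  define y where "y z = xx (z / \<tau>) / z\<^sup>2" for z
  have y: "(y \<longlongrightarrow> L) (at 0)" unfolding y_def L_def by (rule tendsto_xx_over)
  have "((\<lambda>z. L * (((sin (c * z) / (c * z))\<^sup>2 - 1) / z\<^sup>2) * (\<Sum>i<s. y z ^ i * L ^ (s - Suc i))) \<longlongrightarrow>
     L * - (c\<^sup>2 / 3) * (\<Sum>i<s. L ^ i * L ^ (s - Suc i))) (at 0)"
    by (intro tendsto_intros tendsto_sin_quadratic[OF c] y)
  also have "L * - (c\<^sup>2 / 3) * (\<Sum>i<s. L ^ i * L ^ (s - Suc i)) = of_nat s * L ^ s * - (c\<^sup>2 / 3)"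
  proof -
    have "(\<Sum>i<s. L ^ i * L ^ (s - Suc i)) = (\<Sum>i<s. L ^ (s - 1))"
      by (intro sum.cong) (auto simp flip: power_add)
    then show ?thesis by (cases s) auto
  qed
  finally have "((\<lambda>z. L * (((sin (c * z) / (c * z))\<^sup>2 - 1) / z\<^sup>2) * (\<Sum>i<s. y z ^ i * L ^ (s - Suc i))) \<longlongrightarrow>
     of_nat s * L ^ s * - (c\<^sup>2 / 3)) (at 0)" .
  then have "((\<lambda>z. (y z ^ s - L ^ s) / z\<^sup>2) \<longlongrightarrow> of_nat s * L ^ s * - (c\<^sup>2 / 3)) (at 0)"
  proof (rule Lim_transform_eventually)
    have "L * (((sin (c * z) / (c * z))\<^sup>2 - 1) / z\<^sup>2) * (\<Sum>i<s. y z ^ i * L ^ (s - Suc i)) = (y z ^ s - L ^ s) / z\<^sup>2"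
      if "z \<noteq> 0" for z
    proof -
      have "L * ((sin (c * z) / (c * z))\<^sup>2 - 1) = y z - L"
        using c that \<tau> by (simp add: y_def xx_sin L_def c_def field_simps power2_eq_square)
      moreover have "y z ^ s - L ^ s = (y z - L) * (\<Sum>i<s. y z ^ i * L ^ (s - Suc i))"
        by (simp add: power_diff_sumr2 mult.commute)
      ultimately show ?thesis by (simp add: mult_ac)
    qed
    then show "\<forall>\<^sub>F z in at 0. L * (((sin (c * z) / (c * z))\<^sup>2 - 1) / z\<^sup>2) * (\<Sum>i<s. y z ^ i * L ^ (s - Suc i)) = (y z ^ s - L ^ s) / z\<^sup>2"
      by (auto simp: eventually_at_filter)
  qed
  then show ?thesis by (simp add: y_def c_def)
qed

lemma tendsto_ex_power: "((\<lambda>z. (ex (z\<^sup>2 / \<tau>) ^ K - 1) / z\<^sup>2) \<longlongrightarrow> 2 * of_real pi * \<i> * of_nat K / \<tau>) (at 0)"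
proof -
  define a where "a = 2 * of_real pi * \<i> * of_nat K / \<tau>"
  have "((\<lambda>w. exp (a * w)) has_field_derivative a) (at 0)"
    by (rule derivative_eq_intros refl | simp)+
  then have "((\<lambda>w. (exp (a * w) - 1) / w) \<longlongrightarrow> a) (at 0)" by (simp add: DERIV_def)
  moreover have "filterlim (\<lambda>z::complex. z\<^sup>2) (at 0) (at 0)"
  proof (rule filterlim_atI)
    have "((\<lambda>z::complex. z\<^sup>2) \<longlongrightarrow> 0\<^sup>2) (at 0)" by (intro tendsto_intros)
    then show "((\<lambda>z::complex. z\<^sup>2) \<longlongrightarrow> 0) (at 0)" by simp
  qed (auto simp: eventually_at_filter)
  ultimately have "((\<lambda>z. (exp (a * z\<^sup>2) - 1) / z\<^sup>2) \<longlongrightarrow> a) (at 0)" by (rule filterlim_compose)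
  moreover have "exp (a * z\<^sup>2) = ex (z\<^sup>2 / \<tau>) ^ K" for z
    unfolding ex_of_nat_mult[symmetric] by (simp add: a_def ex_def mult_ac)
  ultimately show ?thesis by (simp add: a_def)
qed

lemma lowX_Suc:
  assumes "lowX j A" "\<And>n. coeff (fps_nth A n) j = 0"
  shows "lowX (Suc j) A"
  using assms by (auto simp: lowX_def less_Suc_eq)

context
  fixes s K :: nat and A :: "complex poly fps"
  assumes jac: "jac s K A"
begin

lemma conv_A: "conv A" using jac by (rule jac_conv)

lemma jac_lowX_S:
  assumes low: "lowX j A" and \<tau>: "Im \<tau> > 0" and z: "z \<noteq> 0"
  shows "\<tau> ^ (2 * s) * ((xx (z / \<tau>) / z\<^sup>2) ^ j * ev (shiftX j A) (ex (- 1 / \<tau>)) (xx (z / \<tau>))) =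
     ex (z\<^sup>2 / \<tau>) ^ K * ((xx z / z\<^sup>2) ^ j * ev (shiftX j A) (ex \<tau>) (xx z))"
proof -
  have q: "norm (ex \<tau>) < 1" "norm (ex (- 1 / \<tau>)) < 1" using \<tau> Im_S[OF \<tau>] by (auto simp del: divide_minus_left)
  show ?thesis using jac_S[OF jac \<tau>, of z] z
    unfolding ev_shiftX[OF conv_A low q(1)] ev_shiftX[OF conv_A low q(2)]
    by (simp add: power_divide field_simps del: divide_minus_left)
qed

text \<open>Let z tend to 0 in \<open>jac_lowX_S\<close>: once X^j divides the form, the coefficient
  of X^j is modular of weight 2 j - 2 s.\<close>

lemma jac_leading_S:
  assumes low: "lowX j A" and \<tau>: "Im \<tau> > 0"
  shows "\<tau> ^ (2 * s) * ev (shiftX j A) (ex (- 1 / \<tau>)) 0 = \<tau> ^ (2 * j) * ev (shiftX j A) (ex \<tau>) 0"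
proof -
  have q: "norm (ex \<tau>) < 1" "norm (ex (- 1 / \<tau>)) < 1" using \<tau> Im_S[OF \<tau>] by (auto simp del: divide_minus_left)
  have \<tau>0: "\<tau> \<noteq> 0" using \<tau> by auto
  have "((\<lambda>z. \<tau> ^ (2 * s) * ((xx (z / \<tau>) / z\<^sup>2) ^ j * ev (shiftX j A) (ex (- 1 / \<tau>)) (xx (z / \<tau>)))) \<longlongrightarrow>
      \<tau> ^ (2 * s) * ((- 4 * (of_real pi / \<tau>)\<^sup>2) ^ j * ev (shiftX j A) (ex (- 1 / \<tau>)) 0)) (at 0)"
    by (intro tendsto_mult tendsto_const tendsto_power tendsto_xx_over tendsto_ev_xx conv_shiftX conv_A q)
  then have "((\<lambda>z. ex (z\<^sup>2 / \<tau>) ^ K * ((xx (z / 1) / z\<^sup>2) ^ j * ev (shiftX j A) (ex \<tau>) (xx (z / 1)))) \<longlongrightarrow>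
      \<tau> ^ (2 * s) * ((- 4 * (of_real pi / \<tau>)\<^sup>2) ^ j * ev (shiftX j A) (ex (- 1 / \<tau>)) 0)) (at 0)"
    by (rule Lim_transform_eventually) (use jac_lowX_S[OF low \<tau>] in \<open>simp add: eventually_at_filter\<close>)
  moreover have "((\<lambda>z. ex (z\<^sup>2 / \<tau>) ^ K * ((xx (z / 1) / z\<^sup>2) ^ j * ev (shiftX j A) (ex \<tau>) (xx (z / 1)))) \<longlongrightarrow>
      ex (0\<^sup>2 / \<tau>) ^ K * ((- 4 * (of_real pi / 1)\<^sup>2) ^ j * ev (shiftX j A) (ex \<tau>) 0)) (at 0)"
    by (intro tendsto_mult tendsto_power tendsto_xx_over tendsto_ev_xx conv_shiftX conv_A q)
       (unfold ex_def, intro tendsto_intros, simp add: \<tau>0)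
  ultimately have "\<tau> ^ (2 * s) * ((- 4 * (of_real pi / \<tau>)\<^sup>2) ^ j * ev (shiftX j A) (ex (- 1 / \<tau>)) 0) =
     ex (0\<^sup>2 / \<tau>) ^ K * ((- 4 * (of_real pi / 1)\<^sup>2) ^ j * ev (shiftX j A) (ex \<tau>) 0)"
    by (rule LIM_unique)
  moreover define P Q :: complex where "P = (- 4 * (of_real pi / \<tau>)\<^sup>2) ^ j" and "Q = (- 4 * (of_real pi / 1)\<^sup>2) ^ j"
  ultimately have e: "\<tau> ^ (2 * s) * (P * ev (shiftX j A) (ex (- 1 / \<tau>)) 0) = Q * ev (shiftX j A) (ex \<tau>) 0" by simp
  have PQ: "\<tau> ^ (2 * j) * P = Q"
    using \<tau>0 by (simp add: P_def Q_def power_mult power_divide flip: power_mult_distrib)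
  have "Q * (\<tau> ^ (2 * s) * ev (shiftX j A) (ex (- 1 / \<tau>)) 0) =
      \<tau> ^ (2 * j) * (\<tau> ^ (2 * s) * (P * ev (shiftX j A) (ex (- 1 / \<tau>)) 0))"
    unfolding PQ[symmetric] by (simp only: mult_ac)
  also have "\<dots> = Q * (\<tau> ^ (2 * j) * ev (shiftX j A) (ex \<tau>) 0)" unfolding e by (simp only: mult_ac)
  finally show ?thesis by (simp add: Q_def del: divide_minus_left)
qed

text \<open>For j < s the weight 2 j - 2 s is negative, so \<open>modular_zero\<close> removes one
  power of X after the other.\<close>

lemma jac_lowX: "j \<le> s \<Longrightarrow> lowX j A"
proof (induction j)
  case (Suc j)
  then have low: "lowX j A" by simp
  have S: "\<tau> ^ (2 * (s - j)) * ev (shiftX j A) (ex (- 1 / \<tau>)) 0 = ev (shiftX j A) (ex \<tau>) 0" if \<tau>: "Im \<tau> > 0" for \<tau>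
  proof -
    have "2 * s = 2 * j + 2 * (s - j)" using Suc.prems by simp
    then have "\<tau> ^ (2 * s) = \<tau> ^ (2 * j) * \<tau> ^ (2 * (s - j))" by (metis power_add)
    moreover have "\<tau> \<noteq> 0" using \<tau> by auto
    ultimately show ?thesis using jac_leading_S[OF low \<tau>] by (simp add: mult.assoc del: divide_minus_left)
  qed
  have z: "ev (shiftX j A) q 0 = 0" if "norm q < 1" for q
    by (rule modular_zero[OF holomorphic_ev_q[OF conv_shiftX[OF conv_A]] S _ that]) (use Suc.prems in auto)
  have "coeff (fps_nth A n) j = 0" for n
  proof -
    have "poly (fps_nth (shiftX j A) n) 0 = 0"
    proof (rule powser_coeffs_zero[of 1])
      fix q :: complex assume "norm q < 1"
      then show "(\<lambda>n. poly (fps_nth (shiftX j A) n) 0 * q ^ n) sums 0"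
        using ev_sums[OF conv_shiftX[OF conv_A], of q j 0] z by simp
    qed simp
    then show ?thesis by (simp add: nth_shiftX_0)
  qed
  with low show ?case by (rule lowX_Suc)
qed (simp add: lowX_def)

text \<open>
  The first two Taylor coefficients in \<open>X\<close> of \<open>A / X\<^sup>s\<close> are a constant \<open>c\<close> and a function that is
  quasimodular of weight \<open>2\<close>; the transformation law of the latter comes from comparing the
  coefficients of \<open>z\<^sup>2\<close>.
\<close>

lemma jac_second_coeff:
  "12 * coeff (fps_nth A 0) (Suc s) = (of_nat K - of_nat s) * coeff (fps_nth A 0) s"
proof -
  define B where "B = shiftX s A"
  have low: "lowX s A" by (rule jac_lowX) simp
  have cB: "conv B" unfolding B_def by (intro conv_shiftX conv_A)
  define c where "c = coeff (fps_nth A 0) s"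
  have const: "ev B q 0 = c" if q: "norm q < 1" for q
  proof -
    have "ev B q 0 = ev B 0 0"
    proof (rule modular_const[OF holomorphic_ev_q[OF cB] _ refl q])
      fix \<tau> :: complex assume \<tau>: "Im \<tau> > 0"
      have "\<tau> \<noteq> 0" using \<tau> by auto
      then show "\<tau> ^ (2 * 0) * ev B (ex (- 1 / \<tau>)) 0 = ev B (ex \<tau>) 0"
        using jac_leading_S[OF low \<tau>] by (simp add: B_def del: divide_minus_left)
    qed
    then show ?thesis unfolding ev_q0 B_def nth_shiftX_0 c_def .
  qed
  define B' where "B' = B - fps_const [:c:]"
  have cB': "conv B'" unfolding B'_def by (intro conv_intros cB)
  have low': "lowX 1 B'"
  proof -
    have "poly (fps_nth B' n) 0 = 0" for n
    proof (rule powser_coeffs_zero[of 1])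
      fix q :: complex assume "norm q < 1"
      then show "(\<lambda>n. poly (fps_nth B' n) 0 * q ^ n) sums 0"
        using ev_sums[OF cB', of q 0] const by (simp add: B'_def ev_diff cB)
    qed simp
    then show ?thesis by (simp add: lowX_def poly_0_coeff_0)
  qed
  define C where "C = shiftX 1 B'"
  have cC: "conv C" unfolding C_def by (intro conv_shiftX cB')
  have BC: "ev B q X = c + X * ev C q X" if "norm q < 1" for q X
    using ev_shiftX[OF cB' low' that, of X] that by (simp add: B'_def C_def ev_diff cB diff_eq_eq add.commute)
  define L where "L = - 4 * (of_real pi :: complex)\<^sup>2"
  have L0: "L \<noteq> 0" by (simp add: L_def)
  have S: "ev C (ex (- 1 / \<tau>)) 0 / \<tau>\<^sup>2 + c * of_nat s / 12 * (1 / \<tau>\<^sup>2 - 1) =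
      ev C (ex \<tau>) 0 - \<i> * of_nat K * c / (2 * of_real pi * \<tau>)" if \<tau>: "Im \<tau> > 0" for \<tau>
  proof -
    have q: "norm (ex \<tau>) < 1" "norm (ex (- 1 / \<tau>)) < 1" using \<tau> Im_S[OF \<tau>] by (auto simp del: divide_minus_left)
    have \<tau>0: "\<tau> \<noteq> 0" using \<tau> by auto
    define M where "M = - 4 * (of_real pi / \<tau>)\<^sup>2"
    have MtL: "\<tau>\<^sup>2 * M = L" using \<tau>0 by (simp add: M_def L_def power_divide)
    then have MtLs: "\<tau> ^ (2 * s) * M ^ s = L ^ s" by (simp add: power_mult flip: power_mult_distrib)
    let ?a = "\<lambda>z. xx (z / \<tau>) / z\<^sup>2" and ?b = "\<lambda>z. xx (z / 1) / z\<^sup>2" and ?e = "\<lambda>z. ex (z\<^sup>2 / \<tau>) ^ K"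
    have lb: "(?b \<longlongrightarrow> L) (at 0)" using tendsto_xx_over[of 1] by (simp add: L_def)
    have la: "(?a \<longlongrightarrow> M) (at 0)" using tendsto_xx_over[of \<tau>] by (simp add: M_def)
    have l1: "((\<lambda>z. (?a z ^ s - M ^ s) / z\<^sup>2) \<longlongrightarrow> of_nat s * M ^ s * - ((of_real pi / \<tau>)\<^sup>2 / 3)) (at 0)"
      unfolding M_def by (rule tendsto_xx_power[OF \<tau>0])
    have l2: "((\<lambda>z. (?b z ^ s - L ^ s) / z\<^sup>2) \<longlongrightarrow> of_nat s * L ^ s * - ((of_real pi)\<^sup>2 / 3)) (at 0)"
      using tendsto_xx_power[of 1 s] by (simp add: L_def)
    have le: "(?e \<longlongrightarrow> ex (0\<^sup>2 / \<tau>) ^ K) (at 0)" unfolding ex_def by (intro tendsto_intros) (simp add: \<tau>0)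
    \<comment> \<open>The transformation law minus its limit at z = 0, divided by z^2 and grouped
      into difference quotients with known limits.\<close>
    have id: "\<tau> ^ (2 * s) * (c * ((?a z ^ s - M ^ s) / z\<^sup>2) + ?a z ^ s * ?a z * ev C (ex (- 1 / \<tau>)) (xx (z / \<tau>))) =
       c * ((?b z ^ s - L ^ s) / z\<^sup>2) + ?b z ^ s * c * ((?e z - 1) / z\<^sup>2) + ?e z * ?b z ^ s * ?b z * ev C (ex \<tau>) (xx (z / 1))"
      if z: "z \<noteq> 0" for z
    proof -
      have E: "\<tau> ^ (2 * s) * (?a z ^ s * (c + xx (z / \<tau>) * ev C (ex (- 1 / \<tau>)) (xx (z / \<tau>)))) =
          ?e z * (?b z ^ s * (c + xx (z / 1) * ev C (ex \<tau>) (xx (z / 1))))"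
        using jac_lowX_S[OF low \<tau> z] unfolding B_def[symmetric] BC[OF q(1)] BC[OF q(2)] by simp
      have "\<tau> ^ (2 * s) * (c * ((?a z ^ s - M ^ s) / z\<^sup>2) + ?a z ^ s * ?a z * ev C (ex (- 1 / \<tau>)) (xx (z / \<tau>)))
         = (\<tau> ^ (2 * s) * (?a z ^ s * (c + xx (z / \<tau>) * ev C (ex (- 1 / \<tau>)) (xx (z / \<tau>)))) - (\<tau> ^ (2 * s) * M ^ s) * c) / z\<^sup>2"
        by (simp add: diff_divide_distrib add_divide_distrib algebra_simps del: divide_minus_left)
      also have "\<dots> = (?e z * (?b z ^ s * (c + xx (z / 1) * ev C (ex \<tau>) (xx (z / 1)))) - L ^ s * c) / z\<^sup>2"
        unfolding E MtLs ..
      also have "\<dots> = c * ((?b z ^ s - L ^ s) / z\<^sup>2) + ?b z ^ s * c * ((?e z - 1) / z\<^sup>2) + ?e z * ?b z ^ s * ?b z * ev C (ex \<tau>) (xx (z / 1))"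
        by (simp add: diff_divide_distrib add_divide_distrib algebra_simps)
      finally show ?thesis .
    qed
    have "((\<lambda>z. \<tau> ^ (2 * s) * (c * ((?a z ^ s - M ^ s) / z\<^sup>2) + ?a z ^ s * ?a z * ev C (ex (- 1 / \<tau>)) (xx (z / \<tau>)))) \<longlongrightarrow>
       \<tau> ^ (2 * s) * (c * (of_nat s * M ^ s * - ((of_real pi / \<tau>)\<^sup>2 / 3)) + M ^ s * M * ev C (ex (- 1 / \<tau>)) 0)) (at 0)"
      by (intro tendsto_mult tendsto_add tendsto_power tendsto_const l1 la tendsto_ev_xx cC q)
    then have "((\<lambda>z. c * ((?b z ^ s - L ^ s) / z\<^sup>2) + ?b z ^ s * c * ((?e z - 1) / z\<^sup>2) + ?e z * ?b z ^ s * ?b z * ev C (ex \<tau>) (xx (z / 1))) \<longlongrightarrow>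
       \<tau> ^ (2 * s) * (c * (of_nat s * M ^ s * - ((of_real pi / \<tau>)\<^sup>2 / 3)) + M ^ s * M * ev C (ex (- 1 / \<tau>)) 0)) (at 0)"
      by (rule Lim_transform_eventually) (use id in \<open>simp add: eventually_at_filter\<close>)
    moreover have "((\<lambda>z. c * ((?b z ^ s - L ^ s) / z\<^sup>2) + ?b z ^ s * c * ((?e z - 1) / z\<^sup>2) + ?e z * ?b z ^ s * ?b z * ev C (ex \<tau>) (xx (z / 1))) \<longlongrightarrow>
       c * (of_nat s * L ^ s * - ((of_real pi)\<^sup>2 / 3)) + L ^ s * c * (2 * of_real pi * \<i> * of_nat K / \<tau>) + ex (0\<^sup>2 / \<tau>) ^ K * L ^ s * L * ev C (ex \<tau>) 0) (at 0)"
      by (intro tendsto_mult tendsto_add tendsto_power tendsto_const l2 lb le tendsto_ex_power tendsto_ev_xx cC q)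
    ultimately have E: "\<tau> ^ (2 * s) * (c * (of_nat s * M ^ s * - ((of_real pi / \<tau>)\<^sup>2 / 3)) + M ^ s * M * ev C (ex (- 1 / \<tau>)) 0) =
       c * (of_nat s * L ^ s * - ((of_real pi)\<^sup>2 / 3)) + L ^ s * c * (2 * of_real pi * \<i> * of_nat K / \<tau>) + ex (0\<^sup>2 / \<tau>) ^ K * L ^ s * L * ev C (ex \<tau>) 0"
      by (rule LIM_unique)
    have M12: "- ((of_real pi / \<tau>)\<^sup>2 / 3) = M / 12" and L12: "- ((of_real pi)\<^sup>2 / 3) = L / 12" by (simp_all add: M_def L_def)
    note E
    also have "\<tau> ^ (2 * s) * (c * (of_nat s * M ^ s * - ((of_real pi / \<tau>)\<^sup>2 / 3)) + M ^ s * M * ev C (ex (- 1 / \<tau>)) 0) =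
       (\<tau> ^ (2 * s) * M ^ s) * (c * of_nat s * (M / 12) + M * ev C (ex (- 1 / \<tau>)) 0)"
      unfolding M12 by (simp only: distrib_left mult_ac)
    also have "\<dots> = L ^ s * (c * of_nat s * (L / (12 * \<tau>\<^sup>2)) + L / \<tau>\<^sup>2 * ev C (ex (- 1 / \<tau>)) 0)"
    proof -
      have "M = L / \<tau>\<^sup>2" unfolding MtL[symmetric] using \<tau>0 by simp
      then have "M / 12 = L / (12 * \<tau>\<^sup>2)" by simp
      with \<open>M = L / \<tau>\<^sup>2\<close> show ?thesis unfolding MtLs by (simp only:)
    qed
    also have "c * (of_nat s * L ^ s * - ((of_real pi)\<^sup>2 / 3)) + L ^ s * c * (2 * of_real pi * \<i> * of_nat K / \<tau>) + ex (0\<^sup>2 / \<tau>) ^ K * L ^ s * L * ev C (ex \<tau>) 0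
       = L ^ s * (c * of_nat s * (L / 12) + c * (2 * of_real pi * \<i> * of_nat K / \<tau>) + L * ev C (ex \<tau>) 0)"
      unfolding L12 using \<tau>0 by (simp add: distrib_left mult_ac)
    finally have "c * of_nat s * (L / (12 * \<tau>\<^sup>2)) + L / \<tau>\<^sup>2 * ev C (ex (- 1 / \<tau>)) 0 =
       c * of_nat s * (L / 12) + c * (2 * of_real pi * \<i> * of_nat K / \<tau>) + L * ev C (ex \<tau>) 0"
      using L0 by (simp only: mult_cancel_left power_not_zero simp_thms)
    then have "L * (c * of_nat s * (1 / (12 * \<tau>\<^sup>2)) + 1 / \<tau>\<^sup>2 * ev C (ex (- 1 / \<tau>)) 0) =
       L * (c * of_nat s * (1 / 12) + c * (2 * of_real pi * \<i> * of_nat K / (L * \<tau>)) + ev C (ex \<tau>) 0)"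
      using L0 by (simp add: distrib_left mult_ac del: divide_minus_left)
    then have "c * of_nat s * (1 / (12 * \<tau>\<^sup>2)) + 1 / \<tau>\<^sup>2 * ev C (ex (- 1 / \<tau>)) 0 =
       c * of_nat s * (1 / 12) + c * (2 * of_real pi * \<i> * of_nat K / (L * \<tau>)) + ev C (ex \<tau>) 0"
      using L0 by (simp only: mult_cancel_left) simp
    moreover have R: "c * (2 * of_real pi * \<i> * of_nat K / (L * \<tau>)) = - (\<i> * of_nat K * c / (2 * of_real pi * \<tau>))"
      using \<tau>0 by (simp add: L_def power2_eq_square field_simps)
    ultimately have "c * of_nat s * (1 / (12 * \<tau>\<^sup>2)) + 1 / \<tau>\<^sup>2 * ev C (ex (- 1 / \<tau>)) 0 =
       c * of_nat s * (1 / 12) - \<i> * of_nat K * c / (2 * of_real pi * \<tau>) + ev C (ex \<tau>) 0"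
      unfolding R by simp
    then show ?thesis by (simp add: algebra_simps diff_divide_distrib del: divide_minus_left)
  qed
  \<comment> \<open>The shift by c s / 12 absorbs the term with s in \<open>S\<close>, so that G
    satisfies the quasimodular law with constant K c.\<close>
  define G where "G = C + fps_const [:c * of_nat s / 12:]"
  have "poly (fps_nth G 0) 0 = of_nat K * c / 12"
  proof (rule quasimodular_const_term)
    show "conv G" unfolding G_def by (intro conv_intros cC)
    fix \<tau> :: complex assume \<tau>: "Im \<tau> > 0"
    have q: "norm (ex \<tau>) < 1" "norm (ex (- 1 / \<tau>)) < 1" using \<tau> Im_S[OF \<tau>] by (auto simp del: divide_minus_left)
    have \<tau>0: "\<tau> \<noteq> 0" using \<tau> by auto
    have "\<tau>\<^sup>2 * (ev C (ex (- 1 / \<tau>)) 0 / \<tau>\<^sup>2 + c * of_nat s / 12 * (1 / \<tau>\<^sup>2 - 1)) =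
       \<tau>\<^sup>2 * (ev C (ex \<tau>) 0 - \<i> * of_nat K * c / (2 * of_real pi * \<tau>))"
      unfolding S[OF \<tau>] ..
    then have "ev C (ex (- 1 / \<tau>)) 0 + c * of_nat s / 12 * (1 - \<tau>\<^sup>2) =
       \<tau>\<^sup>2 * ev C (ex \<tau>) 0 - \<i> * of_nat K * c * \<tau> / (2 * of_real pi)"
      using \<tau>0 by (simp add: distrib_left right_diff_distrib power2_eq_square mult_ac del: divide_minus_left)
    then show "ev G (ex (- 1 / \<tau>)) 0 = \<tau>\<^sup>2 * ev G (ex \<tau>) 0 - \<i> * (of_nat K * c) * \<tau> / (2 * of_real pi)"
      using q by (simp add: G_def ev_add cC algebra_simps diff_divide_distrib del: divide_minus_left)
  qed
  moreover have "poly (fps_nth G 0) 0 = coeff (fps_nth A 0) (Suc s) + c * of_nat s / 12"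
    by (simp add: G_def C_def B'_def B_def nth_shiftX_0 shiftX_def coeff_poly_shift poly_0_coeff_0)
  ultimately have "coeff (fps_nth A 0) (Suc s) + c * of_nat s / 12 = of_nat K * c / 12" by simp
  from arg_cong[OF this, of "\<lambda>x. 12 * x"]
  have "12 * coeff (fps_nth A 0) (Suc s) + c * of_nat s = of_nat K * c" by (simp add: distrib_left)
  then show ?thesis unfolding c_def[symmetric] by (simp add: algebra_simps)
qed

end

section \<open>The discriminant as a product over points of order two\<close>

definition W1 :: "complex poly fps" where
  "W1 = infprod (\<lambda>n. fps_X ^ (2 * n + 1) * (fps_const [:-1:] * 1))"
definition W2 :: "complex poly fps" where
  "W2 = infprod (\<lambda>n. fps_X ^ (2 * n + 2) * (fps_const [:1:] * geom 1 (2 * n + 2)))"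
definition WW :: "complex poly fps" where "WW = (W1 * W2) ^ 2"

interpretation W1: fps_product "\<lambda>n. fps_X ^ (2 * n + 1) * (fps_const [:-1:] * 1)"
  by (rule fps_productI[where M = "\<lambda>_ _. 1"]) auto
interpretation W2: fps_product "\<lambda>n. fps_X ^ (2 * n + 2) * (fps_const [:1:] * geom 1 (2 * n + 2))"
  by (rule fps_productI[where M = "\<lambda>r _. 1 / (1 - r)"]) (auto intro!: conv_geom fnorm_geom)

lemma conv_W: "conv W1" "conv W2"
  unfolding W1_def W2_def by (rule W1.conv_infprod W2.conv_infprod)+

lemma conv_WW: "conv WW"
  unfolding WW_def by (intro conv_intros conv_W)

text \<open>\<open>W1\<close> multiplies the 1 - r^(2n+1), and \<open>W2\<close> multiplies 1 + r^e
  / (1 - r^e) = 1 / (1 - r^e) with e = 2n+2. Thus \<open>WW\<close> is the constant product of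
  \<open>half_finite\<close>, with limit known from \<open>half_const_lim\<close>.\<close>

lemma ev_WW:
  assumes \<tau>: "Im \<tau> > 0"
  shows "ev WW (ex (\<tau> / 2)) X = (1 - ex (\<tau> / 2)) * ev KK (ex \<tau>) (xx (\<tau> / 2))"
proof -
  define r where "r = ex (\<tau> / 2)"
  have r: "norm r < 1" using \<tau> by (simp add: r_def)
  have e1: "1 + ev (fps_X ^ (2 * n + 1) * (fps_const [:-1:] * 1)) r X = 1 - r ^ (2 * n + 1)" for n
    using r by (simp add: ev_simps)
  have e2: "1 + ev (fps_X ^ (2 * n + 2) * (fps_const [:1:] * geom 1 (2 * n + 2))) r X = 1 / (1 - r ^ (2 * n + 2))" for n
    using r power_neq_1[OF r, of "2 * n + 2"] by (simp add: ev_simps conv_geom ev_geom field_simps)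
  have "(\<lambda>N. ((\<Prod>n<N. 1 - r ^ (2 * n + 1)) * (\<Prod>n<N. 1 / (1 - r ^ (2 * n + 2)))) ^ 2) \<longlonglongrightarrow> (ev W1 r X * ev W2 r X) ^ 2"
    using W1.ev_infprod[OF r, of X] W2.ev_infprod[OF r, of X] unfolding e1 e2 W1_def[symmetric] W2_def[symmetric]
    by (intro tendsto_intros)
  moreover have "(\<Prod>n<N. 1 - r ^ (2 * n + 1)) * (\<Prod>n<N. 1 / (1 - r ^ (2 * n + 2))) = (\<Prod>n<N. (1 - r ^ (2 * n + 1)) / (1 - r ^ (2 * n + 2)))" for N
    by (simp flip: prod.distrib)
  ultimately have "(\<lambda>N. \<Prod>n<N. ((1 - r ^ (2 * n + 1)) / (1 - r ^ (2 * n + 2))) ^ 2) \<longlonglongrightarrow> ev WW r X"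
    using r by (simp add: WW_def ev_simps conv_W prod_power_distrib)
  then show ?thesis using half_const_lim[OF \<tau>] LIMSEQ_unique unfolding r_def by blast
qed

lemma kap_half_WW:
  assumes \<tau>: "Im \<tau> > 0"
  shows "kap \<tau> (\<tau> / 2) = (ev WW (ex (\<tau> / 2)) X)\<^sup>2 / ex (\<tau> / 2)"
    and "kap \<tau> (\<tau> / 2 + 1 / 2) = - (ev WW (- ex (\<tau> / 2)) X)\<^sup>2 / ex (\<tau> / 2)"
proof -
  have *: "kap \<tau> (\<tau> / 2) = (ev WW (ex (\<tau> / 2)) X)\<^sup>2 / ex (\<tau> / 2)" if \<tau>: "Im \<tau> > 0" for \<tau>
    unfolding ev_WW[OF \<tau>] using \<tau> by (simp add: kap_eq xx_eq[of "\<tau> / 2"] power_mult_distrib)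
  show "kap \<tau> (\<tau> / 2) = (ev WW (ex (\<tau> / 2)) X)\<^sup>2 / ex (\<tau> / 2)" using *[OF \<tau>] .
  have "ex ((\<tau> + 1) / 2) = - ex (\<tau> / 2)" by (simp add: add_divide_distrib ex_add)
  then show "kap \<tau> (\<tau> / 2 + 1 / 2) = - (ev WW (- ex (\<tau> / 2)) X)\<^sup>2 / ex (\<tau> / 2)"
    using *[of "\<tau> + 1"] \<tau> by (simp add: kap_tau_plus_1 add_divide_distrib)
qed

text \<open>
  \<open>dinv\<close> is \<open>1 / \<Delta>\<close>, written as a product of values of \<open>kap\<close> at the points of order two;
  \<open>UU\<close> is the expansion of \<open>q / \<Delta>\<close>.
\<close>

definition dinv :: "complex \<Rightarrow> complex" where
  "dinv \<tau> = (kap \<tau> (1 / 2) * (ex (\<tau> / 4) * kap \<tau> (\<tau> / 2)) * (ex (\<tau> / 4) * kap \<tau> (\<tau> / 2 + 1 / 2)))\<^sup>2 / 16"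

definition UU :: "complex poly fps" where
  "UU = (fps_const [:1 / 4:] * atX (- 4) KAP) ^ 2 * (evens WW ^ 2 - fps_X * odds WW ^ 2) ^ 4"

text \<open>Inversion exchanges the first two factors of \<open>dinv\<close> and takes the third to
  its negative, each at the cost of \<tau>^2. The outer square removes the sign and doubles the
  exponent 6.\<close>

lemma dinv_S:
  assumes \<tau>: "Im \<tau> > 0"
  shows "\<tau> ^ 12 * dinv (- 1 / \<tau>) = dinv \<tau>"
proof -
  define \<sigma> where "\<sigma> = - 1 / \<tau>"
  have \<tau>0: "\<tau> \<noteq> 0" using \<tau> by auto
  have S: "\<tau>\<^sup>2 * kap \<sigma> (c / \<tau>) = ex (c\<^sup>2 / \<tau>) * kap \<tau> c" for c
    unfolding \<sigma>_def by (rule kap_S[OF \<tau>])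
  have 1: "\<tau>\<^sup>2 * kap \<sigma> (1 / 2) = ex (\<tau> / 4) * kap \<tau> (\<tau> / 2)"
    using S[of "\<tau> / 2"] \<tau>0 by (simp add: power2_eq_square)
  have "\<sigma> / 2 = - ((1 / 2) / \<tau>)" by (simp add: \<sigma>_def)
  then have "kap \<sigma> (\<sigma> / 2) = kap \<sigma> ((1 / 2) / \<tau>)" by (simp only: kap_minus)
  then have "\<tau>\<^sup>2 * kap \<sigma> (\<sigma> / 2) = ex ((1 / 2)\<^sup>2 / \<tau>) * kap \<tau> (1 / 2)" unfolding S[symmetric] by (simp only:)
  from arg_cong[OF this, of "\<lambda>x. ex (\<sigma> / 4) * x"]
  have "\<tau>\<^sup>2 * (ex (\<sigma> / 4) * kap \<sigma> (\<sigma> / 2)) = (ex (\<sigma> / 4) * ex ((1 / 2)\<^sup>2 / \<tau>)) * kap \<tau> (1 / 2)"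
    by (simp only: mult_ac)
  moreover have "ex (\<sigma> / 4) * ex ((1 / 2)\<^sup>2 / \<tau>) = 1"
    by (simp add: \<sigma>_def power2_eq_square flip: ex_add)
  ultimately have 2: "\<tau>\<^sup>2 * (ex (\<sigma> / 4) * kap \<sigma> (\<sigma> / 2)) = kap \<tau> (1 / 2)"
    by (simp only: mult_1)
  have "\<sigma> / 2 + 1 / 2 = (\<tau> / 2 - 1 / 2) / \<tau>" using \<tau>0 by (simp add: \<sigma>_def field_simps)
  then have "\<tau>\<^sup>2 * kap \<sigma> (\<sigma> / 2 + 1 / 2) = ex ((\<tau> / 2 - 1 / 2)\<^sup>2 / \<tau>) * kap \<tau> (\<tau> / 2 - 1 / 2)" unfolding S[symmetric] by simp
  from arg_cong[OF this, of "\<lambda>x. ex (\<sigma> / 4) * x"]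
  have "\<tau>\<^sup>2 * (ex (\<sigma> / 4) * kap \<sigma> (\<sigma> / 2 + 1 / 2)) =
      (ex (\<sigma> / 4) * ex ((\<tau> / 2 - 1 / 2)\<^sup>2 / \<tau>)) * kap \<tau> (\<tau> / 2 - 1 / 2)"
    by (simp only: mult_ac)
  moreover have "kap \<tau> (\<tau> / 2 - 1 / 2) = kap \<tau> (\<tau> / 2 + 1 / 2)"
    using kap_add_1[of \<tau> "\<tau> / 2 - 1 / 2"] by (simp add: algebra_simps)
  moreover have "ex (\<sigma> / 4) * ex ((\<tau> / 2 - 1 / 2)\<^sup>2 / \<tau>) = - ex (\<tau> / 4)"
  proof -
    have "\<sigma> / 4 + (\<tau> / 2 - 1 / 2)\<^sup>2 / \<tau> = \<tau> / 4 - 1 / 2"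
      using \<tau>0 by (simp add: \<sigma>_def power2_eq_square field_simps)
    then have "ex (\<sigma> / 4) * ex ((\<tau> / 2 - 1 / 2)\<^sup>2 / \<tau>) = ex (\<tau> / 4 - 1 / 2)"
      unfolding ex_add[symmetric] by (rule arg_cong)
    then show ?thesis by (simp add: ex_diff)
  qed
  ultimately have 3: "\<tau>\<^sup>2 * (ex (\<sigma> / 4) * kap \<sigma> (\<sigma> / 2 + 1 / 2)) = - (ex (\<tau> / 4) * kap \<tau> (\<tau> / 2 + 1 / 2))"
    by (simp only: mult_minus_left)
  have "\<tau> ^ 12 * dinv \<sigma> = ((\<tau>\<^sup>2 * kap \<sigma> (1 / 2)) * (\<tau>\<^sup>2 * (ex (\<sigma> / 4) * kap \<sigma> (\<sigma> / 2))) *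
      (\<tau>\<^sup>2 * (ex (\<sigma> / 4) * kap \<sigma> (\<sigma> / 2 + 1 / 2))))\<^sup>2 / 16"
    by (simp add: dinv_def power_mult_distrib mult_ac flip: power_mult power_add)
  also have "\<dots> = dinv \<tau>" unfolding 1 2 3 by (simp add: dinv_def mult_ac)
  finally show ?thesis unfolding \<sigma>_def .
qed

lemma conv_UU: "conv UU"
  unfolding UU_def by (intro conv_intros conv_atX conv_KAP conv_evens conv_odds conv_WW)

lemma ev_UU:
  assumes \<tau>: "Im \<tau> > 0"
  shows "ev UU (ex \<tau>) X = ex \<tau> * dinv \<tau>"
proof -
  define r where "r = ex (\<tau> / 2)"
  have r: "norm r < 1" "norm (- r) < 1" "r \<noteq> 0" using \<tau> by (auto simp: r_def)
  have q: "ex \<tau> = r\<^sup>2" by (simp add: r_def ex_half_square)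
  have q4: "ex (\<tau> / 4) ^ 2 = r" using ex_half_square[of "\<tau> / 2"] by (simp add: r_def)
  have h: "xx (1 / 2) = - 4" using xx_half[of 0] by simp
  have w: "ev WW r X * ev WW (- r) X = ev (evens WW) (r\<^sup>2) X ^ 2 - r\<^sup>2 * ev (odds WW) (r\<^sup>2) X ^ 2"
    unfolding ev_split[OF conv_WW r(1), of X] ev_split[OF conv_WW r(2), of X]
    by (simp add: power2_eq_square algebra_simps)
  have "norm (r\<^sup>2) < 1" using \<tau> by (simp flip: q)
  then have "ev UU (r\<^sup>2) X = (kap \<tau> (1 / 2) / 4) ^ 2 * (ev WW r X * ev WW (- r) X) ^ 4"
    unfolding w UU_def
    by (simp add: ev_simps conv_atX conv_KAP conv_evens conv_odds conv_WW kap_def q h)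
  moreover have "dinv \<tau> = (kap \<tau> (1 / 2) / 4) ^ 2 * (ex (\<tau> / 4) ^ 2 * kap \<tau> (\<tau> / 2) * kap \<tau> (\<tau> / 2 + 1 / 2)) ^ 2"
    unfolding dinv_def by (simp add: power_mult_distrib power_divide power2_eq_square mult_ac)
  then have "dinv \<tau> = (kap \<tau> (1 / 2) / 4) ^ 2 * ((ev WW r X * ev WW (- r) X) ^ 2 / r) ^ 2"
    unfolding q4 kap_half_WW[OF \<tau>, of X] r_def[symmetric] using r
    by (simp add: power_divide power_mult_distrib power2_eq_square field_simps)
  ultimately show ?thesis unfolding q using r by (simp add: power_divide flip: power_mult)
qed

lemma nth_0_UU: "fps_nth UU 0 = 1"
proof -
  have "fps_nth WW 0 = 1" by (simp add: WW_def W1_def W2_def infprod_def fps_nth_power_0)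
  then show ?thesis
    by (simp add: UU_def fps_nth_power_0 atX_def evens_def nth_0_KAP power2_eq_square)
qed

text \<open>The product of A / q^N and (q / \<Delta>)^N is the expansion of A / \<Delta>^N.\<close>

lemma jac_divide_Delta:
  assumes A: "jac 0 K A" and low: "\<And>i. i < N \<Longrightarrow> fps_nth A i = 0"
  shows "jac (6 * N) K (fps_shift N A * UU ^ N)"
proof -
  let ?B = "fps_shift N A * UU ^ N"
  have cA: "conv A" using A by (rule jac_conv)
  have ev: "ev ?B (ex \<tau>) X = dinv \<tau> ^ N * ev A (ex \<tau>) X" if \<tau>: "Im \<tau> > 0" for \<tau> X
    using ev_shift_q[OF cA low, where q = "ex \<tau>" and X = X] \<tau>
    by (simp add: ev_simps conv_shift_q cA conv_UU ev_UU power_mult_distrib)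
  show ?thesis unfolding jac_def
  proof (intro conjI allI impI)
    show "conv ?B" by (intro conv_intros conv_shift_q cA conv_UU)
    fix \<tau> z :: complex assume \<tau>: "Im \<tau> > 0"
    have "\<tau> ^ (2 * (6 * N)) * ev ?B (ex (- 1 / \<tau>)) (xx (z / \<tau>)) =
       (\<tau> ^ 12 * dinv (- 1 / \<tau>)) ^ N * ev A (ex (- 1 / \<tau>)) (xx (z / \<tau>))"
      unfolding ev[OF Im_S[OF \<tau>]] by (simp add: power_mult_distrib power_mult del: divide_minus_left)
    also have "\<dots> = dinv \<tau> ^ N * (\<tau> ^ (2 * 0) * ev A (ex (- 1 / \<tau>)) (xx (z / \<tau>)))"
      unfolding dinv_S[OF \<tau>] by simp
    also have "\<dots> = ex (z\<^sup>2 / \<tau>) ^ K * ev ?B (ex \<tau>) (xx z)"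
      unfolding jac_S[OF A \<tau>] ev[OF \<tau>] by simp
    finally show "\<tau> ^ (2 * (6 * N)) * ev ?B (ex (- 1 / \<tau>)) (xx (z / \<tau>)) = ex (z\<^sup>2 / \<tau>) ^ K * ev ?B (ex \<tau>) (xx z)" .
    show "ex (\<tau> + 2 * z) ^ K * ev ?B (ex \<tau>) (xx (z + \<tau>)) = ev ?B (ex \<tau>) (xx z)"
      using jac_elliptic[OF A \<tau>, of z] unfolding ev[OF \<tau>] by (simp add: mult.left_commute)
  qed
qed

section \<open>The degree bound for leading coefficients\<close>

lemma poly_degree_le_of_growth:
  fixes p :: "complex poly"
  assumes "\<And>x. A \<le> norm x \<Longrightarrow> norm (poly p x) \<le> B * norm x ^ K"
  shows "degree p \<le> K"
proof -
  have "poly p x = (\<Sum>k\<le>K. (deriv ^^ k) (poly p) 0 / fact k * x ^ k)" for x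
    by (rule Liouville_polynomial[where A = A and B = B]) (use assms in \<open>auto intro: holomorphic_intros\<close>)
  then have "p = (\<Sum>k\<le>K. monom ((deriv ^^ k) (poly p) 0 / fact k) k)"
    by (intro poly_eqI_degree poly_ext) (auto simp: poly_sum poly_monom poly_eq_poly_eq_iff[symmetric] fun_eq_iff)
  also have "degree \<dots> \<le> K"
    by (intro degree_sum_le) (auto intro: order.trans[OF degree_monom_le])
  finally show ?thesis .
qed

text \<open>\<zeta> and 1 / \<zeta> are the roots of t^2 - (X + 2) t + 1; exchanging z and -z
  selects the larger one.\<close>

lemma xx_surj:
  obtains z where "xx z = X" "norm (ex z) \<ge> 1"
proof -
  define w where "w = X + 2"
  define \<zeta> where "\<zeta> = (w + csqrt (w\<^sup>2 - 4)) / 2"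
  have "\<zeta> * (w - \<zeta>) = (w\<^sup>2 - csqrt (w\<^sup>2 - 4) ^ 2) / 4"
    by (simp add: \<zeta>_def power2_eq_square field_simps)
  then have z1: "\<zeta> * (w - \<zeta>) = 1" by simp
  then have "\<zeta> \<noteq> 0" by auto
  then obtain z where z: "ex z = \<zeta>" using ex_surj by blast
  have "ex (- z) = w - \<zeta>" using z1 z \<open>\<zeta> \<noteq> 0\<close> by (simp add: ex_minus field_simps)
  then have x: "xx z = X" using z by (simp add: xx_def w_def)
  show ?thesis
  proof (cases "norm (ex z) \<ge> 1")
    case False
    then have "norm (ex (- z)) \<ge> 1" by (simp add: ex_minus norm_divide)
    then show ?thesis using that[of "- z"] x by simp
  qed (use that x in blast)
qed

lemma norm_xx_le:
  assumes "norm (ex z) \<ge> 1"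
  shows "norm (ex z) \<le> norm (xx z) + 3" "norm (xx z) \<le> norm (ex z) + 3"
proof -
  have "norm (ex (- z)) \<le> 1" using assms by (simp add: ex_minus norm_divide)
  moreover have "ex z = xx z + 2 - ex (- z)" by (simp add: xx_def)
  then have "norm (ex z) \<le> norm (xx z) + 2 + norm (ex (- z))"
    using norm_triangle_ineq4[of "xx z + 2" "ex (- z)"] norm_triangle_ineq[of "xx z" 2] by simp
  moreover have "norm (xx z) \<le> norm (ex z) + norm (ex (- z)) + 2"
    using norm_triangle_ineq4[of "ex z + ex (- z)" 2] norm_triangle_ineq[of "ex z" "ex (- z)"] by (simp add: xx_def)
  ultimately show "norm (ex z) \<le> norm (xx z) + 3" "norm (xx z) \<le> norm (ex z) + 3" by auto
qed

text \<open>
  On \<open>\<bar>\<zeta>\<bar> = R\<close> take \<open>\<bar>q\<bar> = 1 / R\<close>; then \<open>q \<zeta>\<close> has modulus one, where the series is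
  \<open>O (\<bar>q\<bar> ^ N)\<close>, and the elliptic law costs a factor \<open>R ^ K\<close>.
\<close>

lemma jac_degree_leading:
  assumes jac: "jac s K A" and low: "\<And>i. i < N \<Longrightarrow> fps_nth A i = 0"
  shows "degree (fps_nth A N) \<le> K"
proof -
  have cA: "conv A" using jac by (rule jac_conv)
  define B where "B = fps_shift N A"
  have cB: "conv B" unfolding B_def by (rule conv_shift_q[OF cA])
  \<comment> \<open>Radius 1/2 because the modulus of q is 1 / R with R \<ge> 2, and 4 because this
    bounds X when \<zeta> has modulus one.\<close>
  define M where "M = fnorm (1 / 2) 4 B"
  have M: "0 \<le> M" unfolding M_def by (intro fnorm_nonneg cB) auto
  have bound: "norm (ev B 0 (xx z)) \<le> M * norm (ex z) ^ K" if R: "norm (ex z) \<ge> 2" for z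
  proof (rule maximum_modulus_frontier[of "\<lambda>q. ev B q (xx z)" "ball 0 (1 / norm (ex z))"])
    define R where "R = norm (ex z)"
    have R2: "R \<ge> 2" using R by (simp add: R_def)
    have "1 / R < 1" using R2 by simp
    then have sub: "cball 0 (1 / norm (ex z)) \<subseteq> ball (0::complex) 1"
      unfolding R_def[symmetric] by (auto intro: le_less_trans)
    show "(\<lambda>q. ev B q (xx z)) holomorphic_on interior (ball 0 (1 / norm (ex z)))"
      by (rule holomorphic_on_subset[OF holomorphic_ev_q[OF cB]]) (use sub in \<open>auto simp: subset_iff\<close>)
    show "continuous_on (closure (ball 0 (1 / norm (ex z)))) (\<lambda>q. ev B q (xx z))"
      by (rule holomorphic_on_imp_continuous_on[OF holomorphic_on_subset[OF holomorphic_ev_q[OF cB]]])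
         (use sub R2 in \<open>auto simp: R_def[symmetric]\<close>)
    fix q :: complex assume "q \<in> frontier (ball 0 (1 / norm (ex z)))"
    then have q: "norm q = 1 / R" using R2 by (simp add: R_def)
    then have q0: "q \<noteq> 0" and q1: "norm q < 1" using R2 by auto
    obtain \<tau> where \<tau>: "ex \<tau> = q" "Im \<tau> > 0" using ex_surj_H[OF q0 q1] .
    have n1: "norm (ex (z + \<tau>)) = 1" using R2 by (simp add: ex_add \<tau> norm_mult q R_def[symmetric])
    have x4: "norm (xx (z + \<tau>)) \<le> 4" using norm_xx_le(2)[of "z + \<tau>"] n1 by simp
    have "q ^ N * ev B q (xx z) = ex (\<tau> + 2 * z) ^ K * (q ^ N * ev B q (xx (z + \<tau>)))"
      using jac_elliptic[OF jac \<tau>(2), of z, symmetric] ev_shift_q[OF cA low q1] by (simp add: \<tau> B_def)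
    then have e: "ev B q (xx z) = ex (\<tau> + 2 * z) ^ K * ev B q (xx (z + \<tau>))" using q0 by simp
    have "ex (\<tau> + 2 * z) = q * ex z * ex z" by (simp only: ex_add \<tau> mult_2 mult.assoc)
    then have nE: "norm (ex (\<tau> + 2 * z)) = R" using R2 by (simp add: norm_mult q R_def[symmetric])
    have nB: "norm (ev B q (xx (z + \<tau>))) \<le> M" unfolding M_def
      by (rule norm_ev_le[OF cB _ _ x4]) (use q frac_le[of 1 1 2 R] R2 in auto)
    have "R ^ K * norm (ev B q (xx (z + \<tau>))) \<le> R ^ K * M" using R2 nB by (intro mult_left_mono) auto
    then show "norm (ev B q (xx z)) \<le> M * norm (ex z) ^ K"
      unfolding e norm_mult norm_power nE R_def[symmetric] by (simp add: mult.commute)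
  qed (use R in \<open>auto simp: intro: le_less_trans\<close>)
  show ?thesis
  proof (rule poly_degree_le_of_growth[where A = 5 and B = "M * 2 ^ K"])
    fix x :: complex assume x: "5 \<le> norm x"
    obtain z where z: "xx z = x" "norm (ex z) \<ge> 1" using xx_surj .
    \<comment> \<open>By \<open>norm_xx_le\<close> the moduli of \<zeta> and x differ by at most 3,
      so 5 is large enough for both claims.\<close>
    have "norm (ex z) \<ge> 2" "norm (ex z) \<le> 2 * norm x" using norm_xx_le[OF z(2)] z(1) x by auto
    then have "norm (ev B 0 x) \<le> M * (2 * norm x) ^ K"
      using bound[of z] z(1) M by (meson mult_left_mono norm_ge_zero order_trans power_mono)
    then show "norm (poly (fps_nth A N) x) \<le> M * 2 ^ K * norm x ^ K"
      by (simp add: ev_q0 B_def power_mult_distrib mult_ac)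
  qed
qed

text \<open>
  Division by \<open>\<Delta>\<^sup>N\<close> turns a form of weight \<open>0\<close> and order \<open>N\<close> into one of weight \<open>- 12 N\<close>.
\<close>

lemma jac_leading_coeff:
  assumes jac: "jac 0 K A" and low: "\<And>i. i < N \<Longrightarrow> fps_nth A i = 0"
  shows "i < 6 * N \<Longrightarrow> coeff (fps_nth A N) i = 0"
    and "12 * coeff (fps_nth A N) (Suc (6 * N)) = (of_nat K - of_nat (6 * N)) * coeff (fps_nth A N) (6 * N)"
proof -
  have B: "jac (6 * N) K (fps_shift N A * UU ^ N)" using jac low by (rule jac_divide_Delta)
  have n: "fps_nth (fps_shift N A * UU ^ N) 0 = fps_nth A N" by (simp add: fps_nth_power_0 nth_0_UU)
  show "i < 6 * N \<Longrightarrow> coeff (fps_nth A N) i = 0"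
    using jac_lowX[OF B order_refl] unfolding n[symmetric] lowX_def by blast
  show "12 * coeff (fps_nth A N) (Suc (6 * N)) = (of_nat K - of_nat (6 * N)) * coeff (fps_nth A N) (6 * N)"
    using jac_second_coeff[OF B] unfolding n by simp
qed

section \<open>Integral Jacobi forms\<close>

text \<open>
  The integral polynomials that occur as constant terms of integral Jacobi forms of weight \<open>0\<close>
  and index \<open>K\<close>. Up to multiples of \<open>X\<^sup>2\<close> these are the multiples of \<open>(12 + K X) / gcd(12, K)\<close>, and the
  form \<open>1 + X\<close> of index \<open>12\<close> permits an induction with step \<open>12\<close> from the small indices.
\<close>

definition good :: "nat \<Rightarrow> complex poly \<Rightarrow> bool" where
  "good K P \<longleftrightarrow> (\<exists>G. jac 0 K G \<and> ifps G \<and> fps_nth G 0 = P)"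

lemma good_mult: "good K P \<Longrightarrow> good L Q \<Longrightarrow> good (K + L) (P * Q)"
  unfolding good_def using jac_mult[of 0 K _ 0 L] ifps_mult by fastforce

lemma good_add: "good K P \<Longrightarrow> good K Q \<Longrightarrow> good K (P + Q)"
  unfolding good_def using jac_add[of 0 K] ifps_add by fastforce

lemma good_smult: "m \<in> \<int> \<Longrightarrow> good K P \<Longrightarrow> good K (smult m P)"
proof -
  assume m: "m \<in> \<int>" and "good K P"
  then obtain G where "jac 0 K G" "ifps G" "fps_nth G 0 = P" by (auto simp: good_def)
  then show ?thesis unfolding good_def using m
    by (intro exI[of _ "fps_const [:m:] * G"]) (auto intro!: jac_scale ifps_mult)
qed

lemma good_0: "good K 0"
  unfolding good_def by (rule exI[of _ 0]) (simp add: jac_def)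

lemma good_sum: "(\<And>i. i \<in> I \<Longrightarrow> good K (f i)) \<Longrightarrow> good K (sum f I)"
  by (induction I rule: infinite_finite_induct) (auto simp: good_0 intro: good_add)

text \<open>Lets an explicit polynomial identity be settled by computation; the constant form of
  index 0 fills up a product with a single factor.\<close>

lemma good_combination:
  assumes "good a P" "good b Q" "good c R" "good d S" "a + b = K" "c + d = K"
    and "smult (of_int m) (P * Q) - smult (of_int n) (R * S) = T"
  shows "good K T"
proof -
  have "good K (smult (of_int m) (P * Q) + smult (of_int (- n)) (R * S))"
    using good_mult[OF assms(1,2)] good_mult[OF assms(3,4)] assms(5,6)
    by (intro good_add good_smult) auto
  then show ?thesis using assms(7) by simp
qed

lemma good_gens: "good 0 1" "good 1 [:12, 1:]" "good 2 [:6, 1:]" "good 3 [:4, 1:]" "good 4 [:3, 1:]"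
  using jac_1 jac_PH1 jac_PH2 jac_PH3 jac_PH4 ifps_PH ifps_1 nth_0_PH
  unfolding good_def by (metis fps_one_nth)+

text \<open>Apart from the auxiliary \<open>t9\<close>, the combinations are chosen so that the X^2
  terms cancel or only X^2 survives. Example: (X + 6) (X + 3) - (X + 4)^2 = X + 2 in index
  6.\<close>

lemma good_small_index:
  shows good_p5: "good 5 [:12, 5:]" and good_p6: "good 6 [:2, 1:]" and good_p7: "good 7 [:12, 7:]"
    and good_p8: "good 8 [:3, 2:]" and good_p9: "good 9 [:4, 3:]" and good_p10: "good 10 [:6, 5:]"
    and good_p11: "good 11 [:12, 11:]" and good_p12: "good 12 [:1, 1:]"
    and good_square_small: "2 \<le> K \<Longrightarrow> K \<le> 14 \<Longrightarrow> good K [:0, 0, 1:]"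
proof -
  note p0 = good_gens(1) and p1 = good_gens(2) and p2 = good_gens(3) and p3 = good_gens(4) and p4 = good_gens(5)
  have s2: "good 2 [:0, 0, 1:]" by (rule good_combination[OF p1 p1 p2 p0, where m = 1 and n = 24]) auto
  have s3: "good 3 [:0, 0, 1:]" by (rule good_combination[OF p1 p2 p3 p0, where m = 1 and n = 18]) auto
  have s4: "good 4 [:0, 0, 1:]" by (rule good_combination[OF p1 p3 p4 p0, where m = 1 and n = 16]) auto
  show p5: "good 5 [:12, 5:]" by (rule good_combination[OF p1 p4 p2 p3, where m = 1 and n = 1]) auto
  have s5: "good 5 [:0, 0, 1:]" by (rule good_combination[OF p2 p3 p5 p0, where m = 1 and n = 2]) auto
  show p6: "good 6 [:2, 1:]" by (rule good_combination[OF p2 p4 p3 p3, where m = 1 and n = 1]) auto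
  have s6: "good 6 [:0, 0, 1:]" by (rule good_combination[OF p3 p3 p6 p0, where m = 1 and n = 8]) auto
  have s7: "good 7 [:0, 0, 1:]" by (rule good_combination[OF p3 p4 p2 p5, where m = 6 and n = 1]) auto
  show p7: "good 7 [:12, 7:]" by (rule good_combination[OF p3 p4 s7 p0, where m = 1 and n = 1]) auto
  show p8: "good 8 [:3, 2:]" by (rule good_combination[OF p2 p6 p4 p4, where m = 1 and n = 1]) auto
  have s8: "good 8 [:0, 0, 1:]" by (rule good_combination[OF p4 p4 p8 p0, where m = 1 and n = 3]) auto
  have t9: "good 9 [:4, 3, 1:]" by (rule good_combination[OF p4 p5 p3 p6, where m = 1 and n = 4]) auto
  have s9: "good 9 [:0, 0, 1:]" by (rule good_combination[OF t9 p0 p3 p6, where m = 2 and n = 1]) auto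
  show p9: "good 9 [:4, 3:]" by (rule good_combination[OF t9 p0 s9 p0, where m = 1 and n = 1]) auto
  have s10: "good 10 [:0, 0, 1:]" by (rule good_combination[OF p4 p6 p2 p8, where m = 3 and n = 1]) auto
  show p10: "good 10 [:6, 5:]" by (rule good_combination[OF p4 p6 s10 p0, where m = 1 and n = 1]) auto
  have s11: "good 11 [:0, 0, 1:]" by (rule good_combination[OF p4 p7 p3 p8, where m = 1 and n = 3]) auto
  show p11: "good 11 [:12, 11:]" by (rule good_combination[OF p3 p8 s11 p0, where m = 1 and n = 2]) auto
  show p12: "good 12 [:1, 1:]" by (rule good_combination[OF p4 p8 p6 p6, where m = 1 and n = 2]) auto
  have s12: "good 12 [:0, 0, 1:]" by (rule good_combination[OF p6 p6 p12 p0, where m = 1 and n = 4]) auto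
  have a13: "good 13 [:0, 0, 7:]" by (rule good_combination[OF p5 p8 p1 p12, where m = 1 and n = 3]) auto
  have b13: "good 13 [:0, 0, 5:]" by (rule good_combination[OF p6 p7 p1 p12, where m = 1 and n = 2]) auto
  \<comment> \<open>Coprime multiples of X^2 suffice: 3 * 5 - 2 * 7 = 1.\<close>
  have s13: "good 13 [:0, 0, 1:]" by (rule good_combination[OF b13 p0 a13 p0, where m = 3 and n = 2]) auto
  have s14: "good 14 [:0, 0, 1:]" by (rule good_combination[OF p6 p8 good_gens(3) p12, where m = 1 and n = 1]) auto
  assume "2 \<le> K" "K \<le> 14"
  then have "K \<in> {2, 3, 4, 5, 6, 7, 8, 9, 10, 11, 12, 13, 14}" by simp arith
  then show "good K [:0, 0, 1:]" using s2 s3 s4 s5 s6 s7 s8 s9 s10 s11 s12 s13 s14 by auto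
qed

text \<open>For K > 14 the product of X^2 in index 2 and index K - 2 gives X^4; then (1 + X) X^3 -
  X^4 and (1 + X) X^2 - X^3 descend to X^3 and X^2. Since the square needs the cube, both are
  carried along. The table ends at 14 because index K - 12 must admit X^3.\<close>

lemma good_square_cube: "(2 \<le> K \<longrightarrow> good K [:0, 0, 1:]) \<and> (3 \<le> K \<longrightarrow> good K [:0, 0, 0, 1:])"
proof (induction K rule: less_induct)
  case (less K)
  show ?case
  proof (cases "K \<le> 14")
    case True
    then have s: "2 \<le> K \<Longrightarrow> good K [:0, 0, 1:]" by (rule good_square_small[rotated])
    moreover have "good K [:0, 0, 0, 1:]" if "3 \<le> K"
      by (rule good_combination[OF good_gens(2) _ s good_gens(1), of "K - 1" "[:0, 0, 1:]" K 1 12])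
         (use that less.IH[of "K - 1"] in auto)
    ultimately show ?thesis by blast
  next
    case False
    then have K: "14 < K" by simp
    have e: "2 + (K - 2) = K" using K by simp
    have "good (2 + (K - 2)) ([:0, 0, 1:] * [:0, 0, 1:])"
      by (rule good_mult) (use good_square_small[of 2] less.IH[of "K - 2"] K in auto)
    then have q: "good K [:0, 0, 0, 0, 1:]" unfolding e by simp
    have c: "good K [:0, 0, 0, 1:]"
      by (rule good_combination[OF good_p12 _ q good_gens(1), of "K - 12" "[:0, 0, 0, 1:]" K 1 1])
         (use K less.IH[of "K - 12"] in auto)
    moreover have "good K [:0, 0, 1:]"
      by (rule good_combination[OF good_p12 _ c good_gens(1), of "K - 12" "[:0, 0, 1:]" K 1 1])
         (use K less.IH[of "K - 12"] in auto)
    ultimately show ?thesis by blast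
  qed
qed

lemma good_monom: "2 \<le> j \<Longrightarrow> j \<le> K \<Longrightarrow> good K (monom 1 j)"
proof (induction j arbitrary: K rule: dec_induct)
  case base
  then show ?case using good_square_cube[of K] by (simp add: monom_altdef power2_eq_square)
next
  case (step j)
  have e: "smult (of_int 1) ([:12, 1:] * monom 1 j) - smult (of_int 12) (monom 1 j * 1) = monom (1::complex) (Suc j)"
    by (simp add: monom_Suc smult_monom)
  show ?case
    by (rule good_combination[OF good_gens(2) _ _ good_gens(1) _ _ e, of "K - 1" K])
       (use step in auto)
qed

lemma good_linearI:
  "good K [:a, b:] \<Longrightarrow> of_nat (gcd 12 K) * a = 12 \<Longrightarrow> of_nat (gcd 12 K) * b = of_nat K \<Longrightarrow>
   \<exists>L. good K L \<and> of_nat (gcd 12 K) * coeff L 0 = 12 \<and> of_nat (gcd 12 K) * coeff L 1 = of_nat K"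
  by (rule exI[of _ "[:a, b:]"]) simp

text \<open>Multiplication by 1 + X, of index 12, keeps the constant coefficient and the gcd, and
  adds 12 / gcd to the linear coefficient, as the step from K - 12 to K requires.\<close>

lemma good_linear:
  "\<exists>L. good K L \<and> of_nat (gcd 12 K) * coeff L 0 = 12 \<and> of_nat (gcd 12 K) * coeff L 1 = of_nat K"
proof (induction K rule: less_induct)
  case (less K)
  show ?case
  proof (cases "K < 12")
    case True
    then have "K \<in> {0, 1, 2, 3, 4, 5, 6, 7, 8, 9, 10, 11}" by simp arith
    moreover have z: "good 0 [:1, 0:]" using good_gens(1) by (simp add: one_pCons)
    note gs = z good_gens(2-) good_p5 good_p6 good_p7 good_p8 good_p9 good_p10 good_p11
    have *: ?thesis if "K = n" "good n [:a, b:]" "of_nat (gcd 12 n) * a = 12" "of_nat (gcd 12 n) * b = of_nat n" for n a b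
      using good_linearI[OF that(2-4)] that(1) by blast
    from calculation show ?thesis
    proof (elim insertE emptyE)
      assume "K = 0" then show ?thesis by (rule *[OF _ gs(1)]) (simp_all add: gcd_non_0_nat)
    next
      assume "K = 1" then show ?thesis by (rule *[OF _ gs(2)]) (simp_all add: gcd_non_0_nat)
    next
      assume "K = 2" then show ?thesis by (rule *[OF _ gs(3)]) (simp_all add: gcd_non_0_nat)
    next
      assume "K = 3" then show ?thesis by (rule *[OF _ gs(4)]) (simp_all add: gcd_non_0_nat)
    next
      assume "K = 4" then show ?thesis by (rule *[OF _ gs(5)]) (simp_all add: gcd_non_0_nat)
    next
      assume "K = 5" then show ?thesis by (rule *[OF _ gs(6)]) (simp_all add: gcd_non_0_nat)
    next
      assume "K = 6" then show ?thesis by (rule *[OF _ gs(7)]) (simp_all add: gcd_non_0_nat)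
    next
      assume "K = 7" then show ?thesis by (rule *[OF _ gs(8)]) (simp_all add: gcd_non_0_nat)
    next
      assume "K = 8" then show ?thesis by (rule *[OF _ gs(9)]) (simp_all add: gcd_non_0_nat)
    next
      assume "K = 9" then show ?thesis by (rule *[OF _ gs(10)]) (simp_all add: gcd_non_0_nat)
    next
      assume "K = 10" then show ?thesis by (rule *[OF _ gs(11)]) (simp_all add: gcd_non_0_nat)
    next
      assume "K = 11" then show ?thesis by (rule *[OF _ gs(12)]) (simp_all add: gcd_non_0_nat)
    qed
  next
    case False
    then obtain L where L: "good (K - 12) L" "of_nat (gcd 12 (K - 12)) * coeff L 0 = 12"
      "of_nat (gcd 12 (K - 12)) * coeff L 1 = of_nat (K - 12)" using less.IH[of "K - 12"] by auto
    have g: "gcd 12 (K - 12) = gcd 12 K" using False by (metis gcd_add2 le_add_diff_inverse not_less)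
    have "good K (L * [:1, 1:])" using good_mult[OF L(1) good_p12] False by simp
    moreover have "of_nat (gcd 12 K) * coeff (L * [:1, 1:]) 0 = 12" using L(2) unfolding g by (simp add: coeff_mult)
    moreover have "of_nat (gcd 12 K) * coeff (L * [:1, 1:]) 1 = of_nat K"
      using L(2,3) False unfolding g by (simp add: coeff_pCons distrib_left of_nat_diff)
    ultimately show ?thesis by blast
  qed
qed

lemma good_degree: "good K P \<Longrightarrow> degree P \<le> K"
  unfolding good_def using jac_degree_leading[of 0 K _ 0] by auto

lemma good_ipoly: "good K P \<Longrightarrow> ipoly P"
  unfolding good_def ifps_def by auto

text \<open>The two lowest coefficients of L are coprime, so the relation makes those of P an
  integral multiple of them. After subtraction only X^2, ..., X^K occur, and
  \<open>good_monom\<close> applies.\<close>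

theorem goodI:
  assumes P: "ipoly P" "degree P \<le> K" and rel: "12 * coeff P 1 = of_nat K * coeff P 0"
  shows "good K P"
proof -
  obtain L where L: "good K L" "of_nat (gcd 12 K) * coeff L 0 = 12" "of_nat (gcd 12 K) * coeff L 1 = of_nat K"
    using good_linear by blast
  define g where "g = int (gcd 12 K)"
  have "coeff P 0 \<in> \<int>" "coeff P 1 \<in> \<int>" "coeff L 0 \<in> \<int>" "coeff L 1 \<in> \<int>"
    using P(1) good_ipoly[OF L(1)] by (auto simp: ipoly_def)
  then obtain a b u v :: int where ab: "coeff P 0 = of_int a" "coeff P 1 = of_int b" "coeff L 0 = of_int u" "coeff L 1 = of_int v"
    by (metis Ints_cases)
  have "of_int (g * u) = (of_int 12 :: complex)" "of_int (g * v) = (of_int (int K) :: complex)"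
    using L(2,3) unfolding ab g_def of_int_mult of_int_of_nat_eq by simp_all
  then have gu: "g * u = 12" and gv: "g * v = int K" by (simp_all only: of_int_eq_iff)
  have "of_int (12 * b) = (of_int (int K * a) :: complex)"
    using rel unfolding ab of_int_mult of_int_of_nat_eq by simp
  then have rel': "12 * b = int K * a" by (simp only: of_int_eq_iff)
  have g0: "g > 0" by (simp add: g_def)
  have "u * b = v * a" using rel' g0 unfolding gu[symmetric] gv[symmetric] by (simp add: mult.assoc)
  moreover have "coprime u v"
  proof -
    have "gcd (g * u) (g * v) = g" unfolding gu gv unfolding g_def using gcd_int_int_eq[of 12 K] by simp
    then have "\<bar>g\<bar> * gcd u v = g" by (simp only: gcd_mult_distrib_int)
    then have "gcd u v = 1" using g0 by simp
    then show ?thesis by (simp add: coprime_iff_gcd_eq_1)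
  qed
  ultimately have "u dvd a" using coprime_dvd_mult_right_iff[of u v a] by (metis dvd_triv_left)
  then obtain t where t: "a = u * t" by blast
  moreover have "u \<noteq> 0" using gu by auto
  ultimately have t': "b = v * t" using \<open>u * b = v * a\<close> by simp
  define Q where "Q = P - smult (of_int t) L"
  have Q01: "coeff Q 0 = 0" "coeff Q 1 = 0" using t t' by (simp_all add: Q_def ab ab[unfolded One_nat_def])
  have Qi: "ipoly Q" unfolding Q_def by (intro ipoly_diff ipoly_smult P good_ipoly[OF L(1)]) simp
  have Qd: "degree Q \<le> K" unfolding Q_def
    by (intro degree_diff_le P order.trans[OF degree_smult_le] good_degree[OF L(1)])
  have "Q = (\<Sum>i\<le>K. monom (coeff Q i) i)" using Qd by (rule poly_as_sum_of_monoms'[symmetric])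
  also have "\<dots> = (\<Sum>i\<in>{2..K}. smult (coeff Q i) (monom 1 i))"
  proof (rule sum.mono_neutral_cong_right)
    show "\<forall>i\<in>{..K} - {2..K}. monom (coeff Q i) i = 0"
    proof
      fix i assume "i \<in> {..K} - {2..K}"
      then have "i = 0 \<or> i = 1" by auto
      then show "monom (coeff Q i) i = 0" using Q01 by auto
    qed
  qed (auto simp: smult_monom)
  also have "good K \<dots>"
    using Qi by (intro good_sum good_smult good_monom) (auto simp: ipoly_def)
  finally have "good K (Q + smult (of_int t) L)" by (intro good_add good_smult L) auto
  then show ?thesis by (simp add: Q_def)
qed

section \<open>Successive removal of leading coefficients\<close>

lemma nth_DD_power_mult:
  "i \<le> N \<Longrightarrow> fps_nth (DD ^ N * T) i = (if i = N then monom 1 (6 * N) * fps_nth T 0 else 0)"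
proof -
  assume i: "i \<le> N"
  have "DD = fps_X * fps_shift 1 DD" by (rule fps_ext) (auto simp: nth_DD(1))
  define S where "S = fps_shift 1 DD ^ N * T"
  have e: "DD ^ N * T = fps_X ^ N * S"
    unfolding S_def by (metis \<open>DD = fps_X * fps_shift 1 DD\<close> mult.assoc power_mult_distrib)
  have "fps_nth S 0 = monom 1 (6 * N) * fps_nth T 0"
    by (simp add: S_def fps_nth_power_0 nth_DD[unfolded One_nat_def] monom_power mult.commute)
  then show ?thesis unfolding e using i by (auto simp: fps_X_power_mult_nth)
qed

theorem jac_integral:
  assumes A: "jac 0 K A" and int: "\<And>n. n \<le> K div 6 \<Longrightarrow> ipoly (fps_nth A n)"
  shows "ifps A"
proof -
  have approx: "\<exists>G. jac 0 K G \<and> ifps G \<and> (\<forall>i<N. fps_nth (A - G) i = 0)" if "N \<le> K div 6 + 1" for N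
    using that
  proof (induction N)
    case 0
    show ?case by (rule exI[of _ 0]) (simp add: jac_def)
  next
    case (Suc N)
    then obtain G where G: "jac 0 K G" "ifps G" "\<And>i. i < N \<Longrightarrow> fps_nth (A - G) i = 0" by auto
    have N: "N \<le> K div 6" "6 * N \<le> K" using Suc.prems by auto
    have D: "jac 0 K (A - G)" using A G(1) by (rule jac_diff)
    define P where "P = fps_nth (A - G) N"
    define R where "R = poly_shift (6 * N) P"
    have P: "P = monom 1 (6 * N) * R"
      by (rule poly_eqI) (use jac_leading_coeff(1)[OF D G(3)] in \<open>auto simp: P_def R_def coeff_monom_mult coeff_poly_shift\<close>)
    have "ipoly P" unfolding P_def using int[OF N(1)] G(2) by (auto simp: ifps_def intro: ipoly_diff)
    then have "ipoly R" by (simp add: R_def ipoly_def coeff_poly_shift)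
    moreover have "degree R \<le> K - 6 * N"
    proof (rule degree_le, intro allI impI)
      fix i assume "K - 6 * N < i"
      then have "degree P < i + 6 * N" using jac_degree_leading[where N = N, OF D G(3)] by (simp add: P_def)
      then show "coeff R i = 0" by (simp add: R_def coeff_poly_shift coeff_eq_0)
    qed
    moreover have "12 * coeff R 1 = of_nat (K - 6 * N) * coeff R 0"
      using jac_leading_coeff(2)[OF D G(3)] N(2) by (simp add: R_def P_def coeff_poly_shift of_nat_diff)
    ultimately have "good (K - 6 * N) R" by (rule goodI)
    then obtain T where T: "jac 0 (K - 6 * N) T" "ifps T" "fps_nth T 0 = R" by (auto simp: good_def)
    have "jac 0 (6 * N + (K - 6 * N)) (DD ^ N * T)"
      using jac_mult[OF jac_power[OF jac_DD, of N] T(1)] by (simp add: mult.commute)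
    then have "jac 0 K (G + DD ^ N * T)" using G(1) N(2) by (intro jac_add) auto
    moreover have "ifps (G + DD ^ N * T)" by (intro ifps_intros G T ifps_PH)
    moreover have "fps_nth (A - (G + DD ^ N * T)) i = 0" if "i < Suc N" for i
    proof -
      have "fps_nth (A - (G + DD ^ N * T)) i = fps_nth (A - G) i - fps_nth (DD ^ N * T) i" by simp
      also have "\<dots> = 0" unfolding nth_DD_power_mult[OF less_Suc_eq_le[THEN iffD1, OF that]]
        using that G(3)[of i] P T(3) by (auto simp: P_def less_Suc_eq)
      finally show ?thesis .
    qed
    ultimately show ?case by blast
  qed
  obtain G where G: "jac 0 K G" "ifps G" "\<And>i. i < K div 6 + 1 \<Longrightarrow> fps_nth (A - G) i = 0"
    using approx[of "K div 6 + 1"] by auto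
  have D: "jac 0 K (A - G)" using A G(1) by (rule jac_diff)
  have "fps_nth (A - G) n = 0" for n
  proof (induction n rule: less_induct)
    case (less n)
    show ?case
    proof (cases "n < K div 6 + 1")
      case False
      \<comment> \<open>Beyond K / 6 the degree is below 6 n while all coefficients below 6 n
        vanish, so the polynomial is zero.\<close>
      have "degree (fps_nth (A - G) n) \<le> K" by (rule jac_degree_leading[OF D less])
      then have "degree (fps_nth (A - G) n) < 6 * n" using False by simp
      then show ?thesis using jac_leading_coeff(1)[OF D less] by (metis leading_coeff_0_iff)
    qed (rule G(3))
  qed
  then have "A = G" by (simp add: fps_eq_iff)
  then show ?thesis using G(2) by simp
qed

section \<open>Siegel modular forms\<close>

lemma sum_UNIV_2_2: "sum f (UNIV :: (2 + 2) set) = f (Inl 1) + f (Inl 2) + f (Inr 1) + f (Inr 2)"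
proof -
  have "sum f (UNIV :: (2 + 2) set) = sum f (UNIV <+> UNIV)" by simp
  also have "\<dots> = sum (f \<circ> Inl) UNIV + sum (f \<circ> Inr) UNIV" by (rule sum.Plus) auto
  finally show ?thesis by (simp add: sum_2 add_ac)
qed

lemma forall_2_2: "(\<forall>i :: 2 + 2. P i) \<longleftrightarrow> P (Inl 1) \<and> P (Inl 2) \<and> P (Inr 1) \<and> P (Inr 2)"
  by (simp only: split_sum_all forall_2 conj_assoc)

definition mat2 :: "'a::zero \<Rightarrow> 'a \<Rightarrow> 'a \<Rightarrow> 'a \<Rightarrow> 'a^2^2" where
  "mat2 a b c d = vector [vector [a, b], vector [c, d]]"

abbreviation entry :: "'a^2^2 \<Rightarrow> 2 \<Rightarrow> 2 \<Rightarrow> 'a" where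
  "entry A i j \<equiv> vec_nth (vec_nth A i) j"

lemma mat2_nth [simp]: "entry (mat2 a b c d) 1 1 = a" "entry (mat2 a b c d) 1 2 = b"
    "entry (mat2 a b c d) 2 1 = c" "entry (mat2 a b c d) 2 2 = d"
  by (simp_all add: mat2_def)

lemma mat2_eq_iff: "(A :: 'a::zero^2^2) = B \<longleftrightarrow>
    entry A 1 1 = entry B 1 1 \<and> entry A 1 2 = entry B 1 2 \<and> entry A 2 1 = entry B 2 1 \<and> entry A 2 2 = entry B 2 2"
  by (simp only: vec_eq_iff forall_2 conj_assoc)

lemma mat2_mult: "mat2 a b c d ** mat2 e f g h =
    mat2 (a * e + b * g) (a * f + b * h) (c * e + d * g) (c * f + d * (h::'a::semiring_1))"
  by (simp add: mat2_eq_iff matrix_matrix_mult_def sum_2)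

lemma mat2_add: "mat2 a b c d + mat2 e f g h = mat2 (a + e) (b + f) (c + g) (d + (h::'a::monoid_add))"
  by (simp add: mat2_eq_iff)

lemma period_matrix_mat2: "period_matrix \<tau>\<^sub>1 z \<tau>\<^sub>2 = mat2 \<tau>\<^sub>1 z z \<tau>\<^sub>2"
  by (simp add: period_matrix_def mat2_def)

lemma period_matrix_in_siegel_half_space:
  assumes 1: "Im \<tau>\<^sub>1 > 0" and 2: "(Im z)\<^sup>2 < Im \<tau>\<^sub>1 * Im \<tau>\<^sub>2"
  shows "period_matrix \<tau>\<^sub>1 z \<tau>\<^sub>2 \<in> siegel_half_space"
proof -
  have "x \<bullet> ((\<chi> i j. Im (entry (period_matrix \<tau>\<^sub>1 z \<tau>\<^sub>2) i j)) *v x) > 0" if x: "x \<noteq> 0" for x :: "real^2"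
  proof -
    define a b where "a = vec_nth x 1" and "b = vec_nth x 2"
    have ab: "a \<noteq> 0 \<or> b \<noteq> 0" using x by (auto simp: vec_eq_iff forall_2 a_def b_def)
    define Q where "Q = Im \<tau>\<^sub>1 * a\<^sup>2 + 2 * Im z * a * b + Im \<tau>\<^sub>2 * b\<^sup>2"
    have "x \<bullet> ((\<chi> i j. Im (entry (period_matrix \<tau>\<^sub>1 z \<tau>\<^sub>2) i j)) *v x) = Q"
      by (simp add: period_matrix_mat2 inner_vec_def matrix_vector_mult_def sum_2 Q_def a_def b_def
          power2_eq_square algebra_simps)
    moreover have e: "Im \<tau>\<^sub>1 * Q = (Im \<tau>\<^sub>1 * a + Im z * b)\<^sup>2 + (Im \<tau>\<^sub>1 * Im \<tau>\<^sub>2 - (Im z)\<^sup>2) * b\<^sup>2"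
      by (simp add: Q_def power2_eq_square algebra_simps)
    have "Im \<tau>\<^sub>1 * Q > 0"
    proof (cases "b = 0")
      case True
      then show ?thesis unfolding e using ab 1 by simp
    next
      case False
      then have "(Im \<tau>\<^sub>1 * Im \<tau>\<^sub>2 - (Im z)\<^sup>2) * b\<^sup>2 > 0" using 2 by simp
      then show ?thesis unfolding e by (simp add: add_nonneg_pos)
    qed
    then have "Q > 0" using 1 by (simp add: zero_less_mult_iff)
    ultimately show ?thesis by simp
  qed
  moreover have "transpose (period_matrix \<tau>\<^sub>1 z \<tau>\<^sub>2) = period_matrix \<tau>\<^sub>1 z \<tau>\<^sub>2"
    by (simp add: mat2_eq_iff period_matrix_mat2 transpose_def)
  ultimately show ?thesis by (simp add: siegel_half_space_def)
qed

lemma complex_block_block_matrix: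
  "complex_block Inl Inl (block_matrix (mat2 a b c d) B C D) = mat2 (of_int a) (of_int b) (of_int c) (of_int d)"
  "complex_block Inl Inr (block_matrix A (mat2 a b c d) C D) = mat2 (of_int a) (of_int b) (of_int c) (of_int d)"
  "complex_block Inr Inl (block_matrix A B (mat2 a b c d) D) = mat2 (of_int a) (of_int b) (of_int c) (of_int d)"
  "complex_block Inr Inr (block_matrix A B C (mat2 a b c d)) = mat2 (of_int a) (of_int b) (of_int c) (of_int d)"
  by (simp_all add: mat2_eq_iff complex_block_def block_matrix_def)

text \<open>Replaces the matrix inverse by the check Y N = A Z + B for a guessed image Y.\<close>

lemma siegel_modular_form_action:
  assumes \<Phi>: "siegel_modular_form w \<Phi>" and M: "M \<in> Sp4Z" and Z: "Z \<in> siegel_half_space"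
    and N: "automorphy_matrix M Z = N" "det N \<noteq> 0"
    and Y: "complex_block Inl Inl M ** Z + complex_block Inl Inr M = Y ** N"
  shows "\<Phi> Y = det N ^ w * \<Phi> Z"
proof -
  have "invertible N" using N(2) by (simp add: invertible_det_nz)
  then have "N ** matrix_inv N = mat 1"
    unfolding invertible_def matrix_inv_def by (rule someI_ex[THEN conjunct1])
  then have "symplectic_action M Z = Y"
    unfolding symplectic_action_def N(1) Y by (simp add: matrix_mul_assoc[symmetric])
  then show ?thesis using \<Phi> M Z N(1) unfolding siegel_modular_form_def by metis
qed

lemmas Sp4Z_simps = Sp4Z_def vec_eq_iff forall_2_2 matrix_matrix_mult_def sum_UNIV_2_2 transpose_def
  symplectic_unit_def block_matrix_def mat_def

text \<open>The four matrices yield, in turn, the symmetry in n and m, the evenness in z, the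
  elliptic law and the inversion of the first variable. The determinant -1 of the first two
  automorphy matrices is harmless in even weight.\<close>

lemma Sp4Z_swap: "block_matrix (mat2 0 1 1 0) 0 0 (mat2 0 1 1 0) \<in> Sp4Z"
  by (simp add: Sp4Z_simps)

lemma Sp4Z_sign: "block_matrix (mat2 1 0 0 (-1)) 0 0 (mat2 1 0 0 (-1)) \<in> Sp4Z"
  by (simp add: Sp4Z_simps)

lemma Sp4Z_unipotent: "block_matrix (mat2 1 0 1 1) 0 0 (mat2 1 (-1) 0 1) \<in> Sp4Z"
  by (simp add: Sp4Z_simps)

lemma Sp4Z_inversion:
  "block_matrix (mat2 0 0 0 1) (mat2 (-1) 0 0 0) (mat2 1 0 0 0) (mat2 0 0 0 1) \<in> Sp4Z"
  by (simp add: Sp4Z_simps)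

lemma zero_mat2: "0 = mat2 0 0 0 (0 :: 'a :: zero)"
  by (simp add: mat2_eq_iff)

context
  fixes k :: nat and \<Phi> :: "complex^2^2 \<Rightarrow> complex" and \<tau>\<^sub>1 z \<tau>\<^sub>2 :: complex
  assumes \<Phi>: "siegel_modular_form (2 * k) \<Phi>"
    and H1: "Im \<tau>\<^sub>1 > 0" and H2: "(Im z)\<^sup>2 < Im \<tau>\<^sub>1 * Im \<tau>\<^sub>2"
begin

lemmas act = siegel_modular_form_action[OF \<Phi> _ period_matrix_in_siegel_half_space[OF H1 H2]]

lemmas act_simps = automorphy_matrix_def zero_mat2[where 'a = int] complex_block_block_matrix
  period_matrix_mat2 mat2_mult mat2_add

lemma siegel_swap: "\<Phi> (period_matrix \<tau>\<^sub>2 z \<tau>\<^sub>1) = \<Phi> (period_matrix \<tau>\<^sub>1 z \<tau>\<^sub>2)"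
proof -
  have "\<Phi> (period_matrix \<tau>\<^sub>2 z \<tau>\<^sub>1) = det (mat2 0 1 1 0) ^ (2 * k) * \<Phi> (period_matrix \<tau>\<^sub>1 z \<tau>\<^sub>2)"
    by (rule act[OF Sp4Z_swap]) (simp_all add: act_simps det_2)
  then show ?thesis by (simp add: det_2)
qed

lemma siegel_sign: "\<Phi> (period_matrix \<tau>\<^sub>1 (- z) \<tau>\<^sub>2) = \<Phi> (period_matrix \<tau>\<^sub>1 z \<tau>\<^sub>2)"
proof -
  have "\<Phi> (period_matrix \<tau>\<^sub>1 (- z) \<tau>\<^sub>2) = det (mat2 1 0 0 (-1)) ^ (2 * k) * \<Phi> (period_matrix \<tau>\<^sub>1 z \<tau>\<^sub>2)"
    by (rule act[OF Sp4Z_sign]) (simp_all add: act_simps det_2)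
  then show ?thesis by (simp add: det_2)
qed

lemma siegel_elliptic:
  "\<Phi> (period_matrix \<tau>\<^sub>1 (z + \<tau>\<^sub>1) (\<tau>\<^sub>2 + 2 * z + \<tau>\<^sub>1)) = \<Phi> (period_matrix \<tau>\<^sub>1 z \<tau>\<^sub>2)"
proof -
  have "\<Phi> (period_matrix \<tau>\<^sub>1 (z + \<tau>\<^sub>1) (\<tau>\<^sub>2 + 2 * z + \<tau>\<^sub>1)) = det (mat2 1 (-1) 0 1) ^ (2 * k) * \<Phi> (period_matrix \<tau>\<^sub>1 z \<tau>\<^sub>2)"
    by (rule act[OF Sp4Z_unipotent]) (simp_all add: act_simps det_2 add_ac)
  then show ?thesis by (simp add: det_2)
qed

lemma siegel_inversion:
  "\<Phi> (period_matrix (- 1 / \<tau>\<^sub>1) (z / \<tau>\<^sub>1) (\<tau>\<^sub>2 - z\<^sup>2 / \<tau>\<^sub>1)) = \<tau>\<^sub>1 ^ (2 * k) * \<Phi> (period_matrix \<tau>\<^sub>1 z \<tau>\<^sub>2)"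
proof -
  have "\<tau>\<^sub>1 \<noteq> 0" using H1 by auto
  then have "\<Phi> (period_matrix (- 1 / \<tau>\<^sub>1) (z / \<tau>\<^sub>1) (\<tau>\<^sub>2 - z\<^sup>2 / \<tau>\<^sub>1)) =
      det (mat2 \<tau>\<^sub>1 z 0 1) ^ (2 * k) * \<Phi> (period_matrix \<tau>\<^sub>1 z \<tau>\<^sub>2)"
    by (intro act[OF Sp4Z_inversion]) (simp_all add: act_simps det_2 power2_eq_square)
  then show ?thesis by (simp add: det_2)
qed

end

section \<open>The Fourier-Jacobi expansion and uniqueness of coefficients\<close>

definition lset :: "nat \<Rightarrow> nat \<Rightarrow> int set" where
  "lset n m = {l. l\<^sup>2 \<le> 4 * int n * int m}"

lemma lset_subset: "lset n m \<subseteq> {- int (4 * n * m)..int (4 * n * m)}"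
proof
  fix l assume l: "l \<in> lset n m"
  have "\<bar>l\<bar> \<le> l\<^sup>2"
    using mult_left_mono[of 1 "\<bar>l\<bar>" "\<bar>l\<bar>"] by (cases "l = 0") (auto simp: power2_eq_square simp flip: abs_mult)
  with l show "l \<in> {- int (4 * n * m)..int (4 * n * m)}" by (auto simp: lset_def)
qed

lemma finite_lset [simp]: "finite (lset n m)"
  using lset_subset by (rule finite_subset) simp

definition laurent :: "(nat \<Rightarrow> int \<Rightarrow> nat \<Rightarrow> complex) \<Rightarrow> nat \<Rightarrow> nat \<Rightarrow> complex \<Rightarrow> complex" where
  "laurent c m n z = (\<Sum>l\<in>lset n m. c n l m * ex z powi l)"

definition fourier_jacobi :: "(nat \<Rightarrow> int \<Rightarrow> nat \<Rightarrow> complex) \<Rightarrow> nat \<Rightarrow> complex \<Rightarrow> complex \<Rightarrow> complex" where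
  "fourier_jacobi c m \<tau> z = (\<Sum>n. laurent c m n z * ex \<tau> ^ n)"

lemma bij_betw_fourier_index:
  "bij_betw (\<lambda>(m, n, l). (n, l, m)) (SIGMA m:UNIV. SIGMA n:UNIV. lset n m) fourier_index"
  by (rule bij_betwI[where g = "\<lambda>(n, l, m). (m, n, l)"]) (auto simp: lset_def fourier_index_def)

locale fourier_expansion =
  fixes \<Phi> :: "complex^2^2 \<Rightarrow> complex" and c :: "nat \<Rightarrow> int \<Rightarrow> nat \<Rightarrow> complex"
  assumes expansion: "has_fourier_expansion \<Phi> c"
begin

lemma has_sum_Sigma:
  assumes "Im \<tau>\<^sub>1 > 0" "(Im z)\<^sup>2 < Im \<tau>\<^sub>1 * Im \<tau>\<^sub>2"
  shows "((\<lambda>(m, n, l). c n l m * ex \<tau>\<^sub>1 ^ n * ex \<tau>\<^sub>2 ^ m * ex z powi l) has_sum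
     \<Phi> (period_matrix \<tau>\<^sub>1 z \<tau>\<^sub>2)) (SIGMA m:UNIV. SIGMA n:UNIV. lset n m)"
proof -
  have "((\<lambda>(n, l, m). c n l m * ex \<tau>\<^sub>1 ^ n * ex \<tau>\<^sub>2 ^ m * ex z powi l) has_sum
     \<Phi> (period_matrix \<tau>\<^sub>1 z \<tau>\<^sub>2)) fourier_index"
    using expansion period_matrix_in_siegel_half_space[OF assms]
    unfolding has_fourier_expansion_def ex_def by simp
  then show ?thesis
    by (subst (asm) has_sum_reindex_bij_betw[OF bij_betw_fourier_index, symmetric]) (simp add: case_prod_unfold)
qed

lemma summable_fixed_m:
  assumes \<tau>: "Im \<tau> > 0"
  shows "(\<lambda>(n, l). c n l m * ex \<tau> ^ n * ex z powi l) summable_on (SIGMA n:UNIV. lset n m)"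
proof -
  \<comment> \<open>Any third variable with large enough imaginary part completes (\<tau>, z) to a
    point of the half-space; the factor e(\<tau>')^m is divided out afterwards.\<close>
  define \<tau>' where "\<tau>' = \<i> * of_real (((Im z)\<^sup>2 + 1) / Im \<tau>)"
  have "(Im z)\<^sup>2 < Im \<tau> * Im \<tau>'" using \<tau> by (simp add: \<tau>'_def)
  from has_sum_Sigma[OF \<tau> this]
  have "(\<lambda>(m, y). case y of (n, l) \<Rightarrow> c n l m * ex \<tau> ^ n * ex \<tau>' ^ m * ex z powi l) summable_on (SIGMA m:UNIV. SIGMA n:UNIV. lset n m)"
    by (auto simp: summable_on_def)
  then have "(\<lambda>(n, l). c n l m * ex \<tau> ^ n * ex \<tau>' ^ m * ex z powi l) summable_on (SIGMA n:UNIV. lset n m)"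
    by (rule summable_on_SigmaD1) simp
  then have "(\<lambda>x. (1 / ex \<tau>' ^ m) * (case x of (n, l) \<Rightarrow> c n l m * ex \<tau> ^ n * ex \<tau>' ^ m * ex z powi l)) summable_on (SIGMA n:UNIV. lset n m)"
    by (rule summable_on_cmult_right)
  then show ?thesis by (simp add: case_prod_unfold mult_ac)
qed

lemma summable_norm_fixed_m:
  assumes \<tau>: "Im \<tau> > 0"
  shows "summable (\<lambda>n. (\<Sum>l\<in>lset n m. norm (c n l m) * norm (ex z) powi l) * norm (ex \<tau>) ^ n)"
proof -
  have "(\<lambda>x. norm (case x of (n, l) \<Rightarrow> c n l m * ex \<tau> ^ n * ex z powi l)) summable_on (SIGMA n:UNIV. lset n m)"
    using summable_fixed_m[OF assms] by (simp add: summable_on_iff_abs_summable_on_complex)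
  then have "(\<lambda>n. infsum (\<lambda>l. norm (case (n, l) of (n, l) \<Rightarrow> c n l m * ex \<tau> ^ n * ex z powi l)) (lset n m)) summable_on UNIV"
    by (rule summable_on_SigmaD) auto
  then have "summable (\<lambda>n. infsum (\<lambda>l. norm (case (n, l) of (n, l) \<Rightarrow> c n l m * ex \<tau> ^ n * ex z powi l)) (lset n m))"
    by (rule summable_on_imp_summable)
  then show ?thesis
    by (simp add: infsum_finite norm_mult norm_power norm_power_int sum_distrib_left sum_distrib_right mult_ac)
qed

lemma has_sum_fourier_jacobi:
  assumes \<tau>: "Im \<tau> > 0"
  shows "((\<lambda>(n, l). c n l m * ex \<tau> ^ n * ex z powi l) has_sum fourier_jacobi c m \<tau> z) (SIGMA n:UNIV. lset n m)"
    and "(\<lambda>n. laurent c m n z * ex \<tau> ^ n) sums fourier_jacobi c m \<tau> z"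
proof -
  obtain S where S: "((\<lambda>(n, l). c n l m * ex \<tau> ^ n * ex z powi l) has_sum S) (SIGMA n:UNIV. lset n m)"
    using summable_fixed_m[OF \<tau>] by (auto simp: summable_on_def)
  have "((\<lambda>n. laurent c m n z * ex \<tau> ^ n) has_sum S) UNIV"
  proof (rule has_sum_SigmaD[OF S])
    fix n
    have "((\<lambda>l. c n l m * ex \<tau> ^ n * ex z powi l) has_sum (\<Sum>l\<in>lset n m. c n l m * ex \<tau> ^ n * ex z powi l)) (lset n m)"
      by (rule has_sum_finite) simp
    then show "((\<lambda>l. case (n, l) of (n, l) \<Rightarrow> c n l m * ex \<tau> ^ n * ex z powi l) has_sum laurent c m n z * ex \<tau> ^ n) (lset n m)"
      by (simp add: laurent_def sum_distrib_left mult_ac)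
  qed
  then have s: "(\<lambda>n. laurent c m n z * ex \<tau> ^ n) sums S" by (rule has_sum_imp_sums)
  then have "fourier_jacobi c m \<tau> z = S" by (simp add: fourier_jacobi_def sums_iff)
  with S s show "((\<lambda>(n, l). c n l m * ex \<tau> ^ n * ex z powi l) has_sum fourier_jacobi c m \<tau> z) (SIGMA n:UNIV. lset n m)"
    "(\<lambda>n. laurent c m n z * ex \<tau> ^ n) sums fourier_jacobi c m \<tau> z" by auto
qed

lemma fourier_jacobi_sums:
  assumes "Im \<tau>\<^sub>1 > 0" "(Im z)\<^sup>2 < Im \<tau>\<^sub>1 * Im \<tau>\<^sub>2"
  shows "(\<lambda>m. fourier_jacobi c m \<tau>\<^sub>1 z * ex \<tau>\<^sub>2 ^ m) sums \<Phi> (period_matrix \<tau>\<^sub>1 z \<tau>\<^sub>2)"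
proof (rule has_sum_imp_sums, rule has_sum_SigmaD[OF has_sum_Sigma[OF assms]])
  fix m
  have "((\<lambda>x. (case x of (n, l) \<Rightarrow> c n l m * ex \<tau>\<^sub>1 ^ n * ex z powi l) * ex \<tau>\<^sub>2 ^ m) has_sum
     fourier_jacobi c m \<tau>\<^sub>1 z * ex \<tau>\<^sub>2 ^ m) (SIGMA n:UNIV. lset n m)"
    by (intro has_sum_cmult_left has_sum_fourier_jacobi assms)
  then show "((\<lambda>y. case (m, y) of (m, n, l) \<Rightarrow> c n l m * ex \<tau>\<^sub>1 ^ n * ex \<tau>\<^sub>2 ^ m * ex z powi l) has_sum
     fourier_jacobi c m \<tau>\<^sub>1 z * ex \<tau>\<^sub>2 ^ m) (SIGMA n:UNIV. lset n m)"
    by (simp add: case_prod_unfold mult_ac)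
qed

end

text \<open>Uniqueness of power series on a punctured disc in q = e(\<tau>'). The right-hand side is
  a function of \<tau>', so a logarithm of q with Im \<tau>' > y is chosen for each q.\<close>

lemma fourier_jacobi_unique:
  assumes \<tau>: "Im \<tau> > 0"
    and 1: "\<And>\<tau>'. Im \<tau>' > y \<Longrightarrow> (\<lambda>m. a m * ex \<tau>' ^ m) sums f \<tau>'"
    and 2: "\<And>\<tau>'. Im \<tau>' > y \<Longrightarrow> (\<lambda>m. b m * ex \<tau>' ^ m) sums f \<tau>'"
  shows "a m = b m"
proof (rule powser_coeffs_eq[where r = "exp (- (2 * pi * y))" and f = "\<lambda>q. f (SOME \<tau>'. ex \<tau>' = q \<and> Im \<tau>' > y)"])
  fix q :: complex assume q: "norm q < exp (- (2 * pi * y))" "q \<noteq> 0"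
  obtain \<tau>' where t: "ex \<tau>' = q" using ex_surj[OF q(2)] .
  have "Im \<tau>' > y" using q(1) unfolding t[symmetric] norm_ex by simp
  with t have "\<exists>\<tau>'. ex \<tau>' = q \<and> Im \<tau>' > y" by blast
  then have s: "ex (SOME \<tau>'. ex \<tau>' = q \<and> Im \<tau>' > y) = q \<and> Im (SOME \<tau>'. ex \<tau>' = q \<and> Im \<tau>' > y) > y" by (rule someI_ex)
  from 1[OF s[THEN conjunct2]] s show "(\<lambda>m. a m * q ^ m) sums f (SOME \<tau>'. ex \<tau>' = q \<and> Im \<tau>' > y)" by simp
  from 2[OF s[THEN conjunct2]] s show "(\<lambda>m. b m * q ^ m) sums f (SOME \<tau>'. ex \<tau>' = q \<and> Im \<tau>' > y)" by simp
qed simp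

text \<open>Multiplication by q^B, where B bounds the exponents, turns the Laurent polynomial into a
  power series.\<close>

lemma laurent_coeffs_zero:
  assumes "\<And>z. (\<Sum>l\<in>lset n m. d l * ex z powi l) = 0" and l: "l \<in> lset n m"
  shows "d l = 0"
proof -
  define B where "B = int (4 * n * m)"
  define a where "a j = (if int j - B \<in> lset n m then d (int j - B) else 0)" for j :: nat
  have "a (nat (l + B)) = 0"
  proof (rule powser_coeffs_zero[of 1])
    fix q :: complex assume q: "q \<noteq> 0"
    obtain z where z: "ex z = q" using ex_surj[OF q] .
    have "0 \<le> l + B" if "l \<in> lset n m" for l using that lset_subset[of n m] by (auto simp: B_def)
    then have inj: "inj_on (\<lambda>l. nat (l + B)) (lset n m)"
      by (intro inj_onI) (metis add_right_imp_eq eq_nat_nat_iff)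
    have "(\<lambda>j. a j * q ^ j) sums (\<Sum>j\<in>(\<lambda>l. nat (l + B)) ` lset n m. a j * q ^ j)"
    proof (rule sums_finite)
      fix j assume j: "j \<notin> (\<lambda>l. nat (l + B)) ` lset n m"
      have "int j - B \<notin> lset n m"
      proof
        assume "int j - B \<in> lset n m"
        then have "nat ((int j - B) + B) \<in> (\<lambda>l. nat (l + B)) ` lset n m" by blast
        with j show False by simp
      qed
      then show "a j * q ^ j = 0" by (simp add: a_def)
    qed simp
    also have "(\<Sum>j\<in>(\<lambda>l. nat (l + B)) ` lset n m. a j * q ^ j) = (\<Sum>l\<in>lset n m. q powi B * (d l * q powi l))"
      unfolding sum.reindex[OF inj] o_def
    proof (rule sum.cong)
      fix l assume l: "l \<in> lset n m"
      then have nn: "0 \<le> l + B" using lset_subset[of n m] by (auto simp: B_def)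
      then have "q ^ nat (l + B) = q powi (l + B)" by (simp add: power_int_def)
      also have "\<dots> = q powi l * q powi B" using q by (simp add: power_int_add)
      finally show "a (nat (l + B)) * q ^ nat (l + B) = q powi B * (d l * q powi l)"
        using nn l by (simp add: a_def)
    qed simp
    also have "\<dots> = q powi B * (\<Sum>l\<in>lset n m. d l * ex z powi l)" by (simp add: z sum_distrib_left)
    finally show "(\<lambda>j. a j * q ^ j) sums 0" using assms(1) by simp
  qed simp
  moreover have "0 \<le> l + B" using l lset_subset[of n m] by (auto simp: B_def)
  ultimately show ?thesis using l by (simp add: a_def)
qed

text \<open>One-variable uniqueness for the second q-variable, the first one and \<zeta> in turn. It
  turns symmetries of \<Phi> into symmetries of c.\<close>

lemma fourier_coefficients_unique:
  assumes "has_fourier_expansion \<Phi> c" "has_fourier_expansion \<Phi> d" and l: "l \<in> lset n m"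
  shows "c n l m = d n l m"
proof -
  interpret c: fourier_expansion \<Phi> c by standard (rule assms(1))
  interpret d: fourier_expansion \<Phi> d by standard (rule assms(2))
  have 1: "fourier_jacobi c m \<tau> z = fourier_jacobi d m \<tau> z" if \<tau>: "Im \<tau> > 0" for \<tau> z m
  proof (rule fourier_jacobi_unique[OF \<tau>, where y = "(Im z)\<^sup>2 / Im \<tau>"])
    fix \<tau>' assume "Im \<tau>' > (Im z)\<^sup>2 / Im \<tau>"
    then have "(Im z)\<^sup>2 < Im \<tau> * Im \<tau>'" using \<tau> by (simp add: field_simps)
    from c.fourier_jacobi_sums[OF \<tau> this] d.fourier_jacobi_sums[OF \<tau> this]
    show "(\<lambda>m. fourier_jacobi c m \<tau> z * ex \<tau>' ^ m) sums \<Phi> (period_matrix \<tau> z \<tau>')"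
      "(\<lambda>m. fourier_jacobi d m \<tau> z * ex \<tau>' ^ m) sums \<Phi> (period_matrix \<tau> z \<tau>')" .
  qed
  have 2: "laurent c m n z = laurent d m n z" for z n
  proof (rule fourier_jacobi_unique[of \<i> 0])
    show "Im \<tau>' > 0 \<Longrightarrow> (\<lambda>n. laurent c m n z * ex \<tau>' ^ n) sums fourier_jacobi c m \<tau>' z" for \<tau>'
      by (rule c.has_sum_fourier_jacobi)
    show "Im \<tau>' > 0 \<Longrightarrow> (\<lambda>n. laurent d m n z * ex \<tau>' ^ n) sums fourier_jacobi c m \<tau>' z" for \<tau>'
      unfolding 1 by (rule d.has_sum_fourier_jacobi)
  qed simp
  have "c n l m - d n l m = 0"
  proof (rule laurent_coeffs_zero[OF _ l])
    show "(\<Sum>l\<in>lset n m. (c n l m - d n l m) * ex z powi l) = 0" for z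
      using 2[of n z] by (simp add: laurent_def left_diff_distrib sum_subtractf)
  qed
  then show ?thesis by simp
qed

text \<open>
  \<open>\<zeta>\<^sup>n + 1 / \<zeta>\<^sup>n\<close> as a monic integral polynomial in \<open>X\<close>; only the degenerate case \<open>n = 0\<close> is not monic.
\<close>

fun cheb :: "nat \<Rightarrow> complex poly" where
  "cheb 0 = [:2:]"
| "cheb (Suc 0) = [:2, 1:]"
| "cheb (Suc (Suc n)) = [:2, 1:] * cheb (Suc n) - cheb n"

lemma poly_cheb: "poly (cheb n) (xx z) = ex z ^ n + 1 / ex z ^ n"
proof (induction n rule: cheb.induct)
  case (3 n)
  then show ?case by (simp add: xx_def ex_minus field_simps)
qed (simp_all add: xx_def ex_minus)

lemma ipoly_cheb: "ipoly (cheb n)"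
  by (induction n rule: cheb.induct) (auto intro!: ipoly_diff ipoly_mult ipoly_add simp del: mult_pCons_left)

lemma cheb_degree: "degree (cheb n) \<le> n" and cheb_lead: "0 < n \<Longrightarrow> coeff (cheb n) n = 1"
proof -
  have "degree (cheb n) \<le> n \<and> (0 < n \<longrightarrow> coeff (cheb n) n = 1)"
  proof (induction n rule: cheb.induct)
    case (3 n)
    have d: "degree ([:2, 1:] * cheb (Suc n)) \<le> Suc (Suc n)"
      by (rule order.trans[OF degree_mult_le]) (use 3 in auto)
    have "degree (cheb (Suc (Suc n))) \<le> Suc (Suc n)"
      unfolding cheb.simps(3) using d 3 by (intro degree_diff_le) auto
    moreover have "coeff (cheb (Suc (Suc n))) (Suc (Suc n)) = 1"
      using 3 by (simp add: coeff_eq_0 le_imp_less_Suc less_Suc_eq_le)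
    ultimately show ?case by simp
  qed auto
  then show "degree (cheb n) \<le> n" "0 < n \<Longrightarrow> coeff (cheb n) n = 1" by auto
qed

text \<open>With x = s + 3 the recursion needs (s + 2) x + 1 \<le> x^2. The bound is later compared
  with the Fourier series at \<zeta> = s + 3.\<close>

lemma pnorm_cheb: "0 \<le> s \<Longrightarrow> pnorm s (cheb n) \<le> 2 * (s + 3) ^ n"
proof (induction n rule: cheb.induct)
  case (3 n)
  have "pnorm s (cheb (Suc (Suc n))) \<le> pnorm s [:2, 1:] * pnorm s (cheb (Suc n)) + pnorm s (cheb n)"
    unfolding cheb.simps(3) using pnorm_diff[OF 3(3)] pnorm_mult[OF 3(3)] by (smt (verit, best))
  also have "\<dots> \<le> (2 + s) * (2 * (s + 3) ^ Suc n) + 2 * (s + 3) ^ n"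
    using 3 by (intro add_mono mult_mono pnorm_nonneg) auto
  also have "\<dots> \<le> (2 + s) * (2 * (s + 3) ^ Suc n) + 2 * (s + 3) ^ Suc n"
    using 3 by (intro add_left_mono mult_left_mono power_increasing) auto
  also have "\<dots> = 2 * (s + 3) ^ Suc (Suc n)" by (simp add: algebra_simps)
  finally show ?case .
qed auto

text \<open>The sum of a 0 and of a l (\<zeta>^l + \<zeta>^(-l)) for 1 \<le> l \<le> B; the term l =
  0 stands apart because \<open>cheb 0\<close> is 2.\<close>

definition even_laurent :: "nat \<Rightarrow> (nat \<Rightarrow> complex) \<Rightarrow> complex poly" where
  "even_laurent B a = [:a 0:] + (\<Sum>l=1..B. smult (a l) (cheb l))"

lemma ipoly_even_laurent: "(\<And>l. l \<le> B \<Longrightarrow> a l \<in> \<int>) \<Longrightarrow> ipoly (even_laurent B a)"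
  unfolding even_laurent_def by (intro ipoly_add ipoly_sum ipoly_smult ipoly_cheb) auto

text \<open>As \<open>cheb\<close> is monic in positive degree, the top coefficient is a (Suc B);
  split it off and descend.\<close>

lemma ipoly_even_laurentD: "ipoly (even_laurent B a) \<Longrightarrow> l \<le> B \<Longrightarrow> a l \<in> \<int>"
proof (induction B arbitrary: l)
  case 0
  then show ?case by (simp add: even_laurent_def)
next
  case (Suc B)
  have e: "even_laurent (Suc B) a = even_laurent B a + smult (a (Suc B)) (cheb (Suc B))"
    by (simp add: even_laurent_def)
  have "degree (even_laurent B a) \<le> B"
    unfolding even_laurent_def
    by (intro degree_add_le degree_sum_le order.trans[OF degree_smult_le] order.trans[OF cheb_degree]) auto
  then have "coeff (even_laurent (Suc B) a) (Suc B) = a (Suc B)"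
    unfolding e by (simp add: coeff_eq_0 cheb_lead)
  then have a: "a (Suc B) \<in> \<int>" using Suc.prems(1) by (metis ipoly_def)
  then have "ipoly (even_laurent (Suc B) a - smult (a (Suc B)) (cheb (Suc B)))"
    by (intro ipoly_diff Suc.prems ipoly_smult ipoly_cheb)
  then have "ipoly (even_laurent B a)" by (simp add: e)
  then show ?case using Suc a by (cases "l = Suc B") auto
qed

lemma sum_symmetric_interval:
  fixes f :: "int \<Rightarrow> complex"
  shows "sum f {- int B..int B} = f 0 + (\<Sum>l=1..B. f (int l) + f (- int l))"
proof (induction B)
  case (Suc B)
  have "{- int (Suc B)..int (Suc B)} = insert (int (Suc B)) (insert (- int (Suc B)) {- int B..int B})" by auto
  then have "sum f {- int (Suc B)..int (Suc B)} = f (int (Suc B)) + (f (- int (Suc B)) + sum f {- int B..int B})" by simp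
  then show ?case using Suc by (simp add: add_ac)
qed simp

lemma siegel_half_spaceD:
  assumes Z: "period_matrix \<tau>\<^sub>1 z \<tau>\<^sub>2 \<in> siegel_half_space"
  shows "Im \<tau>\<^sub>1 > 0" "(Im z)\<^sup>2 < Im \<tau>\<^sub>1 * Im \<tau>\<^sub>2"
proof -
  have Q: "Im \<tau>\<^sub>1 * a\<^sup>2 + 2 * Im z * a * b + Im \<tau>\<^sub>2 * b\<^sup>2 > 0" if "a \<noteq> 0 \<or> b \<noteq> 0" for a b :: real
  proof -
    have "vector [a, b] \<noteq> (0 :: real^2)" using that by (auto simp: vec_eq_iff forall_2)
    then have "vector [a, b] \<bullet> ((\<chi> i j. Im (entry (period_matrix \<tau>\<^sub>1 z \<tau>\<^sub>2) i j)) *v vector [a, b]) > (0 :: real)"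
      using Z by (simp add: siegel_half_space_def)
    then show ?thesis
      by (simp add: period_matrix_mat2 inner_vec_def matrix_vector_mult_def sum_2 power2_eq_square algebra_simps)
  qed
  show 1: "Im \<tau>\<^sub>1 > 0" using Q[of 1 0] by simp
  \<comment> \<open>The vector (- Im z, Im \<tau>1) makes the quadratic form a multiple of the
    determinant.\<close>
  have "Im \<tau>\<^sub>1 * (- Im z)\<^sup>2 + 2 * Im z * (- Im z) * Im \<tau>\<^sub>1 + Im \<tau>\<^sub>2 * (Im \<tau>\<^sub>1)\<^sup>2 =
      Im \<tau>\<^sub>1 * (Im \<tau>\<^sub>1 * Im \<tau>\<^sub>2 - (Im z)\<^sup>2)"
    by (simp add: power2_eq_square algebra_simps)
  with Q[of "- Im z" "Im \<tau>\<^sub>1"] 1 show "(Im z)\<^sup>2 < Im \<tau>\<^sub>1 * Im \<tau>\<^sub>2"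
    by (simp add: zero_less_mult_iff)
qed

lemma has_fourier_expansion_iff:
  "has_fourier_expansion \<Phi> c \<longleftrightarrow> (\<forall>\<tau>\<^sub>1 z \<tau>\<^sub>2. Im \<tau>\<^sub>1 > 0 \<longrightarrow> (Im z)\<^sup>2 < Im \<tau>\<^sub>1 * Im \<tau>\<^sub>2 \<longrightarrow>
     ((\<lambda>(n, l, m). c n l m * ex \<tau>\<^sub>1 ^ n * ex \<tau>\<^sub>2 ^ m * ex z powi l) has_sum \<Phi> (period_matrix \<tau>\<^sub>1 z \<tau>\<^sub>2)) fourier_index)"
proof -
  have "has_fourier_expansion \<Phi> c \<longleftrightarrow> (\<forall>\<tau>\<^sub>1 z \<tau>\<^sub>2. period_matrix \<tau>\<^sub>1 z \<tau>\<^sub>2 \<in> siegel_half_space \<longrightarrow>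
     ((\<lambda>(n, l, m). c n l m * ex \<tau>\<^sub>1 ^ n * ex \<tau>\<^sub>2 ^ m * ex z powi l) has_sum \<Phi> (period_matrix \<tau>\<^sub>1 z \<tau>\<^sub>2)) fourier_index)"
    unfolding has_fourier_expansion_def ex_def by simp
  moreover have "period_matrix \<tau>\<^sub>1 z \<tau>\<^sub>2 \<in> siegel_half_space \<longleftrightarrow> Im \<tau>\<^sub>1 > 0 \<and> (Im z)\<^sup>2 < Im \<tau>\<^sub>1 * Im \<tau>\<^sub>2" for \<tau>\<^sub>1 z \<tau>\<^sub>2
    using period_matrix_in_siegel_half_space siegel_half_spaceD by blast
  ultimately show ?thesis by (simp add: imp_conjL)
qed

lemma has_fourier_expansionD:
  assumes "has_fourier_expansion \<Phi> c" "Im \<tau>\<^sub>1 > 0" "(Im z)\<^sup>2 < Im \<tau>\<^sub>1 * Im \<tau>\<^sub>2"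
  shows "((\<lambda>(n, l, m). c n l m * ex \<tau>\<^sub>1 ^ n * ex \<tau>\<^sub>2 ^ m * ex z powi l) has_sum \<Phi> (period_matrix \<tau>\<^sub>1 z \<tau>\<^sub>2)) fourier_index"
  using assms by (simp add: has_fourier_expansion_iff)

section \<open>Fourier-Jacobi coefficients as series in q and X\<close>

locale siegel_expansion =
  fixes k :: nat and \<Phi> :: "complex^2^2 \<Rightarrow> complex" and c :: "nat \<Rightarrow> int \<Rightarrow> nat \<Rightarrow> complex"
  assumes \<Phi>: "siegel_modular_form (2 * k) \<Phi>" and expansion': "has_fourier_expansion \<Phi> c"
begin

sublocale fourier_expansion \<Phi> c by standard (rule expansion')

lemma coeff_swap: assumes l: "l\<^sup>2 \<le> 4 * int n * int m" shows "c n l m = c m l n"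
proof (rule fourier_coefficients_unique[OF expansion'])
  show "has_fourier_expansion \<Phi> (\<lambda>n l m. c m l n)"
    unfolding has_fourier_expansion_iff
  proof (intro allI impI)
    fix \<tau>\<^sub>1 z \<tau>\<^sub>2 assume H: "Im \<tau>\<^sub>1 > 0" "(Im z)\<^sup>2 < Im \<tau>\<^sub>1 * Im \<tau>\<^sub>2"
    have "0 < Im \<tau>\<^sub>1 * Im \<tau>\<^sub>2" using H(2) zero_le_power2[of "Im z"] by linarith
    then have H': "Im \<tau>\<^sub>2 > 0" "(Im z)\<^sup>2 < Im \<tau>\<^sub>2 * Im \<tau>\<^sub>1" using H by (auto simp: zero_less_mult_iff mult.commute)
    have "((\<lambda>(n, l, m). c n l m * ex \<tau>\<^sub>2 ^ n * ex \<tau>\<^sub>1 ^ m * ex z powi l) has_sum \<Phi> (period_matrix \<tau>\<^sub>1 z \<tau>\<^sub>2)) fourier_index"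
      using has_fourier_expansionD[OF expansion' H'] unfolding siegel_swap[OF \<Phi> H] .
    also have "?this \<longleftrightarrow> ((\<lambda>(n, l, m). c m l n * ex \<tau>\<^sub>1 ^ n * ex \<tau>\<^sub>2 ^ m * ex z powi l) has_sum \<Phi> (period_matrix \<tau>\<^sub>1 z \<tau>\<^sub>2)) fourier_index"
      by (rule has_sum_reindex_bij_witness[where i = "\<lambda>(n, l, m). (m, l, n)" and j = "\<lambda>(n, l, m). (m, l, n)"])
         (auto simp: fourier_index_def mult_ac)
    finally show "((\<lambda>(n, l, m). c m l n * ex \<tau>\<^sub>1 ^ n * ex \<tau>\<^sub>2 ^ m * ex z powi l) has_sum \<Phi> (period_matrix \<tau>\<^sub>1 z \<tau>\<^sub>2)) fourier_index" .
  qed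
qed (use l in \<open>simp add: lset_def\<close>)

lemma coeff_minus: assumes l: "l\<^sup>2 \<le> 4 * int n * int m" shows "c n l m = c n (- l) m"
proof (rule fourier_coefficients_unique[OF expansion'])
  show "has_fourier_expansion \<Phi> (\<lambda>n l m. c n (- l) m)"
    unfolding has_fourier_expansion_iff
  proof (intro allI impI)
    fix \<tau>\<^sub>1 z \<tau>\<^sub>2 assume H: "Im \<tau>\<^sub>1 > 0" "(Im z)\<^sup>2 < Im \<tau>\<^sub>1 * Im \<tau>\<^sub>2"
    then have H': "Im \<tau>\<^sub>1 > 0" "(Im (- z))\<^sup>2 < Im \<tau>\<^sub>1 * Im \<tau>\<^sub>2" by auto
    have "((\<lambda>(n, l, m). c n l m * ex \<tau>\<^sub>1 ^ n * ex \<tau>\<^sub>2 ^ m * ex (- z) powi l) has_sum \<Phi> (period_matrix \<tau>\<^sub>1 z \<tau>\<^sub>2)) fourier_index"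
      using has_fourier_expansionD[OF expansion' H'] unfolding siegel_sign[OF \<Phi> H] .
    also have "?this \<longleftrightarrow> ((\<lambda>(n, l, m). c n (- l) m * ex \<tau>\<^sub>1 ^ n * ex \<tau>\<^sub>2 ^ m * ex z powi l) has_sum \<Phi> (period_matrix \<tau>\<^sub>1 z \<tau>\<^sub>2)) fourier_index"
      by (rule has_sum_reindex_bij_witness[where i = "\<lambda>(n, l, m). (n, - l, m)" and j = "\<lambda>(n, l, m). (n, - l, m)"])
         (auto simp: fourier_index_def ex_minus power_int_minus power_int_divide_distrib field_simps)
    finally show "((\<lambda>(n, l, m). c n (- l) m * ex \<tau>\<^sub>1 ^ n * ex \<tau>\<^sub>2 ^ m * ex z powi l) has_sum \<Phi> (period_matrix \<tau>\<^sub>1 z \<tau>\<^sub>2)) fourier_index" .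
  qed
qed (use l in \<open>simp add: lset_def\<close>)

text \<open>Extended by 0, so that sums may run to the common bound 4 n m on the exponents.\<close>

definition jcoeff :: "nat \<Rightarrow> nat \<Rightarrow> nat \<Rightarrow> complex" where
  "jcoeff m n l = (if int l \<in> lset n m then c n (int l) m else 0)"

definition jfps :: "nat \<Rightarrow> complex poly fps" where
  "jfps m = Abs_fps (\<lambda>n. even_laurent (4 * n * m) (jcoeff m n))"

lemma poly_jfps: "poly (fps_nth (jfps m) n) (xx z) = laurent c m n z"
proof -
  define B where "B = 4 * n * m"
  define f where "f l = (if l \<in> lset n m then c n l m * ex z powi l else 0)" for l
  have "laurent c m n z = sum f {- int B..int B}"
    unfolding laurent_def f_def B_def using lset_subset[of n m] by (intro sum.mono_neutral_cong_left) auto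
  also have "\<dots> = f 0 + (\<Sum>l=1..B. f (int l) + f (- int l))" by (rule sum_symmetric_interval)
  also have "\<dots> = jcoeff m n 0 + (\<Sum>l=1..B. jcoeff m n l * (ex z ^ l + 1 / ex z ^ l))"
  proof -
    have "f 0 = jcoeff m n 0" by (simp add: f_def jcoeff_def)
    moreover have "f (int l) + f (- int l) = jcoeff m n l * (ex z ^ l + 1 / ex z ^ l)" for l
      using coeff_minus[of "int l" n m] by (simp add: f_def jcoeff_def lset_def power_int_minus field_simps)
    ultimately show ?thesis by simp
  qed
  also have "\<dots> = poly (fps_nth (jfps m) n) (xx z)"
    by (simp add: jfps_def even_laurent_def poly_sum poly_cheb B_def)
  finally show ?thesis ..
qed

lemma pnorm_jfps:
  assumes s: "0 \<le> s"
  shows "pnorm s (fps_nth (jfps m) n) \<le> 2 * (\<Sum>l\<in>lset n m. norm (c n l m) * (s + 3) powi l)"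
proof -
  define B where "B = 4 * n * m"
  let ?a = "jcoeff m n"
  have "pnorm s (fps_nth (jfps m) n) \<le> norm (?a 0) + (\<Sum>l=1..B. pnorm s (smult (?a l) (cheb l)))"
    unfolding jfps_def even_laurent_def fps_nth_Abs_fps B_def[symmetric]
    using pnorm_add[OF s, of "[:?a 0:]" "\<Sum>l=1..B. smult (?a l) (cheb l)"] pnorm_sum[OF s, of "\<lambda>l. smult (?a l) (cheb l)" "{1..B}"]
    by simp
  also have "\<dots> \<le> 2 * (norm (?a 0) * (s + 3) ^ 0) + (\<Sum>l=1..B. 2 * (norm (?a l) * (s + 3) ^ l))"
  proof (intro add_mono sum_mono)
    fix l
    have "norm (?a l) * pnorm s (cheb l) \<le> norm (?a l) * (2 * (s + 3) ^ l)"
      using pnorm_cheb[OF s, of l] by (intro mult_left_mono) auto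
    then show "pnorm s (smult (?a l) (cheb l)) \<le> 2 * (norm (?a l) * (s + 3) ^ l)" by (simp add: pnorm_smult)
  qed simp
  also have "\<dots> = 2 * (\<Sum>l\<le>B. norm (?a l) * (s + 3) ^ l)"
    by (simp add: sum_distrib_left atMost_atLeast0 sum.atLeast_Suc_atMost)
  also have "(\<Sum>l\<le>B. norm (?a l) * (s + 3) ^ l) = (\<Sum>l\<in>int ` {..B}. if l \<in> lset n m then norm (c n l m) * (s + 3) powi l else 0)"
    by (subst sum.reindex) (auto simp: jcoeff_def intro!: sum.cong)
  also have "\<dots> = (\<Sum>l\<in>int ` {..B} \<inter> lset n m. norm (c n l m) * (s + 3) powi l)"
    by (simp add: sum.inter_restrict)
  also have "\<dots> \<le> (\<Sum>l\<in>lset n m. norm (c n l m) * (s + 3) powi l)"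
    using s by (intro sum_mono2) (auto simp: zero_le_power_int)
  finally show ?thesis by simp
qed

lemma conv_jfps: "conv (jfps m)"
proof (rule convI)
  fix r s :: real assume *: "0 \<le> r" "r < 1" "0 \<le> s"
  define t where "t = (1 + r) / 2"
  have t: "0 < t" "t < 1" "r \<le> t" using * by (auto simp: t_def)
  obtain \<tau> where \<tau>: "ex \<tau> = of_real t" "Im \<tau> > 0" using ex_surj_H[of "of_real t"] t by auto
  \<comment> \<open>At \<zeta> = s + 3 the absolutely convergent Fourier series is the majorant of
    \<open>pnorm_jfps\<close>.\<close>
  obtain z where z: "ex z = of_real (s + 3)" using ex_surj[of "of_real (s + 3)"] * by (auto simp: complex_eq_iff)
  have "norm (ex z) = s + 3" "norm (ex \<tau>) = t" unfolding z \<tau> norm_of_real using * t by auto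
  with summable_norm_fixed_m[OF \<tau>(2), of m z]
  have "summable (\<lambda>n. 2 * ((\<Sum>l\<in>lset n m. norm (c n l m) * (s + 3) powi l) * t ^ n))"
    by (intro summable_mult) simp
  then show "summable (\<lambda>n. pnorm s (fps_nth (jfps m) n) * r ^ n)"
  proof (rule summable_comparison_test'[where N = 0])
    fix n
    have "pnorm s (fps_nth (jfps m) n) * r ^ n \<le> (2 * (\<Sum>l\<in>lset n m. norm (c n l m) * (s + 3) powi l)) * t ^ n"
      using * t pnorm_jfps[of s m n]
      by (intro mult_mono power_mono mult_nonneg_nonneg sum_nonneg) (auto simp: zero_le_power_int)
    then show "norm (pnorm s (fps_nth (jfps m) n) * r ^ n) \<le> 2 * ((\<Sum>l\<in>lset n m. norm (c n l m) * (s + 3) powi l) * t ^ n)"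
      using * by (simp add: abs_mult pnorm_nonneg mult.assoc)
  qed
qed

lemma ev_jfps: "Im \<tau> > 0 \<Longrightarrow> ev (jfps m) (ex \<tau>) (xx z) = fourier_jacobi c m \<tau> z"
  unfolding ev_def poly_jfps fourier_jacobi_def ..

text \<open>Compare expansions in e(\<tau>') on both sides of \<open>siegel_inversion\<close>; the
  shift of \<tau>' by z^2 / \<tau> produces the factor of index m.\<close>

lemma fourier_jacobi_S:
  assumes \<tau>: "Im \<tau> > 0"
  shows "fourier_jacobi c m (- 1 / \<tau>) (z / \<tau>) = \<tau> ^ (2 * k) * ex (z\<^sup>2 / \<tau>) ^ m * fourier_jacobi c m \<tau> z"
proof -
  define \<sigma> w where "\<sigma> = - 1 / \<tau>" and "w = z / \<tau>"
  have \<sigma>: "Im \<sigma> > 0" unfolding \<sigma>_def by (rule Im_S[OF \<tau>])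
  have "fourier_jacobi c m \<sigma> w * ex (- (z\<^sup>2 / \<tau>)) ^ m = \<tau> ^ (2 * k) * fourier_jacobi c m \<tau> z"
  \<comment> \<open>The two bounds place the original and the inverted period matrix in the
    half-space.\<close>
  proof (rule fourier_jacobi_unique[OF \<tau>, where y = "max ((Im z)\<^sup>2 / Im \<tau>) ((Im w)\<^sup>2 / Im \<sigma> + Im (z\<^sup>2 / \<tau>))"])
    fix \<tau>' assume "Im \<tau>' > max ((Im z)\<^sup>2 / Im \<tau>) ((Im w)\<^sup>2 / Im \<sigma> + Im (z\<^sup>2 / \<tau>))"
    then have "Im \<tau>' > (Im z)\<^sup>2 / Im \<tau>" "Im (\<tau>' - z\<^sup>2 / \<tau>) > (Im w)\<^sup>2 / Im \<sigma>" by (auto simp del: Im_divide)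
    then have H: "(Im z)\<^sup>2 < Im \<tau> * Im \<tau>'" and H': "(Im w)\<^sup>2 < Im \<sigma> * Im (\<tau>' - z\<^sup>2 / \<tau>)"
      using \<tau> \<sigma> by (simp_all add: pos_divide_less_eq mult.commute)
    have I: "\<Phi> (period_matrix \<sigma> w (\<tau>' - z\<^sup>2 / \<tau>)) = \<tau> ^ (2 * k) * \<Phi> (period_matrix \<tau> z \<tau>')"
      unfolding \<sigma>_def w_def by (rule siegel_inversion[OF \<Phi> \<tau> H])
    have "ex (\<tau>' - z\<^sup>2 / \<tau>) = ex (- (z\<^sup>2 / \<tau>)) * ex \<tau>'" by (simp flip: ex_add)
    with fourier_jacobi_sums[OF \<sigma> H']
    show "(\<lambda>m. fourier_jacobi c m \<sigma> w * ex (- (z\<^sup>2 / \<tau>)) ^ m * ex \<tau>' ^ m) sums (\<tau> ^ (2 * k) * \<Phi> (period_matrix \<tau> z \<tau>'))"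
      unfolding I by (simp add: power_mult_distrib mult_ac)
    show "(\<lambda>m. \<tau> ^ (2 * k) * fourier_jacobi c m \<tau> z * ex \<tau>' ^ m) sums (\<tau> ^ (2 * k) * \<Phi> (period_matrix \<tau> z \<tau>'))"
      unfolding mult.assoc by (rule sums_mult[OF fourier_jacobi_sums[OF \<tau> H]])
  qed
  then show ?thesis unfolding \<sigma>_def w_def by (simp add: ex_minus power_divide field_simps del: divide_minus_left)
qed

lemma fourier_jacobi_elliptic:
  assumes \<tau>: "Im \<tau> > 0"
  shows "ex (\<tau> + 2 * z) ^ m * fourier_jacobi c m \<tau> (z + \<tau>) = fourier_jacobi c m \<tau> z"
proof (rule fourier_jacobi_unique[OF \<tau>, where y = "max ((Im z)\<^sup>2 / Im \<tau>) ((Im (z + \<tau>))\<^sup>2 / Im \<tau> - Im (2 * z + \<tau>))"])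
  fix \<tau>' assume "Im \<tau>' > max ((Im z)\<^sup>2 / Im \<tau>) ((Im (z + \<tau>))\<^sup>2 / Im \<tau> - Im (2 * z + \<tau>))"
  then have "Im \<tau>' > (Im z)\<^sup>2 / Im \<tau>" "Im (\<tau>' + 2 * z + \<tau>) > (Im (z + \<tau>))\<^sup>2 / Im \<tau>" by auto
  then have H: "(Im z)\<^sup>2 < Im \<tau> * Im \<tau>'" and H': "(Im (z + \<tau>))\<^sup>2 < Im \<tau> * Im (\<tau>' + 2 * z + \<tau>)"
    using \<tau> by (simp_all only: pos_divide_less_eq mult.commute)
  show "(\<lambda>m. fourier_jacobi c m \<tau> z * ex \<tau>' ^ m) sums \<Phi> (period_matrix \<tau> z \<tau>')"
    by (rule fourier_jacobi_sums[OF \<tau> H])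
  have "ex (\<tau>' + 2 * z + \<tau>) = ex (\<tau> + 2 * z) * ex \<tau>'" by (simp add: add_ac flip: ex_add)
  with fourier_jacobi_sums[OF \<tau> H']
  show "(\<lambda>m. ex (\<tau> + 2 * z) ^ m * fourier_jacobi c m \<tau> (z + \<tau>) * ex \<tau>' ^ m) sums \<Phi> (period_matrix \<tau> z \<tau>')"
    unfolding siegel_elliptic[OF \<Phi> \<tau> H] by (simp add: power_mult_distrib mult_ac)
qed

lemma jac_jfps: "jac 0 (m + k) (jfps m * KAP ^ k)"
proof -
  have K: "jac k k (KAP ^ k)" using jac_power[OF jac_KAP, of k] by simp
  note cK = jac_conv[OF K]
  show ?thesis unfolding jac_def
  proof (intro conjI allI impI)
    show "conv (jfps m * KAP ^ k)" by (intro conv_intros conv_jfps conv_KAP)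
    fix \<tau> z :: complex assume \<tau>: "Im \<tau> > 0"
    have "ev (jfps m * KAP ^ k) (ex (- 1 / \<tau>)) (xx (z / \<tau>)) =
        fourier_jacobi c m (- 1 / \<tau>) (z / \<tau>) * ev (KAP ^ k) (ex (- 1 / \<tau>)) (xx (z / \<tau>))"
      using ev_mult[OF conv_jfps cK norm_ex_less_1[OF Im_S[OF \<tau>]]] ev_jfps[OF Im_S[OF \<tau>]] by simp
    also have "\<dots> = ex (z\<^sup>2 / \<tau>) ^ m * fourier_jacobi c m \<tau> z * (\<tau> ^ (2 * k) * ev (KAP ^ k) (ex (- 1 / \<tau>)) (xx (z / \<tau>)))"
      unfolding fourier_jacobi_S[OF \<tau>] by (simp only: mult_ac)
    also have "\<dots> = ex (z\<^sup>2 / \<tau>) ^ (m + k) * ev (jfps m * KAP ^ k) (ex \<tau>) (xx z)"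
      unfolding jac_S[OF K \<tau>] using \<tau> by (simp add: ev_mult[OF conv_jfps cK] ev_jfps power_add)
    finally show "\<tau> ^ (2 * 0) * ev (jfps m * KAP ^ k) (ex (- 1 / \<tau>)) (xx (z / \<tau>)) =
       ex (z\<^sup>2 / \<tau>) ^ (m + k) * ev (jfps m * KAP ^ k) (ex \<tau>) (xx z)" by (simp del: divide_minus_left)
    show "ex (\<tau> + 2 * z) ^ (m + k) * ev (jfps m * KAP ^ k) (ex \<tau>) (xx (z + \<tau>)) = ev (jfps m * KAP ^ k) (ex \<tau>) (xx z)"
      using \<tau> jac_elliptic[OF K \<tau>, of z, symmetric] fourier_jacobi_elliptic[OF \<tau>, of z m, symmetric]
      by (simp add: ev_mult[OF conv_jfps cK] ev_jfps power_add)
  qed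
qed

lemma ipoly_jfps_iff: "ipoly (fps_nth (jfps m) n) \<longleftrightarrow> (\<forall>l. l\<^sup>2 \<le> 4 * int n * int m \<longrightarrow> c n l m \<in> \<int>)"
proof
  assume *: "ipoly (fps_nth (jfps m) n)"
  show "\<forall>l. l\<^sup>2 \<le> 4 * int n * int m \<longrightarrow> c n l m \<in> \<int>"
  proof (intro allI impI)
    fix l assume l: "l\<^sup>2 \<le> 4 * int n * int m"
    then have "l \<in> lset n m" by (simp add: lset_def)
    then have "l \<in> {- int (4 * n * m)..int (4 * n * m)}" using lset_subset by blast
    then have "nat \<bar>l\<bar> \<le> 4 * n * m" unfolding atLeastAtMost_iff by linarith
    with * have "jcoeff m n (nat \<bar>l\<bar>) \<in> \<int>" by (auto simp: jfps_def intro: ipoly_even_laurentD)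
    moreover have "jcoeff m n (nat \<bar>l\<bar>) = c n l m"
      using l coeff_minus[OF l] by (auto simp: jcoeff_def lset_def abs_if)
    ultimately show "c n l m \<in> \<int>" by simp
  qed
next
  assume "\<forall>l. l\<^sup>2 \<le> 4 * int n * int m \<longrightarrow> c n l m \<in> \<int>"
  then show "ipoly (fps_nth (jfps m) n)"
    by (auto simp: jfps_def jcoeff_def lset_def intro!: ipoly_even_laurent)
qed

end

section \<open>Integrality before and after multiplication by powers of \<open>KAP\<close>\<close>

lemma ipoly_monom_mult_iff: "ipoly (monom 1 k * p) \<longleftrightarrow> ipoly p"
proof
  assume *: "ipoly (monom 1 k * p)"
  show "ipoly p"
    unfolding ipoly_def
  proof
    fix i
    have "coeff (monom 1 k * p) (i + k) \<in> \<int>" using * by (auto simp: ipoly_def)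
    then show "coeff p i \<in> \<int>" by (simp add: coeff_monom_mult)
  qed
qed (simp add: ipoly_def coeff_monom_mult)

text \<open>A constant term 1 makes the system for the coefficients unitriangular. It is stated up
  to order N because initially only a range of coefficients is known to be integral.\<close>

lemma ipoly_nth_mult_unit_iff:
  assumes V: "ifps V" "fps_nth V 0 = 1"
  shows "(\<forall>n\<le>N. ipoly (fps_nth (A * V) n)) \<longleftrightarrow> (\<forall>n\<le>N. ipoly (fps_nth A n))"
proof
  assume A: "\<forall>n\<le>N. ipoly (fps_nth A n)"
  show "\<forall>n\<le>N. ipoly (fps_nth (A * V) n)"
    unfolding fps_mult_nth using A V(1) by (auto intro!: ipoly_sum ipoly_mult simp: ifps_def)
next
  assume AV: "\<forall>n\<le>N. ipoly (fps_nth (A * V) n)"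
  have "n \<le> N \<Longrightarrow> ipoly (fps_nth A n)" for n
  proof (induction n rule: less_induct)
    case (less n)
    have "fps_nth (A * V) n = (\<Sum>i<n. fps_nth A i * fps_nth V (n - i)) + fps_nth A n"
      by (simp add: fps_mult_nth atLeast0AtMost lessThan_Suc_atMost[symmetric] V(2))
    then have "fps_nth A n = fps_nth (A * V) n - (\<Sum>i<n. fps_nth A i * fps_nth V (n - i))" by simp
    moreover have "ipoly (\<Sum>i<n. fps_nth A i * fps_nth V (n - i))"
      using less V(1) by (auto intro!: ipoly_sum ipoly_mult simp: ifps_def)
    ultimately show ?case using AV less.prems by (auto intro: ipoly_diff)
  qed
  then show "\<forall>n\<le>N. ipoly (fps_nth A n)" by blast
qed

text \<open>\<open>KAP ^ k\<close> is the monomial X^k, which merely shifts coefficients, times a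
  unit of the integral power series.\<close>

lemma ipoly_nth_mult_KAP_iff:
  "(\<forall>n\<le>N. ipoly (fps_nth (A * KAP ^ k) n)) \<longleftrightarrow> (\<forall>n\<le>N. ipoly (fps_nth A n))"
proof -
  have "KAP ^ k = fps_const (monom 1 k) * (KK ^ 2) ^ k"
  proof -
    have "fps_const ([:0, 1:] :: complex poly) ^ k = fps_const (monom 1 k)"
      by (simp add: fps_const_power monom_altdef)
    then show ?thesis by (simp add: KAP_def power_mult_distrib)
  qed
  then have e: "A * KAP ^ k = fps_const (monom 1 k) * (A * (KK ^ 2) ^ k)" by (simp only: mult_ac)
  have "ipoly (fps_nth (A * KAP ^ k) n) \<longleftrightarrow> ipoly (fps_nth (A * (KK ^ 2) ^ k) n)" for n
    unfolding e by (simp only: fps_mult_left_const_nth ipoly_monom_mult_iff)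
  moreover have "(\<forall>n\<le>N. ipoly (fps_nth (A * (KK ^ 2) ^ k) n)) \<longleftrightarrow> (\<forall>n\<le>N. ipoly (fps_nth A n))"
    by (rule ipoly_nth_mult_unit_iff) (auto intro!: ifps_power ifps_KK simp: fps_nth_power_0 nth_0_KK)
  ultimately show ?thesis by blast
qed

theorem theorem3p4:
  fixes k :: nat
    and \<Phi> :: "complex^2^2 \<Rightarrow> complex"
    and c :: "nat \<Rightarrow> int \<Rightarrow> nat \<Rightarrow> complex"
  assumes "siegel_modular_form (2 * k) \<Phi>"
    and "has_fourier_expansion \<Phi> c"
    and "\<And>n l m. \<lbrakk>m \<le> (k + 1) div 5; n \<le> (k + m) div 6; l\<^sup>2 \<le> 4 * int n * int m\<rbrakk>
           \<Longrightarrow> c n l m \<in> \<int>"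
  shows "\<forall>n l m. l\<^sup>2 \<le> 4 * int n * int m \<longrightarrow> c n l m \<in> \<int>"
proof -
  interpret siegel_expansion k \<Phi> c by standard (rule assms)+
  have "\<forall>n l. l\<^sup>2 \<le> 4 * int n * int m \<longrightarrow> c n l m \<in> \<int>" for m
  proof (induction m rule: less_induct)
    case (less m)
    have "ipoly (fps_nth (jfps m) n)" if n: "n \<le> (m + k) div 6" for n
    proof (cases "m \<le> (k + 1) div 5")
      case True
      then show ?thesis using assms(3)[of m n] n by (auto simp: ipoly_jfps_iff add.commute)
    next
      case False
      then have "n < m" using n by linarith
      show ?thesis unfolding ipoly_jfps_iff
      proof (intro allI impI)
        fix l assume l: "l\<^sup>2 \<le> 4 * int n * int m"
        then have "l\<^sup>2 \<le> 4 * int m * int n" by (simp add: mult_ac)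
        then have "c m l n \<in> \<int>" using less.IH[OF \<open>n < m\<close>] by blast
        then show "c n l m \<in> \<int>" using coeff_swap[OF l] by simp
      qed
    qed
    then have "ipoly (fps_nth (jfps m * KAP ^ k) n)" if "n \<le> (m + k) div 6" for n
      using that ipoly_nth_mult_KAP_iff by blast
    then have "ifps (jfps m * KAP ^ k)" by (rule jac_integral[OF jac_jfps])
    then have "ipoly (fps_nth (jfps m) n)" for n
      using ipoly_nth_mult_KAP_iff[of n "jfps m" k] by (auto simp: ifps_def)
    then show ?case by (simp add: ipoly_jfps_iff)
  qed
  then show ?thesis by blast
qed

end
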